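(* Given a groupoid $\mathcal{G}$ and any family $\mathcal{K}=\{K_x\}_{x\in\mathcal{G}}$ of groups indexed by the objects of $\mathcal{G}$, there is a bijection $$H^2_{\mathrm{Aut}(\mathcal{K})}(\mathcal{G},\mathcal{K})\cong\big[\mathrm{Ner}(\mathcal{G}),\mathrm{Ner}\big(\mathsf{AUT}(\mathcal{K})\big)\big],$$ where $\mathsf{AUT}(\mathcal{K})$ is the 2-groupoid with objects the groups $K_x\in\mathcal{K}$, 1-cells their group isomorphisms (regarded as functors), and 2-cells the natural transformations between them, and the square brackets mean homotopy classes of simplicial maps.
   Context: Groupoids and 2-categories are small; 2-categories are strict; a 2-groupoid is a 2-category in which all 1-cells and 2-cells are invertible. A groupoid $\mathcal{G}$ is regarded as a 2-groupoid with only identity 2-cells. In $\mathsf{AUT}(\mathcal{K})$ each group $K_x$ is regarded as a one-object groupoid; the 1-cells $K_x\to K_y$ are the group isomorphisms, and a 2-cell $u\Rightarrow v$ between isomorphisms $u,v:K_x\to K_y$ is a natural transformation, i.e. an element $k\in K_y$ with $v(a)k=k\,u(a)$ for all $a\in K_x$. All lax 2-functors are normal, and the structure 2-cells have the following direction. A lax 2-functor $F:\mathbf{A}\to\mathbf{B}$ consists of a map on objects; functors $\mathbf{A}(A,B)\to\mathbf{B}(F(A),F(B))$ on hom-categories; and, for each composable pair $A_0\xrightarrow{f}A_1\xrightarrow{g}A_2$ in $\mathbf{A}$, a 2-cell $\sigma^F_{(f,g)}:F(gf)\Rightarrow F(g)F(f)$, natural in $f$ and $g$. These satisfy associativity coherence,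 $(\sigma^F_{(g,k)}F(f))\circ\sigma^F_{(f,kg)}=(F(k)\sigma^F_{(f,g)})\circ\sigma^F_{(gf,k)}$, and normality: $F(1_A)=1_{F(A)}$, the structural transformation for identities is an identity, and $\sigma^F_{(f,g)}$ is an identity whenever $f$ or $g$ is an identity 1-cell. Lax 2-functors compose, with $\sigma^{GF}_{(f,g)}=\sigma^{G}_{(F(f),F(g))}\circ G(\sigma^F_{(f,g)})$. A lax 2-natural transformation $\alpha:F\to G$ consists of 1-cells $\alpha_A:F(A)\to G(A)$ and 2-cells $s_f:\alpha_BF(f)\Rightarrow G(f)\alpha_A$ for $f:A\to B$, natural in $f$ with respect to 2-cells, with $s_{1_A}$ an identity, and with $(\sigma^G_{(f,g)}\alpha_A)\circ s_{gf}=(G(g)s_f)\circ(s_gF(f))\circ(\alpha_C\sigma^F_{(f,g)})$ for $A\xrightarrow{f}B\xrightarrow{g}C$. Lax 2-functors $\mathbf{A}\to\mathbf{B}$ and lax 2-natural transformations form a category $\mathsf{LaxFun}(\mathbf{A},\mathbf{B})$, and $\mathsf{LaxFun}[\mathbf{A},\mathbf{B}]$ denotes its set of connected components. The 2-cohomology of $\mathcal{G}$ with coefficients in $\mathcal{K}$ is the set $$H^2_{\mathrm{Aut}(\mathcal{K})}(\mathcal{G},\mathcal{K})=\mathsf{LaxFun}_*[\mathcal{G},\mathsf{AUT}(\mathcal{K})]$$ of connected components of lax 2-functors $\mathcal{G}\to\mathsf{AUT}(\mathcal{K})$ which are the identity on objects (i.e. send each object $x$ of $\mathcal{G}$ to $K_x$).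 The geometric nerve of a 2-category $\mathbf{A}$ is the simplicial set $\mathrm{Ner}(\mathbf{A})$ whose $n$-simplices are the lax 2-functors $[n]\to\mathbf{A}$ (where $[n]=\{0\le\dots\le n\}$ is regarded as a 2-category with only identity 2-cells), with simplicial operators given by precomposition; on a groupoid it is the usual nerve. $[X,Y]$ denotes the set of homotopy classes of simplicial maps $X\to Y$.
   Formalization: The right-hand side is restricted to homotopy classes containing a simplicial map that sends each vertex x to K_x; without this the claim fails (connected G with non-isomorphic K_x, K_y has empty H^2 but constant maps exist). For pairwise isomorphic K_x the restriction is vacuous. *)

theory Defs
  imports "HOL-Algebra.Group"
begin

section \<open>Categories and groupoids\<close>

text \<open>Composition is written in the usual order: \<open>Comp C g f\<close> is \<open>gf\<close>. The operations are only
  meaningful on objects, and on composable arrows, of the category.\<close>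

record ('o, 'm) cat =
  Ob :: "'o set"
  Ar :: "'m set"
  Dom :: "'m \<Rightarrow> 'o"
  Cod :: "'m \<Rightarrow> 'o"
  One :: "'o \<Rightarrow> 'm"
  Comp :: "'m \<Rightarrow> 'm \<Rightarrow> 'm"

definition composable :: "('o, 'm, 'x) cat_scheme \<Rightarrow> ('m \<times> 'm) set" where
  "composable C = {(f, g). f \<in> Ar C \<and> g \<in> Ar C \<and> Cod C f = Dom C g}"

locale category =
  fixes C :: "('o, 'm, 'x) cat_scheme"
  assumes Dom_in: "f \<in> Ar C \<Longrightarrow> Dom C f \<in> Ob C"
    and Cod_in: "f \<in> Ar C \<Longrightarrow> Cod C f \<in> Ob C"
    and One_in: "a \<in> Ob C \<Longrightarrow> One C a \<in> Ar C \<and> Dom C (One C a) = a \<and> Cod C (One C a) = a"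
    and Comp_in: "(f, g) \<in> composable C \<Longrightarrow>
      Comp C g f \<in> Ar C \<and> Dom C (Comp C g f) = Dom C f \<and> Cod C (Comp C g f) = Cod C g"
    and Comp_One: "f \<in> Ar C \<Longrightarrow> Comp C f (One C (Dom C f)) = f"
    and One_Comp: "f \<in> Ar C \<Longrightarrow> Comp C (One C (Cod C f)) f = f"
    and Comp_assoc: "(f, g) \<in> composable C \<Longrightarrow> (g, k) \<in> composable C \<Longrightarrow>
      Comp C k (Comp C g f) = Comp C (Comp C k g) f"

locale groupoid = category C for C :: "('o, 'm, 'x) cat_scheme" +
  assumes inverse: "f \<in> Ar C \<Longrightarrow> \<exists>g\<in>Ar C. Dom C g = Cod C f \<and> Cod C g = Dom C f \<and>
      Comp C g f = One C (Dom C f) \<and> Comp C f g = One C (Cod C f)"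


section \<open>Strict 2-categories and 2-groupoids\<close>

text \<open>\<open>VComp A b a\<close> is the vertical composite \<open>b \<circ> a\<close> (first \<open>a\<close>, then \<open>b\<close>). \<open>HComp A b a\<close> is the
  horizontal composite of \<open>a : f \<Rightarrow> f'\<close> and \<open>b : g \<Rightarrow> g'\<close>, a 2-cell \<open>gf \<Rightarrow> g'f'\<close>.\<close>

record ('o, 'm, 'c) cat2 = "('o, 'm) cat" +
  Cell :: "'c set"
  Src :: "'c \<Rightarrow> 'm"
  Trg :: "'c \<Rightarrow> 'm"
  Id2 :: "'m \<Rightarrow> 'c"
  VComp :: "'c \<Rightarrow> 'c \<Rightarrow> 'c"
  HComp :: "'c \<Rightarrow> 'c \<Rightarrow> 'c"

definition vcomposable :: "('o, 'm, 'c, 'x) cat2_scheme \<Rightarrow> ('c \<times> 'c) set" where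
  "vcomposable A = {(a, b). a \<in> Cell A \<and> b \<in> Cell A \<and> Trg A a = Src A b}"

definition hcomposable :: "('o, 'm, 'c, 'x) cat2_scheme \<Rightarrow> ('c \<times> 'c) set" where
  "hcomposable A = {(a, b). a \<in> Cell A \<and> b \<in> Cell A \<and> Cod A (Src A a) = Dom A (Src A b)}"

abbreviation whisker_left :: "('o, 'm, 'c, 'x) cat2_scheme \<Rightarrow> 'm \<Rightarrow> 'c \<Rightarrow> 'c" where
  "whisker_left A g a \<equiv> HComp A (Id2 A g) a"

abbreviation whisker_right :: "('o, 'm, 'c, 'x) cat2_scheme \<Rightarrow> 'c \<Rightarrow> 'm \<Rightarrow> 'c" where
  "whisker_right A b f \<equiv> HComp A b (Id2 A f)"

locale two_category = category A for A :: "('o, 'm, 'c, 'x) cat2_scheme" +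
  assumes Src_in: "a \<in> Cell A \<Longrightarrow> Src A a \<in> Ar A"
    and Trg_in: "a \<in> Cell A \<Longrightarrow> Trg A a \<in> Ar A"
    and parallel: "a \<in> Cell A \<Longrightarrow> Dom A (Src A a) = Dom A (Trg A a) \<and> Cod A (Src A a) = Cod A (Trg A a)"
    and Id2_in: "f \<in> Ar A \<Longrightarrow> Id2 A f \<in> Cell A \<and> Src A (Id2 A f) = f \<and> Trg A (Id2 A f) = f"
    and VComp_in: "(a, b) \<in> vcomposable A \<Longrightarrow>
      VComp A b a \<in> Cell A \<and> Src A (VComp A b a) = Src A a \<and> Trg A (VComp A b a) = Trg A b"
    and VComp_Id2: "a \<in> Cell A \<Longrightarrow> VComp A a (Id2 A (Src A a)) = a"
    and Id2_VComp: "a \<in> Cell A \<Longrightarrow> VComp A (Id2 A (Trg A a)) a = a"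
    and VComp_assoc: "(a, b) \<in> vcomposable A \<Longrightarrow> (b, c) \<in> vcomposable A \<Longrightarrow>
      VComp A c (VComp A b a) = VComp A (VComp A c b) a"
    and HComp_in: "(a, b) \<in> hcomposable A \<Longrightarrow> HComp A b a \<in> Cell A \<and>
      Src A (HComp A b a) = Comp A (Src A b) (Src A a) \<and>
      Trg A (HComp A b a) = Comp A (Trg A b) (Trg A a)"
    and HComp_Id2: "(f, g) \<in> composable A \<Longrightarrow> HComp A (Id2 A g) (Id2 A f) = Id2 A (Comp A g f)"
    and interchange: "(a, a') \<in> vcomposable A \<Longrightarrow> (b, b') \<in> vcomposable A \<Longrightarrow> (a, b) \<in> hcomposable A \<Longrightarrow>
      HComp A (VComp A b' b) (VComp A a' a) = VComp A (HComp A b' a') (HComp A b a)"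
    and HComp_One: "a \<in> Cell A \<Longrightarrow> HComp A a (Id2 A (One A (Dom A (Src A a)))) = a"
    and One_HComp: "a \<in> Cell A \<Longrightarrow> HComp A (Id2 A (One A (Cod A (Src A a)))) a = a"
    and HComp_assoc: "(a, b) \<in> hcomposable A \<Longrightarrow> (b, c) \<in> hcomposable A \<Longrightarrow>
      HComp A c (HComp A b a) = HComp A (HComp A c b) a"

locale two_groupoid = two_category A + groupoid A for A :: "('o, 'm, 'c, 'x) cat2_scheme" +
  assumes vinverse: "a \<in> Cell A \<Longrightarrow> \<exists>b\<in>Cell A. Src A b = Trg A a \<and> Trg A b = Src A a \<and>
      VComp A b a = Id2 A (Src A a) \<and> VComp A a b = Id2 A (Trg A a)"

text \<open>A category as a 2-category with only identity 2-cells; the identity 2-cell of an arrow is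
  represented by the arrow itself.\<close>

definition locally_discrete :: "('o, 'm) cat \<Rightarrow> ('o, 'm, 'm) cat2" where
  "locally_discrete C =
     \<lparr> Ob = Ob C, Ar = Ar C, Dom = Dom C, Cod = Cod C, One = One C, Comp = Comp C,
       Cell = Ar C, Src = (\<lambda>f. f), Trg = (\<lambda>f. f), Id2 = (\<lambda>f. f),
       VComp = (\<lambda>b a. a), HComp = Comp C \<rparr>"


section \<open>Normal lax 2-functors\<close>

text \<open>All components are \<open>undefined\<close> outside their domains, so that equality of records is
  equality of lax 2-functors. The structure 2-cell \<open>fstr F (f, g)\<close> is \<open>\<sigma>\<^sub>(\<^sub>f\<^sub>,\<^sub>g\<^sub>) : F(gf) \<Rightarrow> F(g)F(f)\<close>;
  its first index is the arrow applied first.\<close>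

record ('o, 'm, 'c, 'p, 'n, 'd) laxfun =
  fob :: "'o \<Rightarrow> 'p"
  far :: "'m \<Rightarrow> 'n"
  fcell :: "'c \<Rightarrow> 'd"
  fstr :: "'m \<times> 'm \<Rightarrow> 'd"

locale lax_functor =
  fixes A :: "('o, 'm, 'c) cat2" and B :: "('p, 'n, 'd) cat2"
    and F :: "('o, 'm, 'c, 'p, 'n, 'd) laxfun"
  assumes ob: "fob F \<in> Ob A \<rightarrow>\<^sub>E Ob B"
    and ar: "far F \<in> Ar A \<rightarrow>\<^sub>E Ar B"
    and cell: "fcell F \<in> Cell A \<rightarrow>\<^sub>E Cell B"
    and str: "fstr F \<in> composable A \<rightarrow>\<^sub>E Cell B"
    and ar_Dom: "f \<in> Ar A \<Longrightarrow> Dom B (far F f) = fob F (Dom A f)"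
    and ar_Cod: "f \<in> Ar A \<Longrightarrow> Cod B (far F f) = fob F (Cod A f)"
    and cell_Src: "a \<in> Cell A \<Longrightarrow> Src B (fcell F a) = far F (Src A a)"
    and cell_Trg: "a \<in> Cell A \<Longrightarrow> Trg B (fcell F a) = far F (Trg A a)"
    and cell_Id2: "f \<in> Ar A \<Longrightarrow> fcell F (Id2 A f) = Id2 B (far F f)"
    and cell_VComp: "(a, b) \<in> vcomposable A \<Longrightarrow>
      fcell F (VComp A b a) = VComp B (fcell F b) (fcell F a)"
    and str_Src: "(f, g) \<in> composable A \<Longrightarrow> Src B (fstr F (f, g)) = far F (Comp A g f)"
    and str_Trg: "(f, g) \<in> composable A \<Longrightarrow> Trg B (fstr F (f, g)) = Comp B (far F g) (far F f)"
    and str_natural: "(a, b) \<in> hcomposable A \<Longrightarrow>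
      VComp B (fstr F (Trg A a, Trg A b)) (fcell F (HComp A b a)) =
      VComp B (HComp B (fcell F b) (fcell F a)) (fstr F (Src A a, Src A b))"
    and str_assoc: "(f, g) \<in> composable A \<Longrightarrow> (g, k) \<in> composable A \<Longrightarrow>
      VComp B (whisker_right B (fstr F (g, k)) (far F f)) (fstr F (f, Comp A k g)) =
      VComp B (whisker_left B (far F k) (fstr F (f, g))) (fstr F (Comp A g f, k))"
    and normal_One: "x \<in> Ob A \<Longrightarrow> far F (One A x) = One B (fob F x)"
    and normal_left: "f \<in> Ar A \<Longrightarrow> fstr F (f, One A (Cod A f)) = Id2 B (far F f)"
    and normal_right: "f \<in> Ar A \<Longrightarrow> fstr F (One A (Dom A f), f) = Id2 B (far F f)"

text \<open>The composite \<open>GF\<close> of \<open>F : A \<rightarrow> B\<close> and \<open>G : B \<rightarrow> C\<close>.\<close>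

definition lax_comp :: "('o, 'm, 'c) cat2 \<Rightarrow> ('q, 'r, 's) cat2 \<Rightarrow>
    ('p, 'n, 'd, 'q, 'r, 's) laxfun \<Rightarrow> ('o, 'm, 'c, 'p, 'n, 'd) laxfun \<Rightarrow>
    ('o, 'm, 'c, 'q, 'r, 's) laxfun" where
  "lax_comp A C G F =
     \<lparr> fob = (\<lambda>x\<in>Ob A. fob G (fob F x)),
       far = (\<lambda>f\<in>Ar A. far G (far F f)),
       fcell = (\<lambda>a\<in>Cell A. fcell G (fcell F a)),
       fstr = (\<lambda>(f, g)\<in>composable A.
         VComp C (fstr G (far F f, far F g)) (fcell G (fstr F (f, g)))) \<rparr>"

text \<open>A lax 2-natural transformation \<open>F \<rightarrow> G\<close> with 1-cells \<open>\<alpha> x : F(x) \<rightarrow> G(x)\<close> and 2-cells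
  \<open>s f : \<alpha> y F(f) \<Rightarrow> G(f) \<alpha> x\<close> for \<open>f : x \<rightarrow> y\<close>.\<close>

locale lax_transformation =
  fixes A :: "('o, 'm, 'c) cat2" and B :: "('p, 'n, 'd) cat2"
    and F G :: "('o, 'm, 'c, 'p, 'n, 'd) laxfun"
    and \<alpha> :: "'o \<Rightarrow> 'n" and s :: "'m \<Rightarrow> 'd"
  assumes ar_ext: "\<alpha> \<in> Ob A \<rightarrow>\<^sub>E Ar B"
    and ar_Dom: "x \<in> Ob A \<Longrightarrow> Dom B (\<alpha> x) = fob F x"
    and ar_Cod: "x \<in> Ob A \<Longrightarrow> Cod B (\<alpha> x) = fob G x"
    and cell_ext: "s \<in> Ar A \<rightarrow>\<^sub>E Cell B"
    and cell_Src: "f \<in> Ar A \<Longrightarrow> Src B (s f) = Comp B (\<alpha> (Cod A f)) (far F f)"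
    and cell_Trg: "f \<in> Ar A \<Longrightarrow> Trg B (s f) = Comp B (far G f) (\<alpha> (Dom A f))"
    and natural: "a \<in> Cell A \<Longrightarrow>
      VComp B (s (Trg A a)) (whisker_left B (\<alpha> (Cod A (Src A a))) (fcell F a)) =
      VComp B (whisker_right B (fcell G a) (\<alpha> (Dom A (Src A a)))) (s (Src A a))"
    and cell_One: "x \<in> Ob A \<Longrightarrow> s (One A x) = Id2 B (\<alpha> x)"
    and coherence: "(f, g) \<in> composable A \<Longrightarrow>
      VComp B (whisker_right B (fstr G (f, g)) (\<alpha> (Dom A f))) (s (Comp A g f)) =
      VComp B (whisker_left B (far G g) (s f))
        (VComp B (whisker_right B (s g) (far F f))
          (whisker_left B (\<alpha> (Cod A g)) (fstr F (f, g))))"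

text \<open>The set of classes of the equivalence relation on \<open>S\<close> generated by the relation \<open>R\<close>
  restricted to \<open>S\<close>.\<close>

definition components :: "'a set \<Rightarrow> ('a \<Rightarrow> 'a \<Rightarrow> bool) \<Rightarrow> 'a set set" where
  "components S R =
     S // {(x, y). x \<in> S \<and> y \<in> S \<and> equivclp (\<lambda>a b. a \<in> S \<and> b \<in> S \<and> R a b) x y}"


section \<open>The 2-groupoid of a set of groups and 2-cohomology\<close>

text \<open>A 1-cell is a triple \<open>(H, u, L)\<close> with \<open>u : H \<rightarrow> L\<close> an isomorphism of groups, \<open>undefined\<close>
  outside the carrier of \<open>H\<close>. A 2-cell is a triple \<open>(u, k, v)\<close> consisting of parallel 1-cells and
  the component \<open>k\<close> of a natural transformation from \<open>u\<close> to \<open>v\<close>.\<close>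

type_synonym 'k aut1 = "'k monoid \<times> ('k \<Rightarrow> 'k) \<times> 'k monoid"
type_synonym 'k aut2 = "'k aut1 \<times> 'k \<times> 'k aut1"

definition aut_comp :: "'k aut1 \<Rightarrow> 'k aut1 \<Rightarrow> 'k aut1" where
  "aut_comp = (\<lambda>(_, v, M) (H, u, _). (H, compose (carrier H) v u, M))"

definition AUT :: "'k monoid set \<Rightarrow> ('k monoid, 'k aut1, 'k aut2) cat2" where
  "AUT S =
     \<lparr> Ob = S,
       Ar = {(H, u, L). H \<in> S \<and> L \<in> S \<and> u \<in> iso H L \<inter> extensional (carrier H)},
       Dom = (\<lambda>(H, u, L). H),
       Cod = (\<lambda>(H, u, L). L),
       One = (\<lambda>H. (H, \<lambda>a\<in>carrier H. a, H)),
       Comp = aut_comp,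
       Cell = {((H, u, L), k, (H', v, L')). H = H' \<and> L = L' \<and> H \<in> S \<and> L \<in> S \<and>
         u \<in> iso H L \<inter> extensional (carrier H) \<and> v \<in> iso H L \<inter> extensional (carrier H) \<and>
         k \<in> carrier L \<and> (\<forall>a\<in>carrier H. v a \<otimes>\<^bsub>L\<^esub> k = k \<otimes>\<^bsub>L\<^esub> u a)},
       Src = (\<lambda>(u, k, v). u),
       Trg = (\<lambda>(u, k, v). v),
       Id2 = (\<lambda>(H, u, L). ((H, u, L), \<one>\<^bsub>L\<^esub>, (H, u, L))),
       VComp = (\<lambda>(_, l, w) ((H, u, L), k, _). ((H, u, L), l \<otimes>\<^bsub>L\<^esub> k, w)),
       HComp = (\<lambda>((L, v, M), l, v') (u, k, u').
         (aut_comp (L, v, M) u, l \<otimes>\<^bsub>M\<^esub> v k, aut_comp v' u')) \<rparr>"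

definition LaxFun_over :: "('o, 'm) cat \<Rightarrow> ('o \<Rightarrow> 'k monoid) \<Rightarrow>
    ('o, 'm, 'm, 'k monoid, 'k aut1, 'k aut2) laxfun set" where
  "LaxFun_over G K = {F. lax_functor (locally_discrete G) (AUT (K ` Ob G)) F \<and>
     (\<forall>x\<in>Ob G. fob F x = K x)}"

definition H2 :: "('o, 'm) cat \<Rightarrow> ('o \<Rightarrow> 'k monoid) \<Rightarrow>
    ('o, 'm, 'm, 'k monoid, 'k aut1, 'k aut2) laxfun set set" where
  "H2 G K = components (LaxFun_over G K)
     (\<lambda>E F. \<exists>\<alpha> s. lax_transformation (locally_discrete G) (AUT (K ` Ob G)) E F \<alpha> s)"


section \<open>Simplicial sets and homotopy classes of simplicial maps\<close>

text \<open>The morphisms \<open>[m] \<rightarrow> [n]\<close> of the simplex category, \<open>undefined\<close> above \<open>m\<close>.\<close>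

definition simplex_maps :: "nat \<Rightarrow> nat \<Rightarrow> (nat \<Rightarrow> nat) set" where
  "simplex_maps m n = {\<theta> \<in> {..m} \<rightarrow>\<^sub>E {..n}. mono_on {..m} \<theta>}"

text \<open>\<open>act X m n \<theta>\<close> is the operator \<open>X\<^sub>n \<rightarrow> X\<^sub>m\<close> induced by \<open>\<theta> : [m] \<rightarrow> [n]\<close>.\<close>

record 's sset =
  Simp :: "nat \<Rightarrow> 's set"
  act :: "nat \<Rightarrow> nat \<Rightarrow> (nat \<Rightarrow> nat) \<Rightarrow> 's \<Rightarrow> 's"

locale simplicial_set =
  fixes X :: "'s sset"
  assumes act_in: "\<theta> \<in> simplex_maps m n \<Longrightarrow> x \<in> Simp X n \<Longrightarrow> act X m n \<theta> x \<in> Simp X m"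
    and act_id: "x \<in> Simp X n \<Longrightarrow> act X n n (\<lambda>i\<in>{..n}. i) x = x"
    and act_comp: "\<eta> \<in> simplex_maps l m \<Longrightarrow> \<theta> \<in> simplex_maps m n \<Longrightarrow> x \<in> Simp X n \<Longrightarrow>
      act X l n (compose {..l} \<theta> \<eta>) x = act X l m \<eta> (act X m n \<theta> x)"

definition simplicial_map :: "'s sset \<Rightarrow> 't sset \<Rightarrow> (nat \<Rightarrow> 's \<Rightarrow> 't) \<Rightarrow> bool" where
  "simplicial_map X Y \<phi> \<longleftrightarrow> (\<forall>n. \<phi> n \<in> Simp X n \<rightarrow>\<^sub>E Simp Y n) \<and>
     (\<forall>m n. \<forall>\<theta>\<in>simplex_maps m n. \<forall>x\<in>Simp X n. \<phi> m (act X m n \<theta> x) = act Y m n \<theta> (\<phi> n x))"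

definition standard_simplex :: "nat \<Rightarrow> (nat \<Rightarrow> nat) sset" where
  "standard_simplex p =
     \<lparr> Simp = (\<lambda>n. simplex_maps n p), act = (\<lambda>m n \<theta> \<tau>. compose {..m} \<tau> \<theta>) \<rparr>"

definition sset_prod :: "'s sset \<Rightarrow> 't sset \<Rightarrow> ('s \<times> 't) sset" where
  "sset_prod X Y =
     \<lparr> Simp = (\<lambda>n. Simp X n \<times> Simp Y n),
       act = (\<lambda>m n \<theta> (x, y). (act X m n \<theta> x, act Y m n \<theta> y)) \<rparr>"

definition homotopy :: "'s sset \<Rightarrow> 't sset \<Rightarrow> (nat \<Rightarrow> 's \<Rightarrow> 't) \<Rightarrow> (nat \<Rightarrow> 's \<Rightarrow> 't) \<Rightarrow>
    (nat \<Rightarrow> 's \<times> (nat \<Rightarrow> nat) \<Rightarrow> 't) \<Rightarrow> bool" where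
  "homotopy X Y \<phi> \<psi> H \<longleftrightarrow> simplicial_map (sset_prod X (standard_simplex 1)) Y H \<and>
     (\<forall>n. \<forall>x\<in>Simp X n. H n (x, \<lambda>i\<in>{..n}. 0) = \<phi> n x \<and> H n (x, \<lambda>i\<in>{..n}. 1) = \<psi> n x)"

definition homotopy_classes :: "'s sset \<Rightarrow> 't sset \<Rightarrow> (nat \<Rightarrow> 's \<Rightarrow> 't) set set" where
  "homotopy_classes X Y = components {\<phi>. simplicial_map X Y \<phi>} (\<lambda>\<phi> \<psi>. \<exists>H. homotopy X Y \<phi> \<psi> H)"


section \<open>The geometric nerve\<close>

definition ordinal_cat :: "nat \<Rightarrow> (nat, nat \<times> nat) cat" where
  "ordinal_cat n =
     \<lparr> Ob = {..n}, Ar = {(i, j). i \<le> j \<and> j \<le> n}, Dom = fst, Cod = snd,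
       One = (\<lambda>i. (i, i)), Comp = (\<lambda>g f. (fst f, snd g)) \<rparr>"

abbreviation ordinal :: "nat \<Rightarrow> (nat, nat \<times> nat, nat \<times> nat) cat2" where
  "ordinal n \<equiv> locally_discrete (ordinal_cat n)"

definition ordinal_map :: "nat \<Rightarrow> (nat \<Rightarrow> nat) \<Rightarrow>
    (nat, nat \<times> nat, nat \<times> nat, nat, nat \<times> nat, nat \<times> nat) laxfun" where
  "ordinal_map m \<theta> =
     \<lparr> fob = (\<lambda>i\<in>Ob (ordinal m). \<theta> i),
       far = (\<lambda>(i, j)\<in>Ar (ordinal m). (\<theta> i, \<theta> j)),
       fcell = (\<lambda>(i, j)\<in>Cell (ordinal m). (\<theta> i, \<theta> j)),
       fstr = (\<lambda>(f, g)\<in>composable (ordinal m). (\<theta> (fst f), \<theta> (snd g))) \<rparr>"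

type_synonym ('o, 'm, 'c) nerve_simplex = "(nat, nat \<times> nat, nat \<times> nat, 'o, 'm, 'c) laxfun"

definition Ner :: "('o, 'm, 'c) cat2 \<Rightarrow> ('o, 'm, 'c) nerve_simplex sset" where
  "Ner A =
     \<lparr> Simp = (\<lambda>n. {\<sigma>. lax_functor (ordinal n) A \<sigma>}),
       act = (\<lambda>m n \<theta> \<sigma>. lax_comp (ordinal m) A \<sigma> (ordinal_map m \<theta>)) \<rparr>"

text \<open>A 0-simplex \<open>\<sigma>\<close> of a nerve is the object \<open>fob \<sigma> 0\<close>; \<open>over_objects G K \<phi>\<close> says that the simplicial
  map \<open>\<phi>\<close> sends each vertex \<open>x\<close> to the vertex \<open>K x\<close>. It is the counterpart for simplicial maps of
  the condition \<open>fob F x = K x\<close> in \<open>LaxFun_over\<close>. Every homotopy class contains such a map if the groups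
  \<open>K x\<close> are pairwise isomorphic, in particular if \<open>G\<close> has one object, but not in general: if \<open>G\<close> is
  connected and \<open>K x\<close>, \<open>K y\<close> are not isomorphic, then \<open>H2 G K\<close> is empty, while there is a constant
  simplicial map. Homotopies may move the vertices, just as the lax 2-natural transformations in
  \<open>H2\<close> may have arbitrary 1-cells.\<close>

definition over_objects :: "('o, 'm) cat \<Rightarrow> ('o \<Rightarrow> 'k monoid) \<Rightarrow>
    (nat \<Rightarrow> ('o, 'm, 'm) nerve_simplex \<Rightarrow> ('k monoid, 'k aut1, 'k aut2) nerve_simplex) \<Rightarrow> bool" where
  "over_objects G K \<phi> \<longleftrightarrow>
     (\<forall>\<sigma>\<in>Simp (Ner (locally_discrete G)) 0. fob (\<phi> 0 \<sigma>) 0 = K (fob \<sigma> 0))"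

end

theory Submission
  imports Defs
begin

text \<open>
  A simplicial map into the nerve of a 2-category is determined by what it does to vertices,
  edges and triangles, and the 3-simplices say exactly that these data satisfy the associativity
  coherence; hence the nerve is full and faithful on normal lax 2-functors. A homotopy of nerve maps
  is a simplicial map on \<open>Ner(G) \<times> \<Delta>[1] = Ner(G \<times> [1])\<close>, that is, a lax 2-functor \<open>P\<close> on the cylinder
  \<open>G \<times> [1]\<close>. From \<open>P\<close> one reads off \<open>\<alpha> x = P(1, 0 < 1)\<close> and, 2-cells of the target being
  invertible, the composite \<open>s f : \<alpha> y F(f) \<Rightarrow> P(f, 0 < 1) \<Rightarrow> F'(f) \<alpha> x\<close> of an inverse structure 2-cell
  with a structure 2-cell; the 3-simplices of types \<open>0001\<close>, \<open>0011\<close> and \<open>0111\<close> yield the coherence of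
  \<open>s\<close>. For the target \<open>AUT\<close> all of this becomes a computation with factor sets in the sense of
  Schreier. Lax transformations into \<open>AUT\<close> can be inverted and composed, so a zigzag of homotopies
  that leaves the maps over the objects can be replaced by a single transformation.
\<close>

section \<open>Lax 2-functors on locally discrete 2-categories\<close>

text \<open>The value of \<open>P\<close> at the crossing arrow \<open>(f, (0, 1))\<close> is an
  arrow of its own, and both structure 2-cells to the composites around the square start there.
  Hence one of them has to be inverted before they compose, and the triangles of type 001 and 011
  have to be eliminated from the cocycle conditions. In the other direction a transformation leaves
  freedom in the choice of \<open>P\<close>. The cylinder built here sends the crossing arrow to
  \<open>\<alpha> y F(f)\<close> itself; the 2-cell to be inverted then becomes an identity and the
  other one is \<open>s f\<close>. Passing to factor sets also removes extensionality from the
  algebra: maps are constrained on carriers only, so inverses and composites of transformations are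
  plain functions, and values are cut off only on returning to \<open>AUT\<close>. Since homotopies
  move vertices, functors and simplicial maps are compared without any condition on objects; that
  condition enters at the end, where it selects components.\<close>

lemma locally_discrete_simps [simp]:
  "Ob (locally_discrete C) = Ob C" "Ar (locally_discrete C) = Ar C"
  "Dom (locally_discrete C) = Dom C" "Cod (locally_discrete C) = Cod C"
  "One (locally_discrete C) = One C" "Comp (locally_discrete C) = Comp C"
  "Cell (locally_discrete C) = Ar C" "Src (locally_discrete C) f = f"
  "Trg (locally_discrete C) f = f" "Id2 (locally_discrete C) f = f"
  "VComp (locally_discrete C) g f = f" "HComp (locally_discrete C) = Comp C"
  "composable (locally_discrete C) = composable C"
  "hcomposable (locally_discrete C) = composable C"
  "(f, g) \<in> vcomposable (locally_discrete C) \<longleftrightarrow> f \<in> Ar C \<and> g = f"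
  by (auto simp: locally_discrete_def composable_def hcomposable_def vcomposable_def)

context category
begin

lemma Comp_simps:
  assumes "(f, g) \<in> composable C"
  shows "f \<in> Ar C" "g \<in> Ar C" "Dom C g = Cod C f" "Comp C g f \<in> Ar C"
    "Dom C (Comp C g f) = Dom C f" "Cod C (Comp C g f) = Cod C g"
  using Comp_in[OF assms] assms by (auto simp: composable_def)

lemma composable_Comp:
  assumes "(f, g) \<in> composable C" "(g, k) \<in> composable C"
  shows "(f, Comp C k g) \<in> composable C" "(Comp C g f, k) \<in> composable C"
  using Comp_simps[OF assms(1)] Comp_simps[OF assms(2)] by (auto simp: composable_def)

lemma composable_One:
  assumes "f \<in> Ar C"
  shows "(f, One C (Cod C f)) \<in> composable C" "(One C (Dom C f), f) \<in> composable C"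
  using assms One_in[OF Dom_in[OF assms]] One_in[OF Cod_in[OF assms]]
  by (auto simp: composable_def)

end

lemma two_category_locally_discrete:
  assumes "category C"
  shows "two_category (locally_discrete C)"
proof -
  interpret C: category C by fact
  interpret L: category "locally_discrete C"
    by unfold_locales
      (auto simp: C.Dom_in C.Cod_in C.One_in C.Comp_in C.Comp_One C.One_Comp C.Comp_assoc)
  show ?thesis
    by unfold_locales
      (auto simp: C.Dom_in C.Cod_in C.One_in C.Comp_in C.Comp_One C.One_Comp C.Comp_assoc
        vcomposable_def)
qed

text \<open>The only 2-cells of the source are identities, so \<open>fcell\<close> is forced by
  \<open>cell_Id2\<close> and a lax 2-functor amounts to objects, arrows and structure 2-cells. The
  restrictions supply the \<open>undefined\<close> values that make equality of records
  meaningful.\<close>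

definition discrete_lax :: "('o, 'm) cat \<Rightarrow> ('p, 'n, 'd) cat2 \<Rightarrow> ('o \<Rightarrow> 'p) \<Rightarrow> ('m \<Rightarrow> 'n) \<Rightarrow>
    ('m \<times> 'm \<Rightarrow> 'd) \<Rightarrow> ('o, 'm, 'm, 'p, 'n, 'd) laxfun" where
  "discrete_lax C A b a s =
     \<lparr> fob = restrict b (Ob C), far = restrict a (Ar C), fcell = (\<lambda>f\<in>Ar C. Id2 A (a f)),
       fstr = restrict s (composable C) \<rparr>"

lemma discrete_lax_simps [simp]:
  "x \<in> Ob C \<Longrightarrow> fob (discrete_lax C A b a s) x = b x"
  "f \<in> Ar C \<Longrightarrow> far (discrete_lax C A b a s) f = a f"
  "p \<in> composable C \<Longrightarrow> fstr (discrete_lax C A b a s) p = s p"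
  by (simp_all add: discrete_lax_def)

text \<open>Functoriality on 2-cells and naturality of the structure 2-cells involve identities
  only, so the unit laws \<open>idem\<close> and \<open>unit\<close> settle them; the remaining laws
  are the hypotheses.\<close>

lemma lax_functor_discrete_laxI:
  assumes C: "category C" and A: "two_category A"
    and b: "\<And>x. x \<in> Ob C \<Longrightarrow> b x \<in> Ob A"
    and a: "\<And>f. f \<in> Ar C \<Longrightarrow> a f \<in> Ar A"
    and a_Dom: "\<And>f. f \<in> Ar C \<Longrightarrow> Dom A (a f) = b (Dom C f)"
    and a_Cod: "\<And>f. f \<in> Ar C \<Longrightarrow> Cod A (a f) = b (Cod C f)"
    and a_One: "\<And>x. x \<in> Ob C \<Longrightarrow> a (One C x) = One A (b x)"
    and s: "\<And>f g. (f, g) \<in> composable C \<Longrightarrow> s (f, g) \<in> Cell A"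
    and s_Src: "\<And>f g. (f, g) \<in> composable C \<Longrightarrow> Src A (s (f, g)) = a (Comp C g f)"
    and s_Trg: "\<And>f g. (f, g) \<in> composable C \<Longrightarrow> Trg A (s (f, g)) = Comp A (a g) (a f)"
    and s_assoc: "\<And>f g k. (f, g) \<in> composable C \<Longrightarrow> (g, k) \<in> composable C \<Longrightarrow>
      VComp A (whisker_right A (s (g, k)) (a f)) (s (f, Comp C k g)) =
      VComp A (whisker_left A (a k) (s (f, g))) (s (Comp C g f, k))"
    and s_left: "\<And>f. f \<in> Ar C \<Longrightarrow> s (f, One C (Cod C f)) = Id2 A (a f)"
    and s_right: "\<And>f. f \<in> Ar C \<Longrightarrow> s (One C (Dom C f), f) = Id2 A (a f)"
  shows "lax_functor (locally_discrete C) A (discrete_lax C A b a s)"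
proof -
  interpret C: category C by fact
  interpret A: two_category A by fact
  have comp: "(a f, a g) \<in> composable A" if "(f, g) \<in> composable C" for f g
    using C.Comp_simps[OF that] by (simp add: composable_def a a_Dom a_Cod)
  have unit: "VComp A (s (f, g)) (Id2 A (a (Comp C g f))) = s (f, g)"
    "VComp A (Id2 A (Comp A (a g) (a f))) (s (f, g)) = s (f, g)"
    if "(f, g) \<in> composable C" for f g
    using A.VComp_Id2[OF s[OF that]] A.Id2_VComp[OF s[OF that]] s_Src[OF that] s_Trg[OF that]
    by simp_all
  have idem: "VComp A (Id2 A (a f)) (Id2 A (a f)) = Id2 A (a f)" if "f \<in> Ar C" for f
    using A.VComp_Id2[of "Id2 A (a f)"] A.Id2_in[OF a[OF that]] by simp
  show ?thesis
    by unfold_locales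
      (auto simp: discrete_lax_def a b s a_Dom a_Cod a_One s_Src s_Trg s_left s_right s_assoc
        C.Comp_simps C.Dom_in C.Cod_in C.One_in C.composable_Comp C.composable_One A.Id2_in
        A.HComp_Id2[OF comp] unit idem)
qed

lemma lax_functor_discreteD:
  assumes "category C" and F: "lax_functor (locally_discrete C) A F"
  shows "\<And>x. x \<in> Ob C \<Longrightarrow> fob F x \<in> Ob A"
    "\<And>f. f \<in> Ar C \<Longrightarrow> far F f \<in> Ar A"
    "\<And>f. f \<in> Ar C \<Longrightarrow> Dom A (far F f) = fob F (Dom C f)"
    "\<And>f. f \<in> Ar C \<Longrightarrow> Cod A (far F f) = fob F (Cod C f)"
    "\<And>x. x \<in> Ob C \<Longrightarrow> far F (One C x) = One A (fob F x)"
    "\<And>f. f \<in> Ar C \<Longrightarrow> fcell F f = Id2 A (far F f)"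
    "\<And>f g. (f, g) \<in> composable C \<Longrightarrow> fstr F (f, g) \<in> Cell A"
    "\<And>f g. (f, g) \<in> composable C \<Longrightarrow> Src A (fstr F (f, g)) = far F (Comp C g f)"
    "\<And>f g. (f, g) \<in> composable C \<Longrightarrow> Trg A (fstr F (f, g)) = Comp A (far F g) (far F f)"
    "\<And>f g k. (f, g) \<in> composable C \<Longrightarrow> (g, k) \<in> composable C \<Longrightarrow>
      VComp A (whisker_right A (fstr F (g, k)) (far F f)) (fstr F (f, Comp C k g)) =
      VComp A (whisker_left A (far F k) (fstr F (f, g))) (fstr F (Comp C g f, k))"
    "\<And>f. f \<in> Ar C \<Longrightarrow> fstr F (f, One C (Cod C f)) = Id2 A (far F f)"
    "\<And>f. f \<in> Ar C \<Longrightarrow> fstr F (One C (Dom C f), f) = Id2 A (far F f)"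
proof -
  interpret F: lax_functor "locally_discrete C" A F by fact
  show "\<And>f. f \<in> Ar C \<Longrightarrow> fcell F f = Id2 A (far F f)"
    using F.cell_Id2 by simp
qed (use lax_functor.ob[OF F] lax_functor.ar[OF F] lax_functor.ar_Dom[OF F]
    lax_functor.ar_Cod[OF F] lax_functor.normal_One[OF F] lax_functor.str[OF F]
    lax_functor.str_Src[OF F] lax_functor.str_Trg[OF F] lax_functor.str_assoc[OF F]
    lax_functor.normal_left[OF F] lax_functor.normal_right[OF F] in \<open>auto simp: PiE_def Pi_def\<close>)

text \<open>Agreement on 2-cells comes for free: both functors send \<open>f\<close> to the identity
  2-cell of the same arrow.\<close>

lemma lax_functor_eqI:
  assumes C: "category C"
    and F: "lax_functor (locally_discrete C) A F" and F': "lax_functor (locally_discrete C) A F'"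
    and ob: "\<And>x. x \<in> Ob C \<Longrightarrow> fob F x = fob F' x"
    and ar: "\<And>f. f \<in> Ar C \<Longrightarrow> far F f = far F' f"
    and str: "\<And>f g. (f, g) \<in> composable C \<Longrightarrow> fstr F (f, g) = fstr F' (f, g)"
  shows "F = F'"
proof -
  interpret F: lax_functor "locally_discrete C" A F by fact
  interpret F': lax_functor "locally_discrete C" A F' by fact
  have "fob F = fob F'"
    using PiE_ext[OF F.ob F'.ob] ob by simp
  moreover have "far F = far F'"
    using PiE_ext[OF F.ar F'.ar] ar by simp
  moreover have "fcell F = fcell F'"
    using PiE_ext[OF F.cell F'.cell] ar
    by (simp add: lax_functor_discreteD(6)[OF C F] lax_functor_discreteD(6)[OF C F'])
  moreover have "fstr F = fstr F'"
    using PiE_ext[OF F.str F'.str] str by fastforce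
  ultimately show ?thesis
    by simp
qed

text \<open>A 2-cell of a locally discrete target is its own source and target, which collapses
  laxness to strict functoriality.\<close>

lemma functor_fstr:
  assumes "category D" "lax_functor (locally_discrete D) (locally_discrete C) \<sigma>"
    "(f, g) \<in> composable D"
  shows "fstr \<sigma> (f, g) = far \<sigma> (Comp D g f)" "far \<sigma> (Comp D g f) = Comp C (far \<sigma> g) (far \<sigma> f)"
  using lax_functor_discreteD(8,9)[OF assms] by simp_all

lemma functor_composable:
  assumes D: "category D" and \<sigma>: "lax_functor (locally_discrete D) (locally_discrete C) \<sigma>"
    and fg: "(f, g) \<in> composable D"
  shows "(far \<sigma> f, far \<sigma> g) \<in> composable C"
  using lax_functor_discreteD[OF D \<sigma>] category.Comp_simps[OF D fg] by (simp add: composable_def)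

lemma functorI:
  assumes D: "category D" and C: "category C"
    and b: "\<And>x. x \<in> Ob D \<Longrightarrow> b x \<in> Ob C"
    and a: "\<And>f. f \<in> Ar D \<Longrightarrow> a f \<in> Ar C"
    and a_Dom: "\<And>f. f \<in> Ar D \<Longrightarrow> Dom C (a f) = b (Dom D f)"
    and a_Cod: "\<And>f. f \<in> Ar D \<Longrightarrow> Cod C (a f) = b (Cod D f)"
    and a_One: "\<And>x. x \<in> Ob D \<Longrightarrow> a (One D x) = One C (b x)"
    and a_Comp: "\<And>f g. (f, g) \<in> composable D \<Longrightarrow> a (Comp D g f) = Comp C (a g) (a f)"
  shows "lax_functor (locally_discrete D) (locally_discrete C)
    (discrete_lax D (locally_discrete C) b a (\<lambda>(f, g). a (Comp D g f)))"
proof -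
  interpret D: category D by fact
  interpret C: category C by fact
  have a_Comp_in: "Comp C (a g) (a f) \<in> Ar C" if "(f, g) \<in> composable D" for f g
    using a[OF D.Comp_simps(4)[OF that]] a_Comp[OF that] by simp
  show ?thesis
  proof (rule lax_functor_discrete_laxI[OF D two_category_locally_discrete[OF C]],
      simp_all add: b a a_Dom a_Cod a_One a_Comp a_Comp_in D.Comp_simps D.Comp_One D.One_Comp)
    fix f g k assume fg: "(f, g) \<in> composable D" and gk: "(g, k) \<in> composable D"
    show "a (Comp D (Comp D k g) f) = a (Comp D k (Comp D g f))"
      using D.Comp_assoc[OF fg gk] by simp
  qed
qed

context
  fixes C :: "('o, 'm) cat" and D :: "('p, 'n) cat" and A :: "('q, 'r, 's) cat2" and F \<sigma>
  assumes C: "category C" and D: "category D" and A: "two_category A"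
    and F: "lax_functor (locally_discrete C) A F"
    and \<sigma>: "lax_functor (locally_discrete D) (locally_discrete C) \<sigma>"
begin

interpretation C: category C by (rule C)
interpretation D: category D by (rule D)
interpretation A: two_category A by (rule A)

text \<open>\<open>\<sigma>\<close> lands in a category, so \<open>F\<close> sends its structure
  2-cells to identities, and the second factor in the structure 2-cell of \<open>lax_comp\<close>
  drops out.\<close>

lemma lax_comp_discrete:
  "lax_comp (locally_discrete D) A F \<sigma> =
    discrete_lax D A (\<lambda>x. fob F (fob \<sigma> x)) (\<lambda>f. far F (far \<sigma> f))
      (\<lambda>(f, g). fstr F (far \<sigma> f, far \<sigma> g))"
proof -
  note F' = lax_functor_discreteD[OF C F] and \<sigma>' = lax_functor_discreteD[OF D \<sigma>]
  have "VComp A (fstr F (far \<sigma> f, far \<sigma> g)) (fcell F (fstr \<sigma> (f, g))) = fstr F (far \<sigma> f, far \<sigma> g)"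
    if fg: "(f, g) \<in> composable D" for f g
  proof -
    note c = functor_composable[OF D \<sigma> fg]
    have "fcell F (fstr \<sigma> (f, g)) = Id2 A (Src A (fstr F (far \<sigma> f, far \<sigma> g)))"
      using functor_fstr[OF D \<sigma> fg] F'(6)[of "fstr \<sigma> (f, g)"] F'(8)[OF c] C.Comp_simps[OF c]
      by simp
    then show ?thesis
      using A.VComp_Id2[OF F'(7)[OF c]] by simp
  qed
  moreover have "fcell F (fcell \<sigma> f) = Id2 A (far F (far \<sigma> f))" if "f \<in> Ar D" for f
    using that F'(6) \<sigma>'(2,6) by simp
  ultimately show ?thesis
    by (auto simp: lax_comp_def discrete_lax_def fun_eq_iff restrict_def)
qed

lemma lax_comp_simps:
  "x \<in> Ob D \<Longrightarrow> fob (lax_comp (locally_discrete D) A F \<sigma>) x = fob F (fob \<sigma> x)"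
  "f \<in> Ar D \<Longrightarrow> far (lax_comp (locally_discrete D) A F \<sigma>) f = far F (far \<sigma> f)"
  "(f, g) \<in> composable D \<Longrightarrow>
    fstr (lax_comp (locally_discrete D) A F \<sigma>) (f, g) = fstr F (far \<sigma> f, far \<sigma> g)"
  by (simp_all add: lax_comp_discrete)

lemma lax_functor_lax_comp:
  "lax_functor (locally_discrete D) A (lax_comp (locally_discrete D) A F \<sigma>)"
proof -
  note F' = lax_functor_discreteD[OF C F] and \<sigma>' = lax_functor_discreteD[OF D \<sigma>]
    and c = functor_composable[OF D \<sigma>] and fs = functor_fstr[OF D \<sigma>]
  show ?thesis
    unfolding lax_comp_discrete
  proof (rule lax_functor_discrete_laxI[OF D A])
    fix f g k assume fg: "(f, g) \<in> composable D" and gk: "(g, k) \<in> composable D"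
    show "VComp A (whisker_right A (case (g, k) of (f, g) \<Rightarrow> fstr F (far \<sigma> f, far \<sigma> g)) (far F (far \<sigma> f)))
        (case (f, Comp D k g) of (f, g) \<Rightarrow> fstr F (far \<sigma> f, far \<sigma> g)) =
      VComp A (whisker_left A (far F (far \<sigma> k)) (case (f, g) of (f, g) \<Rightarrow> fstr F (far \<sigma> f, far \<sigma> g)))
        (case (Comp D g f, k) of (f, g) \<Rightarrow> fstr F (far \<sigma> f, far \<sigma> g))"
      using F'(10)[OF c[OF fg] c[OF gk]] fs[OF fg] fs[OF gk] by simp
  next
    fix f assume f: "f \<in> Ar D"
    show "(case (f, One D (Cod D f)) of (f, g) \<Rightarrow> fstr F (far \<sigma> f, far \<sigma> g)) = Id2 A (far F (far \<sigma> f))"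
      using f F'(11)[of "far \<sigma> f"] \<sigma>'(2,4,5) D.Cod_in by simp
    show "(case (One D (Dom D f), f) of (f, g) \<Rightarrow> fstr F (far \<sigma> f, far \<sigma> g)) = Id2 A (far F (far \<sigma> f))"
      using f F'(12)[of "far \<sigma> f"] \<sigma>'(2,3,5) D.Dom_in by simp
  qed (use F' \<sigma>' c fs in simp_all)
qed

end

section \<open>The nerve of a category\<close>

lemma ordinal_cat_simps [simp]:
  "Ob (ordinal_cat n) = {..n}" "(i, j) \<in> Ar (ordinal_cat n) \<longleftrightarrow> i \<le> j \<and> j \<le> n"
  "Dom (ordinal_cat n) = fst" "Cod (ordinal_cat n) = snd" "One (ordinal_cat n) i = (i, i)"
  "Comp (ordinal_cat n) q p = (fst p, snd q)"
  "((i, j), (j', k)) \<in> composable (ordinal_cat n) \<longleftrightarrow> j' = j \<and> i \<le> j \<and> j \<le> k \<and> k \<le> n"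
  by (auto simp: ordinal_cat_def composable_def)

lemma category_ordinal_cat: "category (ordinal_cat n)"
  by unfold_locales (auto simp: ordinal_cat_def composable_def)

lemma simplex_maps_le: "\<theta> \<in> simplex_maps m n \<Longrightarrow> i \<le> m \<Longrightarrow> \<theta> i \<le> n"
  and simplex_maps_mono: "\<theta> \<in> simplex_maps m n \<Longrightarrow> i \<le> j \<Longrightarrow> j \<le> m \<Longrightarrow> \<theta> i \<le> \<theta> j"
  by (auto simp: simplex_maps_def mono_on_def)

lemma Ner_simps [simp]:
  "\<sigma> \<in> Simp (Ner A) n \<longleftrightarrow> lax_functor (ordinal n) A \<sigma>"
  "act (Ner A) m n \<theta> \<sigma> = lax_comp (ordinal m) A \<sigma> (ordinal_map m \<theta>)"
  by (simp_all add: Ner_def)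

lemma lax_functor_ordinal_map:
  assumes \<theta>: "\<theta> \<in> simplex_maps m n"
  shows "lax_functor (ordinal m) (ordinal n) (ordinal_map m \<theta>)"
proof -
  have "ordinal_map m \<theta> = discrete_lax (ordinal_cat m) (ordinal n) \<theta> (\<lambda>(i, j). (\<theta> i, \<theta> j))
      (\<lambda>(f, g). (\<lambda>(i, j). (\<theta> i, \<theta> j)) (Comp (ordinal_cat m) g f))"
    by (auto simp: ordinal_map_def discrete_lax_def restrict_def fun_eq_iff)
  moreover have "lax_functor (ordinal m) (ordinal n)
      (discrete_lax (ordinal_cat m) (ordinal n) \<theta> (\<lambda>(i, j). (\<theta> i, \<theta> j))
      (\<lambda>(f, g). (\<lambda>(i, j). (\<theta> i, \<theta> j)) (Comp (ordinal_cat m) g f)))"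
    by (rule functorI[OF category_ordinal_cat category_ordinal_cat])
      (use simplex_maps_le[OF \<theta>] simplex_maps_mono[OF \<theta>] in \<open>auto split: prod.splits\<close>)
  ultimately show ?thesis
    by simp
qed

lemma ordinal_map_simps [simp]:
  "i \<le> m \<Longrightarrow> fob (ordinal_map m \<theta>) i = \<theta> i"
  "i \<le> j \<Longrightarrow> j \<le> m \<Longrightarrow> far (ordinal_map m \<theta>) (i, j) = (\<theta> i, \<theta> j)"
  by (simp_all add: ordinal_map_def)

lemmas nerve_eqI = lax_functor_eqI[OF category_ordinal_cat]

text \<open>In a category the structure 2-cells of a simplex are its composite edges, so they are
  already covered by the edges.\<close>

lemma nerve_category_eqI:
  assumes \<sigma>: "lax_functor (ordinal n) (locally_discrete C) \<sigma>"
    and \<tau>: "lax_functor (ordinal n) (locally_discrete C) \<tau>"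
    and "\<And>i. i \<le> n \<Longrightarrow> fob \<sigma> i = fob \<tau> i"
    and "\<And>i j. i \<le> j \<Longrightarrow> j \<le> n \<Longrightarrow> far \<sigma> (i, j) = far \<tau> (i, j)"
  shows "\<sigma> = \<tau>"
  by (rule nerve_eqI[OF \<sigma> \<tau>])
    (use assms functor_fstr[OF category_ordinal_cat \<sigma>] functor_fstr[OF category_ordinal_cat \<tau>]
      in auto)

text \<open>Nerve operators are computed through these formulas. Later proofs delete
  \<open>Ner_simps\<close> so that \<open>act\<close> is not unfolded before the formulas can
  match.\<close>

lemma act_Ner:
  assumes A: "two_category A" and \<theta>: "\<theta> \<in> simplex_maps m n" and \<sigma>: "lax_functor (ordinal n) A \<sigma>"
  shows "lax_functor (ordinal m) A (act (Ner A) m n \<theta> \<sigma>)"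
    "i \<le> m \<Longrightarrow> fob (act (Ner A) m n \<theta> \<sigma>) i = fob \<sigma> (\<theta> i)"
    "i \<le> j \<Longrightarrow> j \<le> m \<Longrightarrow> far (act (Ner A) m n \<theta> \<sigma>) (i, j) = far \<sigma> (\<theta> i, \<theta> j)"
    "i \<le> j \<Longrightarrow> j \<le> k \<Longrightarrow> k \<le> m \<Longrightarrow>
      fstr (act (Ner A) m n \<theta> \<sigma>) ((i, j), (j, k)) = fstr \<sigma> ((\<theta> i, \<theta> j), (\<theta> j, \<theta> k))"
  using lax_functor_lax_comp[OF category_ordinal_cat category_ordinal_cat A \<sigma> lax_functor_ordinal_map[OF \<theta>]]
    lax_comp_simps[OF category_ordinal_cat category_ordinal_cat A \<sigma> lax_functor_ordinal_map[OF \<theta>]]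
  by simp_all

definition nerve_map :: "('o, 'm) cat \<Rightarrow> ('p, 'n, 'd) cat2 \<Rightarrow> ('o, 'm, 'm, 'p, 'n, 'd) laxfun \<Rightarrow>
    nat \<Rightarrow> ('o, 'm, 'm) nerve_simplex \<Rightarrow> ('p, 'n, 'd) nerve_simplex" where
  "nerve_map C A F n = (\<lambda>\<sigma>\<in>Simp (Ner (locally_discrete C)) n. lax_comp (ordinal n) A F \<sigma>)"

section \<open>Strings of composable arrows as simplices\<close>

primrec path :: "('o, 'm, 'x) cat_scheme \<Rightarrow> (nat \<Rightarrow> 'o) \<Rightarrow> (nat \<Rightarrow> 'm) \<Rightarrow> nat \<Rightarrow> nat \<Rightarrow> 'm" where
  "path C x h i 0 = One C (x i)"
| "path C x h i (Suc d) = Comp C (h (i + d)) (path C x h i d)"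

text \<open>The simplex with spine \<open>h\<close>: its edge from \<open>i\<close> to
  \<open>j\<close> is the composite of \<open>h i\<close>, ..., \<open>h (j - 1)\<close>. The
  recursion in \<open>path\<close> runs on the length \<open>j - i\<close>, and \<open>x\<close> is
  needed there for the empty composite.\<close>

definition chain :: "('o, 'm) cat \<Rightarrow> nat \<Rightarrow> (nat \<Rightarrow> 'o) \<Rightarrow> (nat \<Rightarrow> 'm) \<Rightarrow> ('o, 'm, 'm) nerve_simplex" where
  "chain C n x h = discrete_lax (ordinal_cat n) (locally_discrete C) x (\<lambda>(i, j). path C x h i (j - i))
     (\<lambda>(f, g). (\<lambda>(i, j). path C x h i (j - i)) (Comp (ordinal_cat n) g f))"

abbreviation point :: "('o, 'm) cat \<Rightarrow> 'o \<Rightarrow> ('o, 'm, 'm) nerve_simplex" where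
  "point C x \<equiv> chain C 0 (\<lambda>_. x) (\<lambda>_. undefined)"

text \<open>Vertex 0 is the source of the first arrow, and vertex \<open>i > 0\<close> is the target
  of the arrow with index \<open>i - 1\<close>. The empty list has no first arrow, which is why
  single objects are treated by \<open>point\<close>.\<close>

definition arrow_string :: "('o, 'm) cat \<Rightarrow> 'm list \<Rightarrow> ('o, 'm, 'm) nerve_simplex" where
  "arrow_string C fs = chain C (length fs)
     (\<lambda>i. if i = 0 then Dom C (hd fs) else Cod C (fs ! (i - 1))) ((!) fs)"

lemma chain_simps [simp]:
  "i \<le> n \<Longrightarrow> fob (chain C n x h) i = x i"
  "i \<le> j \<Longrightarrow> j \<le> n \<Longrightarrow> far (chain C n x h) (i, j) = path C x h i (j - i)"
  by (simp_all add: chain_def)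

context category
begin

lemma path_type:
  assumes x: "\<And>i. i \<le> n \<Longrightarrow> x i \<in> Ob C" and h: "\<And>i. i < n \<Longrightarrow> h i \<in> Ar C"
    and h_Dom: "\<And>i. i < n \<Longrightarrow> Dom C (h i) = x i" and h_Cod: "\<And>i. i < n \<Longrightarrow> Cod C (h i) = x (Suc i)"
  shows "i + d \<le> n \<Longrightarrow>
    path C x h i d \<in> Ar C \<and> Dom C (path C x h i d) = x i \<and> Cod C (path C x h i d) = x (i + d)"
proof (induction d)
  case 0
  then show ?case by (simp add: One_in x)
next
  case (Suc d)
  then have "(path C x h i d, h (i + d)) \<in> composable C"
    by (simp add: composable_def h h_Dom)
  from Comp_simps[OF this] show ?case
    using Suc by (simp add: h_Cod)
qed

lemma path_add:
  assumes x: "\<And>i. i \<le> n \<Longrightarrow> x i \<in> Ob C" and h: "\<And>i. i < n \<Longrightarrow> h i \<in> Ar C"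
    and h_Dom: "\<And>i. i < n \<Longrightarrow> Dom C (h i) = x i" and h_Cod: "\<And>i. i < n \<Longrightarrow> Cod C (h i) = x (Suc i)"
  shows "i + d + e \<le> n \<Longrightarrow> path C x h i (d + e) = Comp C (path C x h (i + d) e) (path C x h i d)"
proof (induction e)
  case 0
  then show ?case
    using path_type[of n x h i d, OF assms] One_Comp[of "path C x h i d"] by simp
next
  case (Suc e)
  have "(path C x h i d, path C x h (i + d) e) \<in> composable C"
    "(path C x h (i + d) e, h (i + d + e)) \<in> composable C"
    using path_type[of n x h i d, OF assms] path_type[of n x h "i + d" e, OF assms] Suc.prems
    by (simp_all add: composable_def h h_Dom)
  from Comp_assoc[OF this] show ?case
    using Suc by (simp add: add.assoc)
qed

end

lemma lax_functor_chain:
  assumes "category C"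
    and x: "\<And>i. i \<le> n \<Longrightarrow> x i \<in> Ob C" and h: "\<And>i. i < n \<Longrightarrow> h i \<in> Ar C"
    and h_Dom: "\<And>i. i < n \<Longrightarrow> Dom C (h i) = x i" and h_Cod: "\<And>i. i < n \<Longrightarrow> Cod C (h i) = x (Suc i)"
  shows "lax_functor (ordinal n) (locally_discrete C) (chain C n x h)"
proof -
  interpret category C by fact
  note pt = path_type[of n x h, OF x h h_Dom h_Cod]
  have pa: "path C x h i (k - i) = Comp C (path C x h j (k - j)) (path C x h i (j - i))"
    if "i \<le> j" "j \<le> k" "k \<le> n" for i j k
    using path_add[of n x h i "j - i" "k - j", OF x h h_Dom h_Cod] that by simp
  show ?thesis
    unfolding chain_def
  proof (rule functorI[OF category_ordinal_cat \<open>category C\<close>])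
    fix p q assume "(p, q) \<in> composable (ordinal_cat n)"
    then obtain i j k where "p = (i, j)" "q = (j, k)" "i \<le> j" "j \<le> k" "k \<le> n"
      by (cases p; cases q) auto
    then show "(case Comp (ordinal_cat n) q p of (i, j) \<Rightarrow> path C x h i (j - i)) =
        Comp C (case q of (i, j) \<Rightarrow> path C x h i (j - i)) (case p of (i, j) \<Rightarrow> path C x h i (j - i))"
      using pa[of i j k] by simp
  qed (auto simp: x pt)
qed

lemma arrow_string:
  assumes C: "category C" and fs: "fs \<noteq> []" "set fs \<subseteq> Ar C"
    and comp: "\<And>i. Suc i < length fs \<Longrightarrow> Cod C (fs ! i) = Dom C (fs ! Suc i)"
  shows "lax_functor (ordinal (length fs)) (locally_discrete C) (arrow_string C fs)"
    "i < length fs \<Longrightarrow> far (arrow_string C fs) (i, Suc i) = fs ! i"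
proof -
  interpret category C by fact
  have *: "fs ! i \<in> Ar C" if "i < length fs" for i
    using that fs(2) nth_mem by blast
  have hd: "hd fs \<in> Ar C"
    using fs by auto
  have D: "Dom C (fs ! i) = (if i = 0 then Dom C (hd fs) else Cod C (fs ! (i - 1)))" if "i < length fs" for i
    using that comp[of "i - 1"] fs(1) by (auto simp: hd_conv_nth)
  show "lax_functor (ordinal (length fs)) (locally_discrete C) (arrow_string C fs)"
    unfolding arrow_string_def
    by (rule lax_functor_chain[OF C]) (use * hd fs(1) D in \<open>auto simp: Dom_in Cod_in\<close>)
  show "far (arrow_string C fs) (i, Suc i) = fs ! i" if "i < length fs"
    using that Comp_One[OF *[OF that]] by (simp add: arrow_string_def D)
qed

lemma lax_functor_point:
  "category C \<Longrightarrow> x \<in> Ob C \<Longrightarrow> lax_functor (ordinal 0) (locally_discrete C) (point C x)"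
  by (rule lax_functor_chain) auto

lemma arrow_string1:
  assumes C: "category C" and f: "f \<in> Ar C"
  shows "lax_functor (ordinal 1) (locally_discrete C) (arrow_string C [f])"
    "far (arrow_string C [f]) (0, 1) = f"
    "fob (arrow_string C [f]) 0 = Dom C f" "fob (arrow_string C [f]) 1 = Cod C f"
    "i \<le> 1 \<Longrightarrow> far (arrow_string C [f]) (i, i) = One C (fob (arrow_string C [f]) i)"
  using arrow_string[OF C, of "[f]"] f arrow_string(2)[OF C, of "[f]" 0]
  by (simp_all add: arrow_string_def)

lemma arrow_string2:
  assumes C: "category C" and fg: "(f, g) \<in> composable C"
  shows "lax_functor (ordinal 2) (locally_discrete C) (arrow_string C [f, g])"
    "far (arrow_string C [f, g]) (0, 1) = f" "far (arrow_string C [f, g]) (1, 2) = g"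
    "far (arrow_string C [f, g]) (0, 2) = Comp C g f"
proof -
  have *: "set [f, g] \<subseteq> Ar C" "\<And>i. Suc i < length [f, g] \<Longrightarrow> Cod C ([f, g] ! i) = Dom C ([f, g] ! Suc i)"
    using fg by (auto simp: composable_def)
  show l: "lax_functor (ordinal 2) (locally_discrete C) (arrow_string C [f, g])"
    using arrow_string(1)[OF C _ *] by (simp add: numeral_2_eq_2)
  show e: "far (arrow_string C [f, g]) (0, 1) = f" "far (arrow_string C [f, g]) (1, 2) = g"
    using arrow_string(2)[OF C _ *, of 0] arrow_string(2)[OF C _ *, of 1] by (simp_all add: numeral_2_eq_2)
  show "far (arrow_string C [f, g]) (0, 2) = Comp C g f"
    using functor_fstr(2)[OF category_ordinal_cat l, of "(0, 1)" "(1, 2)"] e by simp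
qed

lemma arrow_string3:
  assumes C: "category C" and fg: "(f, g) \<in> composable C" and gk: "(g, k) \<in> composable C"
  shows "lax_functor (ordinal 3) (locally_discrete C) (arrow_string C [f, g, k])"
    "far (arrow_string C [f, g, k]) (0, 1) = f" "far (arrow_string C [f, g, k]) (1, 2) = g"
    "far (arrow_string C [f, g, k]) (2, 3) = k"
    "far (arrow_string C [f, g, k]) (0, 2) = Comp C g f"
    "far (arrow_string C [f, g, k]) (1, 3) = Comp C k g"
proof -
  have *: "set [f, g, k] \<subseteq> Ar C"
    "\<And>i. Suc i < length [f, g, k] \<Longrightarrow> Cod C ([f, g, k] ! i) = Dom C ([f, g, k] ! Suc i)"
    using fg gk by (auto simp: composable_def less_Suc_eq)
  show l: "lax_functor (ordinal 3) (locally_discrete C) (arrow_string C [f, g, k])"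
    using arrow_string(1)[OF C _ *] by (simp add: numeral_3_eq_3)
  show e: "far (arrow_string C [f, g, k]) (0, 1) = f" "far (arrow_string C [f, g, k]) (1, 2) = g"
    "far (arrow_string C [f, g, k]) (2, 3) = k"
    using arrow_string(2)[OF C _ *, of 0] arrow_string(2)[OF C _ *, of 1] arrow_string(2)[OF C _ *, of 2]
    by (simp_all add: numeral_2_eq_2 numeral_3_eq_3)
  show "far (arrow_string C [f, g, k]) (0, 2) = Comp C g f"
    using functor_fstr(2)[OF category_ordinal_cat l, of "(0, 1)" "(1, 2)"] e by simp
  show "far (arrow_string C [f, g, k]) (1, 3) = Comp C k g"
    using functor_fstr(2)[OF category_ordinal_cat l, of "(1, 2)" "(2, 3)"] e by simp
qed

text \<open>The data of a lax 2-functor sit on objects, arrows and composable pairs, which are the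
  simplices of dimension 0, 1 and 2 of the nerve of \<open>C\<close>; they are read off from the
  images of these simplices.\<close>

definition lax_of_nerve :: "('o, 'm) cat \<Rightarrow> ('p, 'n, 'd) cat2 \<Rightarrow>
    (nat \<Rightarrow> ('o, 'm, 'm) nerve_simplex \<Rightarrow> ('p, 'n, 'd) nerve_simplex) \<Rightarrow>
    ('o, 'm, 'm, 'p, 'n, 'd) laxfun" where
  "lax_of_nerve C A \<phi> = discrete_lax C A (\<lambda>x. fob (\<phi> 0 (point C x)) 0)
     (\<lambda>f. far (\<phi> 1 (arrow_string C [f])) (0, 1))
     (\<lambda>(f, g). fstr (\<phi> 2 (arrow_string C [f, g])) ((0, 1), (1, 2)))"

section \<open>Full faithfulness of the nerve\<close>

context
  fixes C :: "('o, 'm) cat" and A :: "('p, 'n, 'd) cat2"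
  assumes C: "category C" and A: "two_category A"
begin

interpretation C: category C by (rule C)
interpretation A: two_category A by (rule A)

lemma nerve_map:
  assumes F: "lax_functor (locally_discrete C) A F"
    and \<sigma>: "lax_functor (ordinal n) (locally_discrete C) \<sigma>"
  shows "lax_functor (ordinal n) A (nerve_map C A F n \<sigma>)"
    "i \<le> n \<Longrightarrow> fob (nerve_map C A F n \<sigma>) i = fob F (fob \<sigma> i)"
    "i \<le> j \<Longrightarrow> j \<le> n \<Longrightarrow> far (nerve_map C A F n \<sigma>) (i, j) = far F (far \<sigma> (i, j))"
    "i \<le> j \<Longrightarrow> j \<le> k \<Longrightarrow> k \<le> n \<Longrightarrow>
      fstr (nerve_map C A F n \<sigma>) ((i, j), (j, k)) = fstr F (far \<sigma> (i, j), far \<sigma> (j, k))"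
  using lax_functor_lax_comp[OF C category_ordinal_cat A F \<sigma>] \<sigma>
    lax_comp_simps[OF C category_ordinal_cat A F \<sigma>]
  by (simp_all add: nerve_map_def)

text \<open>\<open>F\<close> acts by postcomposition and the operators act by precomposition, so
  they commute; the two composites are compared on vertices, edges and triangles.\<close>

lemma simplicial_map_nerve_map:
  assumes F: "lax_functor (locally_discrete C) A F"
  shows "simplicial_map (Ner (locally_discrete C)) (Ner A) (nerve_map C A F)"
proof -
  have "nerve_map C A F m (act (Ner (locally_discrete C)) m n \<theta> \<sigma>) =
      act (Ner A) m n \<theta> (nerve_map C A F n \<sigma>)"
    if \<theta>: "\<theta> \<in> simplex_maps m n" and \<sigma>: "lax_functor (ordinal n) (locally_discrete C) \<sigma>" for m n \<theta> \<sigma>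
  proof -
    note a = act_Ner[OF two_category_locally_discrete[OF C] \<theta> \<sigma>]
    note b = act_Ner[OF A \<theta> nerve_map(1)[OF F \<sigma>]]
    note c = nerve_map[OF F a(1)]
    note le = simplex_maps_le[OF \<theta>] simplex_maps_mono[OF \<theta>]
    show ?thesis
      by (rule nerve_eqI[OF c(1) b(1)])
        (auto simp: a b c nerve_map[OF F \<sigma>] le simp del: Ner_simps)
  qed
  moreover have "nerve_map C A F n \<in> Simp (Ner (locally_discrete C)) n \<rightarrow>\<^sub>E Simp (Ner A) n" for n
    using nerve_map(1)[OF F] by (auto simp: nerve_map_def PiE_def)
  ultimately show ?thesis
    by (simp add: simplicial_map_def del: Ner_simps(2))
qed

text \<open>Each vertex, edge or triangle of \<sigma> is the pullback of \<sigma> along some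
  \<theta> from [0], [1] or [2], and this pullback is a \<open>point\<close> or an
  \<open>arrow_string\<close>. Since \<phi> commutes with \<theta>, the components of
  \<open>\<phi> n \<sigma>\<close> are governed by the values of \<phi> in dimensions up to
  2.\<close>

lemma lax_of_nerve:
  assumes \<phi>: "simplicial_map (Ner (locally_discrete C)) (Ner A) \<phi>"
    and \<sigma>: "lax_functor (ordinal n) (locally_discrete C) \<sigma>"
  shows "lax_functor (ordinal n) A (\<phi> n \<sigma>)"
    "i \<le> n \<Longrightarrow> fob (\<phi> n \<sigma>) i = fob (lax_of_nerve C A \<phi>) (fob \<sigma> i)"
    "i \<le> j \<Longrightarrow> j \<le> n \<Longrightarrow> far (\<phi> n \<sigma>) (i, j) = far (lax_of_nerve C A \<phi>) (far \<sigma> (i, j))"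
    "i \<le> j \<Longrightarrow> j \<le> k \<Longrightarrow> k \<le> n \<Longrightarrow>
      fstr (\<phi> n \<sigma>) ((i, j), (j, k)) = fstr (lax_of_nerve C A \<phi>) (far \<sigma> (i, j), far \<sigma> (j, k))"
proof -
  note \<sigma>' = lax_functor_discreteD[OF category_ordinal_cat \<sigma>]
  have \<phi>n: "\<phi> n \<in> Simp (Ner (locally_discrete C)) n \<rightarrow>\<^sub>E Simp (Ner A) n"
    using \<phi> unfolding simplicial_map_def by blast
  show \<phi>\<sigma>: "lax_functor (ordinal n) A (\<phi> n \<sigma>)"
    using PiE_mem[OF \<phi>n, of \<sigma>] \<sigma> by simp
  have face: "\<phi> m (act (Ner (locally_discrete C)) m n \<theta> \<sigma>) = act (Ner A) m n \<theta> (\<phi> n \<sigma>)"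
    if "\<theta> \<in> simplex_maps m n" for m \<theta>
    using \<phi> \<sigma> that by (simp add: simplicial_map_def del: Ner_simps(2))
  {
    assume i: "i \<le> n"
    define \<theta> where "\<theta> = (\<lambda>_\<in>{..0::nat}. i)"
    have \<theta>: "\<theta> \<in> simplex_maps 0 n"
      using i by (auto simp: \<theta>_def simplex_maps_def mono_on_def)
    note a = act_Ner[OF two_category_locally_discrete[OF C] \<theta> \<sigma>]
    have x: "fob \<sigma> i \<in> Ob C"
      using \<sigma>'(1)[of i] i by simp
    have "act (Ner (locally_discrete C)) 0 n \<theta> \<sigma> = point C (fob \<sigma> i)"
      by (rule nerve_category_eqI[OF a(1) lax_functor_point[OF C x]])
        (use i \<sigma>'(5)[of i] a(2)[of 0] a(3)[of 0 0] in \<open>auto simp: \<theta>_def simp del: Ner_simps\<close>)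
    then show "fob (\<phi> n \<sigma>) i = fob (lax_of_nerve C A \<phi>) (fob \<sigma> i)"
      using face[OF \<theta>] act_Ner(2)[OF A \<theta> \<phi>\<sigma>, of 0] x
      by (simp add: lax_of_nerve_def \<theta>_def del: Ner_simps)
  }
  {
    assume ij: "i \<le> j" "j \<le> n"
    \<comment> \<open>\<theta> may be constant: for \<open>i = j\<close> the edge is degenerate and
      is the \<open>arrow_string\<close> of an identity.\<close>
    define \<theta> where "\<theta> = (\<lambda>l\<in>{..1::nat}. if l = 0 then i else j)"
    have \<theta>: "\<theta> \<in> simplex_maps 1 n"
      using ij by (auto simp: \<theta>_def simplex_maps_def mono_on_def)
    note a = act_Ner[OF two_category_locally_discrete[OF C] \<theta> \<sigma>]
    define f where "f = far \<sigma> (i, j)"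
    have f: "f \<in> Ar C" "Dom C f = fob \<sigma> i" "Cod C f = fob \<sigma> j"
      using \<sigma>'(2,3,4)[of "(i, j)"] ij by (simp_all add: f_def)
    note s = arrow_string1[OF C f(1)]
    have "act (Ner (locally_discrete C)) 1 n \<theta> \<sigma> = arrow_string C [f]"
    proof (rule nerve_category_eqI[OF a(1) s(1)])
      fix l :: nat assume "l \<le> 1"
      then have "l = 0 \<or> l = 1" by auto
      then show "fob (act (Ner (locally_discrete C)) 1 n \<theta> \<sigma>) l = fob (arrow_string C [f]) l"
        using a(2)[of l] s(3,4) f by (auto simp: \<theta>_def simp del: Ner_simps)
    next
      fix l m :: nat assume "l \<le> m" "m \<le> 1"
      then have "(l = 0 \<and> m = 0) \<or> (l = 0 \<and> m = 1) \<or> (l = 1 \<and> m = 1)" by auto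
      then show "far (act (Ner (locally_discrete C)) 1 n \<theta> \<sigma>) (l, m) = far (arrow_string C [f]) (l, m)"
        using a(3)[of l m] s f ij \<sigma>'(5)[of i] \<sigma>'(5)[of j]
        by (auto simp: \<theta>_def f_def[symmetric] simp del: Ner_simps)
    qed
    then show "far (\<phi> n \<sigma>) (i, j) = far (lax_of_nerve C A \<phi>) (far \<sigma> (i, j))"
      using face[OF \<theta>] act_Ner(3)[OF A \<theta> \<phi>\<sigma>, of 0 1] f(1)
      by (simp add: lax_of_nerve_def \<theta>_def f_def[symmetric] del: Ner_simps)
  }
  {
    assume ijk: "i \<le> j" "j \<le> k" "k \<le> n"
    define \<theta> where "\<theta> = (\<lambda>l\<in>{..2::nat}. if l = 0 then i else if l = 1 then j else k)"
    have \<theta>: "\<theta> \<in> simplex_maps 2 n"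
      using ijk by (auto simp: \<theta>_def simplex_maps_def mono_on_def)
    note a = act_Ner[OF two_category_locally_discrete[OF C] \<theta> \<sigma>]
    define f g where "f = far \<sigma> (i, j)" and "g = far \<sigma> (j, k)"
    have fg: "(f, g) \<in> composable C" "far \<sigma> (i, k) = Comp C g f"
      using functor_composable[OF category_ordinal_cat \<sigma>, of "(i, j)" "(j, k)"]
        functor_fstr(2)[OF category_ordinal_cat \<sigma>, of "(i, j)" "(j, k)"] ijk
      by (simp_all add: f_def g_def)
    note s = arrow_string2[OF C fg(1)]
    note s' = lax_functor_discreteD[OF category_ordinal_cat s(1)]
    have ob: "fob (act (Ner (locally_discrete C)) 2 n \<theta> \<sigma>) l = fob (arrow_string C [f, g]) l"
      if "l \<le> 2" for l
    proof -
      have "l = 0 \<or> l = 1 \<or> l = 2" using that by auto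
      then show ?thesis
        using a(2)[of l] s'(3)[of "(0, 1)"] s'(3)[of "(1, 2)"] s'(4)[of "(1, 2)"] s(2,3) ijk
          \<sigma>'(3)[of "(i, j)"] \<sigma>'(3)[of "(j, k)"] \<sigma>'(4)[of "(j, k)"]
        by (auto simp: \<theta>_def f_def[symmetric] g_def[symmetric] simp del: Ner_simps)
    qed
    have "act (Ner (locally_discrete C)) 2 n \<theta> \<sigma> = arrow_string C [f, g]"
    proof (rule nerve_category_eqI[OF a(1) s(1)])
      fix l m :: nat assume "l \<le> m" "m \<le> 2"
      then have "(l = m \<and> m \<le> 2) \<or> (l = 0 \<and> m = 1) \<or> (l = 1 \<and> m = 2) \<or> (l = 0 \<and> m = 2)" by auto
      then show "far (act (Ner (locally_discrete C)) 2 n \<theta> \<sigma>) (l, m) = far (arrow_string C [f, g]) (l, m)"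
        using a(3)[of l m] s fg ijk s'(5)[of l] ob[of l]
          lax_functor_discreteD(5)[OF category_ordinal_cat a(1), of l]
        by (auto simp: \<theta>_def f_def[symmetric] g_def[symmetric] simp del: Ner_simps)
    qed (rule ob)
    then show "fstr (\<phi> n \<sigma>) ((i, j), (j, k)) = fstr (lax_of_nerve C A \<phi>) (far \<sigma> (i, j), far \<sigma> (j, k))"
      using face[OF \<theta>] act_Ner(4)[OF A \<theta> \<phi>\<sigma>, of 0 1 2] fg(1)
      by (simp add: lax_of_nerve_def \<theta>_def f_def[symmetric] g_def[symmetric] del: Ner_simps)
  }
qed

text \<open>Every law to be checked involves at most three composable arrows, and it holds because
  \<phi> sends the corresponding \<open>point\<close> or \<open>arrow_string\<close> to a lax
  2-functor on an ordinal.\<close>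

lemma lax_functor_lax_of_nerve:
  assumes \<phi>: "simplicial_map (Ner (locally_discrete C)) (Ner A) \<phi>"
  shows "lax_functor (locally_discrete C) A (lax_of_nerve C A \<phi>)"
proof -
  define F where "F = lax_of_nerve C A \<phi>"
  note key = lax_of_nerve[OF \<phi>, folded F_def]
  have F: "F = discrete_lax C A (fob F) (far F) (fstr F)"
    by (auto simp: F_def lax_of_nerve_def discrete_lax_def fun_eq_iff restrict_def)
  have ob: "fob F x \<in> Ob A" "far F (One C x) = One A (fob F x)" if "x \<in> Ob C" for x
  proof -
    note p = lax_functor_point[OF C that]
    note d = lax_functor_discreteD[OF category_ordinal_cat key(1)[OF p]]
    show "fob F x \<in> Ob A" "far F (One C x) = One A (fob F x)"
      using d(1)[of 0] d(5)[of 0] key(2)[OF p, of 0] key(3)[OF p, of 0 0] by simp_all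
  qed
  have ar: "far F f \<in> Ar A" "Dom A (far F f) = fob F (Dom C f)" "Cod A (far F f) = fob F (Cod C f)"
    "fstr F (f, One C (Cod C f)) = Id2 A (far F f)" "fstr F (One C (Dom C f), f) = Id2 A (far F f)"
    if "f \<in> Ar C" for f
  proof -
    note s = arrow_string1[OF C that]
    note k = key[OF s(1)]
    note d = lax_functor_discreteD[OF category_ordinal_cat k(1)]
    show "far F f \<in> Ar A" "Dom A (far F f) = fob F (Dom C f)" "Cod A (far F f) = fob F (Cod C f)"
      using d(2,3,4)[of "(0, 1)"] k(2)[of 0] k(2)[of 1] k(3)[of 0 1] s by simp_all
    \<comment> \<open>The degenerate triangles 011 and 001 on the edge \<open>f\<close> carry the
      two normality conditions.\<close>
    show "fstr F (f, One C (Cod C f)) = Id2 A (far F f)" "fstr F (One C (Dom C f), f) = Id2 A (far F f)"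
      using d(11,12)[of "(0, 1)"] k(3)[of 0 1] k(4)[of 0 1 1] k(4)[of 0 0 1] s by simp_all
  qed
  have st: "fstr F (f, g) \<in> Cell A" "Src A (fstr F (f, g)) = far F (Comp C g f)"
    "Trg A (fstr F (f, g)) = Comp A (far F g) (far F f)"
    if "(f, g) \<in> composable C" for f g
  proof -
    note s = arrow_string2[OF C that]
    note k = key[OF s(1)]
    note d = lax_functor_discreteD[OF category_ordinal_cat k(1)]
    show "fstr F (f, g) \<in> Cell A" "Src A (fstr F (f, g)) = far F (Comp C g f)"
      "Trg A (fstr F (f, g)) = Comp A (far F g) (far F f)"
      using d(7,8,9)[of "(0, 1)" "(1, 2)"] k(3)[of 0 1] k(3)[of 1 2] k(3)[of 0 2] k(4)[of 0 1 2] s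
      by simp_all
  qed
  have as: "VComp A (whisker_right A (fstr F (g, k)) (far F f)) (fstr F (f, Comp C k g)) =
      VComp A (whisker_left A (far F k) (fstr F (f, g))) (fstr F (Comp C g f, k))"
    if "(f, g) \<in> composable C" "(g, k) \<in> composable C" for f g k
  proof -
    note s = arrow_string3[OF C that]
    note l = key[OF s(1)]
    note d = lax_functor_discreteD[OF category_ordinal_cat l(1)]
    \<comment> \<open>The four triangles are the faces of the 3-simplex; its associativity along 0 <
      1 < 2 < 3 is the required equation.\<close>
    show ?thesis
      using d(10)[of "(0, 1)" "(1, 2)" "(2, 3)"] l(3)[of 0 1] l(3)[of 2 3]
        l(4)[of 0 1 2] l(4)[of 1 2 3] l(4)[of 0 1 3] l(4)[of 0 2 3] s
      by simp
  qed
  have "lax_functor (locally_discrete C) A (discrete_lax C A (fob F) (far F) (fstr F))"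
    by (rule lax_functor_discrete_laxI[OF C A]) (fact ob ar st as)+
  then show ?thesis
    using F unfolding F_def[symmetric] by simp
qed

lemma nerve_map_lax_of_nerve:
  assumes \<phi>: "simplicial_map (Ner (locally_discrete C)) (Ner A) \<phi>"
  shows "nerve_map C A (lax_of_nerve C A \<phi>) = \<phi>"
proof (intro ext)
  fix n \<sigma>
  note F = lax_functor_lax_of_nerve[OF \<phi>]
  show "nerve_map C A (lax_of_nerve C A \<phi>) n \<sigma> = \<phi> n \<sigma>"
  proof (cases "\<sigma> \<in> Simp (Ner (locally_discrete C)) n")
    case True
    then have \<sigma>: "lax_functor (ordinal n) (locally_discrete C) \<sigma>" by simp
    show ?thesis
      by (rule nerve_eqI[OF nerve_map(1)[OF F \<sigma>] lax_of_nerve(1)[OF \<phi> \<sigma>]])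
        (auto simp: nerve_map[OF F \<sigma>] lax_of_nerve[OF \<phi> \<sigma>])
  next
    \<comment> \<open>Outside the set of simplices both families have the value
      \<open>undefined\<close>.\<close>
    case False
    then have "\<phi> n \<sigma> = undefined"
      using \<phi> by (auto simp: simplicial_map_def simp del: Ner_simps intro: PiE_arb)
    then show ?thesis
      using False by (simp add: nerve_map_def del: Ner_simps)
  qed
qed

lemma lax_of_nerve_nerve_map:
  assumes F: "lax_functor (locally_discrete C) A F"
  shows "lax_of_nerve C A (nerve_map C A F) = F"
proof (rule lax_functor_eqI[OF C _ F])
  note \<phi> = simplicial_map_nerve_map[OF F]
  show "lax_functor (locally_discrete C) A (lax_of_nerve C A (nerve_map C A F))"
    by (rule lax_functor_lax_of_nerve[OF \<phi>])
  show "fob (lax_of_nerve C A (nerve_map C A F)) x = fob F x" if "x \<in> Ob C" for x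
    using that nerve_map(2)[OF F lax_functor_point[OF C that], of 0] by (simp add: lax_of_nerve_def)
  show "far (lax_of_nerve C A (nerve_map C A F)) f = far F f" if "f \<in> Ar C" for f
    using that nerve_map(3)[OF F arrow_string1(1)[OF C that], of 0 1] arrow_string1(2)[OF C that]
    by (simp add: lax_of_nerve_def)
  show "fstr (lax_of_nerve C A (nerve_map C A F)) (f, g) = fstr F (f, g)"
    if "(f, g) \<in> composable C" for f g
    using that nerve_map(4)[OF F arrow_string2(1)[OF C that], of 0 1 2] arrow_string2(2,3)[OF C that]
    by (simp add: lax_of_nerve_def)
qed

theorem bij_betw_nerve_map:
  "bij_betw (nerve_map C A) {F. lax_functor (locally_discrete C) A F}
    {\<phi>. simplicial_map (Ner (locally_discrete C)) (Ner A) \<phi>}"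
  by (rule bij_betw_byWitness[where f' = "lax_of_nerve C A"])
    (auto simp: lax_of_nerve_nerve_map nerve_map_lax_of_nerve simplicial_map_nerve_map
      lax_functor_lax_of_nerve)

end

section \<open>Homotopies as lax 2-functors on a cylinder\<close>

text \<open>The product of \<open>C\<close> with [1]. Arrows over \<open>(0, 0)\<close> and
  \<open>(1, 1)\<close> form the bottom and the top copy of \<open>C\<close>; those over
  \<open>(0, 1)\<close> cross from bottom to top.\<close>

definition cylinder :: "('o, 'm) cat \<Rightarrow> ('o \<times> nat, 'm \<times> nat \<times> nat) cat" where
  "cylinder C = \<lparr> Ob = Ob C \<times> {..1}, Ar = Ar C \<times> Ar (ordinal_cat 1),
     Dom = (\<lambda>(f, p). (Dom C f, fst p)), Cod = (\<lambda>(f, p). (Cod C f, snd p)),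
     One = (\<lambda>(x, i). (One C x, (i, i))), Comp = (\<lambda>(g, q) (f, p). (Comp C g f, (fst p, snd q))) \<rparr>"

lemma cylinder_simps [simp]:
  "(x, i) \<in> Ob (cylinder C) \<longleftrightarrow> x \<in> Ob C \<and> i \<le> 1"
  "(f, (i, j)) \<in> Ar (cylinder C) \<longleftrightarrow> f \<in> Ar C \<and> i \<le> j \<and> j \<le> 1"
  "Dom (cylinder C) (f, p) = (Dom C f, fst p)" "Cod (cylinder C) (f, p) = (Cod C f, snd p)"
  "One (cylinder C) (x, i) = (One C x, (i, i))"
  "Comp (cylinder C) (g, q) (f, p) = (Comp C g f, (fst p, snd q))"
  "((f, (i, j)), (g, (j', k))) \<in> composable (cylinder C) \<longleftrightarrow>
    (f, g) \<in> composable C \<and> j' = j \<and> i \<le> j \<and> j \<le> k \<and> k \<le> 1"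
  by (auto simp: cylinder_def composable_def)

lemma category_cylinder:
  assumes "category C"
  shows "category (cylinder C)"
proof -
  interpret category C by fact
  show ?thesis
    by unfold_locales
      (auto simp: cylinder_def composable_def Dom_in Cod_in One_in Comp_in Comp_One One_Comp Comp_assoc)
qed

lemma sset_prod_simps [simp]:
  "Simp (sset_prod X Y) n = Simp X n \<times> Simp Y n"
  "act (sset_prod X Y) m n \<theta> (x, y) = (act X m n \<theta> x, act Y m n \<theta> y)"
  by (simp_all add: sset_prod_def)

lemma standard_simplex_simps [simp]:
  "Simp (standard_simplex p) n = simplex_maps n p"
  "act (standard_simplex p) m n \<theta> \<tau> = compose {..m} \<tau> \<theta>"
  by (simp_all add: standard_simplex_def)

lemma simplex_maps_compose:
  assumes "\<tau> \<in> simplex_maps n p" "\<theta> \<in> simplex_maps m n"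
  shows "compose {..m} \<tau> \<theta> \<in> simplex_maps m p"
  using assms simplex_maps_le[OF assms(1)] simplex_maps_le[OF assms(2)]
    simplex_maps_mono[OF assms(1)] simplex_maps_mono[OF assms(2)]
  unfolding simplex_maps_def by (auto simp: compose_def mono_on_def)

lemma simplex_maps_const: "e \<le> p \<Longrightarrow> (\<lambda>i\<in>{..n}. e) \<in> simplex_maps n p"
  by (auto simp: simplex_maps_def mono_on_def)

text \<open>Together with \<open>base_simplex\<close> and \<open>height\<close> this realises the
  isomorphism between Ner(C) x \<Delta>[1] and Ner(C x [1]): a simplex of
  \<open>standard_simplex 1\<close> is a monotone map to [1], and that is what the second
  coordinates of a simplex of the cylinder amount to.\<close>

definition pair_simplex :: "('o, 'm) cat \<Rightarrow> nat \<Rightarrow> ('o, 'm, 'm) nerve_simplex \<Rightarrow> (nat \<Rightarrow> nat) \<Rightarrow>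
    ('o \<times> nat, 'm \<times> nat \<times> nat, 'm \<times> nat \<times> nat) nerve_simplex" where
  "pair_simplex C n \<sigma> \<tau> = discrete_lax (ordinal_cat n) (locally_discrete (cylinder C))
     (\<lambda>i. (fob \<sigma> i, \<tau> i)) (\<lambda>(i, j). (far \<sigma> (i, j), (\<tau> i, \<tau> j)))
     (\<lambda>(f, g). (\<lambda>(i, j). (far \<sigma> (i, j), (\<tau> i, \<tau> j))) (Comp (ordinal_cat n) g f))"

definition base_simplex :: "('o, 'm) cat \<Rightarrow> nat \<Rightarrow>
    ('o \<times> nat, 'm \<times> nat \<times> nat, 'm \<times> nat \<times> nat) nerve_simplex \<Rightarrow> ('o, 'm, 'm) nerve_simplex" where
  "base_simplex C n \<rho> = discrete_lax (ordinal_cat n) (locally_discrete C)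
     (\<lambda>i. fst (fob \<rho> i)) (\<lambda>p. fst (far \<rho> p)) (\<lambda>(f, g). (\<lambda>p. fst (far \<rho> p)) (Comp (ordinal_cat n) g f))"

definition height :: "nat \<Rightarrow> ('o \<times> nat, 'm \<times> nat \<times> nat, 'm \<times> nat \<times> nat) nerve_simplex \<Rightarrow> nat \<Rightarrow> nat" where
  "height n \<rho> = (\<lambda>i\<in>{..n}. snd (fob \<rho> i))"

text \<open>The restriction of \<open>P\<close> to the copy of \<open>C\<close> at height
  \<open>e\<close> is \<open>F\<close>, written out in components. Values on 2-cells follow from
  \<open>far\<close>, the 2-cells being identities.\<close>

definition lax_cylinder :: "('o, 'm) cat \<Rightarrow> ('p, 'n, 'd) cat2 \<Rightarrow>
    ('o, 'm, 'm, 'p, 'n, 'd) laxfun \<Rightarrow> nat \<Rightarrow>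
    ('o \<times> nat, 'm \<times> nat \<times> nat, 'm \<times> nat \<times> nat, 'p, 'n, 'd) laxfun \<Rightarrow> bool" where
  "lax_cylinder C A F e P \<longleftrightarrow> (\<forall>x\<in>Ob C. fob P (x, e) = fob F x) \<and>
     (\<forall>f\<in>Ar C. far P (f, (e, e)) = far F f) \<and>
     (\<forall>(f, g)\<in>composable C. fstr P ((f, (e, e)), (g, (e, e))) = fstr F (f, g))"

section \<open>Simplices of the cylinder as pairs\<close>

context
  fixes C :: "('o, 'm) cat"
  assumes C: "category C"
begin

interpretation C: category C by (rule C)

lemma pair_simplex:
  assumes \<sigma>: "lax_functor (ordinal n) (locally_discrete C) \<sigma>" and \<tau>: "\<tau> \<in> simplex_maps n 1"
  shows "lax_functor (ordinal n) (locally_discrete (cylinder C)) (pair_simplex C n \<sigma> \<tau>)"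
    "i \<le> n \<Longrightarrow> fob (pair_simplex C n \<sigma> \<tau>) i = (fob \<sigma> i, \<tau> i)"
    "i \<le> j \<Longrightarrow> j \<le> n \<Longrightarrow> far (pair_simplex C n \<sigma> \<tau>) (i, j) = (far \<sigma> (i, j), (\<tau> i, \<tau> j))"
proof -
  note \<sigma>' = lax_functor_discreteD[OF category_ordinal_cat \<sigma>]
    and le = simplex_maps_le[OF \<tau>] simplex_maps_mono[OF \<tau>]
  show "lax_functor (ordinal n) (locally_discrete (cylinder C)) (pair_simplex C n \<sigma> \<tau>)"
    unfolding pair_simplex_def
  proof (rule functorI[OF category_ordinal_cat category_cylinder[OF C]])
    fix p q assume "(p, q) \<in> composable (ordinal_cat n)"
    then obtain i j k where "p = (i, j)" "q = (j, k)" "i \<le> j" "j \<le> k" "k \<le> n"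
      by (cases p; cases q) auto
    then show "(case Comp (ordinal_cat n) q p of (i, j) \<Rightarrow> (far \<sigma> (i, j), \<tau> i, \<tau> j)) =
        Comp (cylinder C) (case q of (i, j) \<Rightarrow> (far \<sigma> (i, j), \<tau> i, \<tau> j))
          (case p of (i, j) \<Rightarrow> (far \<sigma> (i, j), \<tau> i, \<tau> j))"
      using functor_fstr(2)[OF category_ordinal_cat \<sigma>, of p q] by simp
  qed (use \<sigma>' le in \<open>auto split: prod.splits\<close>)
qed (simp_all add: pair_simplex_def)

text \<open>The second coordinate of an edge is forced by its end points, and its being an arrow of
  [1] is what makes \<open>height\<close> monotone.\<close>

lemma cylinder_simplex:
  assumes \<rho>: "lax_functor (ordinal n) (locally_discrete (cylinder C)) \<rho>"
  shows "lax_functor (ordinal n) (locally_discrete C) (base_simplex C n \<rho>)"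
    "height n \<rho> \<in> simplex_maps n 1"
    "i \<le> n \<Longrightarrow> fob \<rho> i = (fob (base_simplex C n \<rho>) i, height n \<rho> i)"
    "i \<le> j \<Longrightarrow> j \<le> n \<Longrightarrow> far \<rho> (i, j) = (far (base_simplex C n \<rho>) (i, j), (height n \<rho> i, height n \<rho> j))"
proof -
  note \<rho>' = lax_functor_discreteD[OF category_ordinal_cat \<rho>, simplified]
  have ob: "fst (fob \<rho> i) \<in> Ob C \<and> snd (fob \<rho> i) \<le> 1" if "i \<le> n" for i
    using \<rho>'(1)[OF that] by (cases "fob \<rho> i") simp
  have ar: "fst (far \<rho> (i, j)) \<in> Ar C" "snd (far \<rho> (i, j)) = (snd (fob \<rho> i), snd (fob \<rho> j))"
    "snd (fob \<rho> i) \<le> snd (fob \<rho> j)"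
    "Dom C (fst (far \<rho> (i, j))) = fst (fob \<rho> i)" "Cod C (fst (far \<rho> (i, j))) = fst (fob \<rho> j)"
    if "i \<le> j" "j \<le> n" for i j
  proof -
    obtain f k l where f: "far \<rho> (i, j) = (f, (k, l))"
      by (metis surj_pair)
    show "fst (far \<rho> (i, j)) \<in> Ar C" "snd (far \<rho> (i, j)) = (snd (fob \<rho> i), snd (fob \<rho> j))"
      "snd (fob \<rho> i) \<le> snd (fob \<rho> j)"
      "Dom C (fst (far \<rho> (i, j))) = fst (fob \<rho> i)" "Cod C (fst (far \<rho> (i, j))) = fst (fob \<rho> j)"
      using \<rho>'(2)[of "(i, j)"] \<rho>'(3)[of "(i, j)"] \<rho>'(4)[of "(i, j)"] that f
      by (auto simp: prod_eq_iff)
  qed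
  show "lax_functor (ordinal n) (locally_discrete C) (base_simplex C n \<rho>)"
    unfolding base_simplex_def
  proof (rule functorI[OF category_ordinal_cat C])
    fix p q assume "(p, q) \<in> composable (ordinal_cat n)"
    then show "fst (far \<rho> (Comp (ordinal_cat n) q p)) = Comp C (fst (far \<rho> q)) (fst (far \<rho> p))"
      using functor_fstr(2)[OF category_ordinal_cat \<rho>, of p q]
      by (cases "far \<rho> p"; cases "far \<rho> q") simp
  next
    fix i assume "i \<in> Ob (ordinal_cat n)"
    then show "fst (far \<rho> (One (ordinal_cat n) i)) = One C (fst (fob \<rho> i))"
      using \<rho>'(5)[of i] by (cases "fob \<rho> i") simp
  qed (auto simp: ob ar)
  show "height n \<rho> \<in> simplex_maps n 1"
    using ob ar(3) by (auto simp: height_def simplex_maps_def mono_on_def)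
  show "i \<le> n \<Longrightarrow> fob \<rho> i = (fob (base_simplex C n \<rho>) i, height n \<rho> i)"
    by (simp add: base_simplex_def height_def)
  show "i \<le> j \<Longrightarrow> j \<le> n \<Longrightarrow> far \<rho> (i, j) = (far (base_simplex C n \<rho>) (i, j), (height n \<rho> i, height n \<rho> j))"
    using ar(2)[of i j] by (simp add: base_simplex_def height_def prod_eq_iff)
qed

lemma act_pair_simplex:
  assumes \<theta>: "\<theta> \<in> simplex_maps m n" and \<tau>: "\<tau> \<in> simplex_maps n 1"
    and \<sigma>: "lax_functor (ordinal n) (locally_discrete C) \<sigma>"
  shows "act (Ner (locally_discrete (cylinder C))) m n \<theta> (pair_simplex C n \<sigma> \<tau>) =
    pair_simplex C m (act (Ner (locally_discrete C)) m n \<theta> \<sigma>) (compose {..m} \<tau> \<theta>)"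
proof -
  note a = act_Ner[OF two_category_locally_discrete[OF C] \<theta> \<sigma>]
  note b = act_Ner[OF two_category_locally_discrete[OF category_cylinder[OF C]] \<theta> pair_simplex(1)[OF \<sigma> \<tau>]]
  note c = pair_simplex[OF a(1) simplex_maps_compose[OF \<tau> \<theta>]]
  show ?thesis
    by (rule nerve_category_eqI[OF b(1) c(1)])
      (auto simp: a b c pair_simplex[OF \<sigma> \<tau>] compose_eq simplex_maps_le[OF \<theta>] simplex_maps_mono[OF \<theta>]
        simp del: Ner_simps)
qed

text \<open>Naturality of the two projections turns a homotopy into a simplicial map on the nerve of
  the cylinder; \<open>act_pair_simplex\<close> serves the way back.\<close>

lemma act_cylinder_simplex:
  assumes \<theta>: "\<theta> \<in> simplex_maps m n"
    and \<rho>: "lax_functor (ordinal n) (locally_discrete (cylinder C)) \<rho>"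
  shows "base_simplex C m (act (Ner (locally_discrete (cylinder C))) m n \<theta> \<rho>) =
      act (Ner (locally_discrete C)) m n \<theta> (base_simplex C n \<rho>)"
    "height m (act (Ner (locally_discrete (cylinder C))) m n \<theta> \<rho>) = compose {..m} (height n \<rho>) \<theta>"
proof -
  note a = act_Ner[OF two_category_locally_discrete[OF category_cylinder[OF C]] \<theta> \<rho>]
  note b = act_Ner[OF two_category_locally_discrete[OF C] \<theta> cylinder_simplex(1)[OF \<rho>]]
  note c = cylinder_simplex[OF a(1)] and d = cylinder_simplex[OF \<rho>]
  note le = simplex_maps_le[OF \<theta>] simplex_maps_mono[OF \<theta>]
  show "base_simplex C m (act (Ner (locally_discrete (cylinder C))) m n \<theta> \<rho>) =
      act (Ner (locally_discrete C)) m n \<theta> (base_simplex C n \<rho>)"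
  proof (rule nerve_category_eqI[OF c(1) b(1)])
    fix i assume "i \<le> m"
    then show "fob (base_simplex C m (act (Ner (locally_discrete (cylinder C))) m n \<theta> \<rho>)) i =
        fob (act (Ner (locally_discrete C)) m n \<theta> (base_simplex C n \<rho>)) i"
      using a(2)[of i] b(2)[of i] c(3)[of i] d(3)[of "\<theta> i"] le by (simp del: Ner_simps)
  next
    fix i j assume "i \<le> j" "j \<le> m"
    then show "far (base_simplex C m (act (Ner (locally_discrete (cylinder C))) m n \<theta> \<rho>)) (i, j) =
        far (act (Ner (locally_discrete C)) m n \<theta> (base_simplex C n \<rho>)) (i, j)"
      using a(3)[of i j] b(3)[of i j] c(4)[of i j] d(4)[of "\<theta> i" "\<theta> j"] le by (simp del: Ner_simps)
  qed
  show "height m (act (Ner (locally_discrete (cylinder C))) m n \<theta> \<rho>) = compose {..m} (height n \<rho>) \<theta>"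
    using a(2) le by (auto simp: height_def compose_def fun_eq_iff restrict_def simp del: Ner_simps)
qed

lemma cylinder_simplex_pair:
  assumes \<sigma>: "lax_functor (ordinal n) (locally_discrete C) \<sigma>" and \<tau>: "\<tau> \<in> simplex_maps n 1"
  shows "base_simplex C n (pair_simplex C n \<sigma> \<tau>) = \<sigma>" "height n (pair_simplex C n \<sigma> \<tau>) = \<tau>"
proof -
  note a = pair_simplex[OF \<sigma> \<tau>]
  show "base_simplex C n (pair_simplex C n \<sigma> \<tau>) = \<sigma>"
    by (rule nerve_category_eqI[OF cylinder_simplex(1)[OF a(1)] \<sigma>])
      (simp_all add: base_simplex_def a)
  show "height n (pair_simplex C n \<sigma> \<tau>) = \<tau>"
  proof
    fix i
    have "\<tau> i = undefined" if "\<not> i \<le> n"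
      using \<tau> that by (intro PiE_arb[of \<tau> "{..n}"]) (auto simp: simplex_maps_def)
    then show "height n (pair_simplex C n \<sigma> \<tau>) i = \<tau> i"
      by (simp add: height_def a(2))
  qed
qed

lemma nerve_map_pair_simplex_const:
  assumes A: "two_category A" and F: "lax_functor (locally_discrete C) A F"
    and P: "lax_functor (locally_discrete (cylinder C)) A P" and e: "e \<le> 1"
    and cyl: "lax_cylinder C A F e P"
    and \<sigma>: "lax_functor (ordinal n) (locally_discrete C) \<sigma>"
  shows "nerve_map (cylinder C) A P n (pair_simplex C n \<sigma> (\<lambda>i\<in>{..n}. e)) = nerve_map C A F n \<sigma>"
proof -
  note p = pair_simplex[OF \<sigma> simplex_maps_const[OF e]]
  note a = nerve_map[OF category_cylinder[OF C] A P p(1)] and b = nerve_map[OF C A F \<sigma>]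
  note \<sigma>' = lax_functor_discreteD[OF category_ordinal_cat \<sigma>]
    and \<sigma>c = functor_composable[OF category_ordinal_cat \<sigma>]
  have cyl': "\<And>x. x \<in> Ob C \<Longrightarrow> fob P (x, e) = fob F x"
    "\<And>f. f \<in> Ar C \<Longrightarrow> far P (f, (e, e)) = far F f"
    "\<And>f g. (f, g) \<in> composable C \<Longrightarrow> fstr P ((f, (e, e)), (g, (e, e))) = fstr F (f, g)"
    using cyl by (auto simp: lax_cylinder_def)
  show ?thesis
    by (rule nerve_eqI[OF a(1) b(1)])
      (use \<sigma>' \<sigma>c in \<open>auto simp: a b p cyl'\<close>)
qed

text \<open>The three clauses are tested on points, single arrows and composable pairs, lifted to
  constant height \<open>e\<close>.\<close>

lemma lax_cylinder_nerveI:
  assumes A: "two_category A" and F: "lax_functor (locally_discrete C) A F"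
    and P: "lax_functor (locally_discrete (cylinder C)) A P" and e: "e \<le> 1"
    and eq: "\<And>n \<sigma>. lax_functor (ordinal n) (locally_discrete C) \<sigma> \<Longrightarrow>
      nerve_map (cylinder C) A P n (pair_simplex C n \<sigma> (\<lambda>i\<in>{..n}. e)) = nerve_map C A F n \<sigma>"
  shows "lax_cylinder C A F e P"
  unfolding lax_cylinder_def
proof (intro conjI ballI)
  note a = nerve_map[OF category_cylinder[OF C] A P pair_simplex(1)[OF _ simplex_maps_const[OF e]]]
    and b = nerve_map[OF C A F]
  note p = pair_simplex[OF _ simplex_maps_const[OF e]]
  show "fob P (x, e) = fob F x" if "x \<in> Ob C" for x
    using eq[OF lax_functor_point[OF C that]] a(2)[OF lax_functor_point[OF C that], of 0]
      p(2)[OF lax_functor_point[OF C that], of 0] b(2)[OF lax_functor_point[OF C that], of 0]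
    by simp
  show "far P (f, (e, e)) = far F f" if "f \<in> Ar C" for f
  proof -
    note s = arrow_string1[OF C that]
    show ?thesis
      using eq[OF s(1)] a(3)[OF s(1), of 0 1] p(3)[OF s(1), of 0 1] b(3)[OF s(1), of 0 1] s by simp
  qed
  show "case q of (f, g) \<Rightarrow> fstr P ((f, (e, e)), (g, (e, e))) = fstr F (f, g)"
    if "q \<in> composable C" for q
  proof -
    obtain f g where q: "q = (f, g)" by fastforce
    note s = arrow_string2[OF C that[unfolded q]]
    show ?thesis
      using eq[OF s(1)] a(4)[OF s(1), of 0 1 2] p(3)[OF s(1), of 0 1] p(3)[OF s(1), of 1 2]
        b(4)[OF s(1), of 0 1 2] s q by simp
  qed
qed

theorem homotopy_nerve_map_iff:
  assumes A: "two_category A" and F: "lax_functor (locally_discrete C) A F"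
    and F': "lax_functor (locally_discrete C) A F'"
  shows "(\<exists>H. homotopy (Ner (locally_discrete C)) (Ner A) (nerve_map C A F) (nerve_map C A F') H) \<longleftrightarrow>
    (\<exists>P. lax_functor (locally_discrete (cylinder C)) A P \<and> lax_cylinder C A F 0 P \<and>
      lax_cylinder C A F' 1 P)"
proof
  let ?X = "Ner (locally_discrete C)" and ?Z = "Ner (locally_discrete (cylinder C))"
    and ?I = "standard_simplex 1"
  note Z = category_cylinder[OF C]
  have zero_le: "(0::nat) \<le> 1" and one_le: "(1::nat) \<le> 1" by simp_all
  {
    assume "\<exists>H. homotopy ?X (Ner A) (nerve_map C A F) (nerve_map C A F') H"
    then obtain H where H: "simplicial_map (sset_prod ?X ?I) (Ner A) H"
      and H0: "\<And>n \<sigma>. \<sigma> \<in> Simp ?X n \<Longrightarrow> H n (\<sigma>, \<lambda>i\<in>{..n}. 0) = nerve_map C A F n \<sigma>"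
      and H1: "\<And>n \<sigma>. \<sigma> \<in> Simp ?X n \<Longrightarrow> H n (\<sigma>, \<lambda>i\<in>{..n}. 1) = nerve_map C A F' n \<sigma>"
      unfolding homotopy_def by blast
    have Hn: "H n \<in> Simp (sset_prod ?X ?I) n \<rightarrow>\<^sub>E Simp (Ner A) n" for n
      using H unfolding simplicial_map_def by blast
    have Hact: "H m (act (sset_prod ?X ?I) m n \<theta> x) = act (Ner A) m n \<theta> (H n x)"
      if "\<theta> \<in> simplex_maps m n" "x \<in> Simp (sset_prod ?X ?I) n" for m n \<theta> x
      using H that unfolding simplicial_map_def by blast
    \<comment> \<open>Transport of \<open>H\<close> along the isomorphism given by base and
      height.\<close>
    define \<phi> where "\<phi> = (\<lambda>n. \<lambda>\<rho>\<in>Simp ?Z n. H n (base_simplex C n \<rho>, height n \<rho>))"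
    have "simplicial_map ?Z (Ner A) \<phi>"
      unfolding simplicial_map_def
    proof (intro conjI allI ballI)
      fix n
      have "H n (base_simplex C n \<rho>, height n \<rho>) \<in> Simp (Ner A) n" if "\<rho> \<in> Simp ?Z n" for \<rho>
        by (rule PiE_mem[OF Hn]) (use that cylinder_simplex[of n \<rho>] in simp)
      then show "\<phi> n \<in> Simp ?Z n \<rightarrow>\<^sub>E Simp (Ner A) n"
        by (simp add: \<phi>_def del: Ner_simps)
    next
      fix m n \<theta> \<rho> assume \<theta>: "\<theta> \<in> simplex_maps m n" and "\<rho> \<in> Simp ?Z n"
      then have \<rho>: "lax_functor (ordinal n) (locally_discrete (cylinder C)) \<rho>" by simp
      have "act ?Z m n \<theta> \<rho> \<in> Simp ?Z m"
        using act_Ner(1)[OF two_category_locally_discrete[OF Z] \<theta> \<rho>] by simp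
      moreover have "(base_simplex C n \<rho>, height n \<rho>) \<in> Simp (sset_prod ?X ?I) n"
        using cylinder_simplex[OF \<rho>] by simp
      ultimately show "\<phi> m (act ?Z m n \<theta> \<rho>) = act (Ner A) m n \<theta> (\<phi> n \<rho>)"
        using Hact[OF \<theta>, of "(base_simplex C n \<rho>, height n \<rho>)"] act_cylinder_simplex[OF \<theta> \<rho>] \<open>\<rho> \<in> Simp ?Z n\<close>
        by (simp add: \<phi>_def del: Ner_simps)
    qed
    \<comment> \<open>Fullness of the nerve, applied to the cylinder in place of
      \<open>C\<close>.\<close>
    then obtain P where P: "lax_functor (locally_discrete (cylinder C)) A P"
      and \<phi>P: "\<phi> = nerve_map (cylinder C) A P"
      using lax_functor_lax_of_nerve[OF Z A] nerve_map_lax_of_nerve[OF Z A] by metis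
    \<comment> \<open>At constant height the projections undo the pairing, so the ends of
      \<open>P\<close> are the ends of \<open>H\<close>.\<close>
    have eq: "nerve_map (cylinder C) A P n (pair_simplex C n \<sigma> (\<lambda>i\<in>{..n}. e)) = H n (\<sigma>, \<lambda>i\<in>{..n}. e)"
      if \<sigma>: "lax_functor (ordinal n) (locally_discrete C) \<sigma>" and e: "e \<le> 1" for n \<sigma> e
      using pair_simplex(1)[OF \<sigma> simplex_maps_const[OF e]]
        cylinder_simplex_pair[OF \<sigma> simplex_maps_const[OF e]]
      unfolding \<phi>P[symmetric] by (simp add: \<phi>_def)
    have "lax_cylinder C A F 0 P"
      by (rule lax_cylinder_nerveI[OF A F P zero_le]) (use eq[OF _ zero_le] H0 in simp)
    moreover have "lax_cylinder C A F' 1 P"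
      by (rule lax_cylinder_nerveI[OF A F' P one_le]) (use eq[OF _ one_le] H1 in simp)
    ultimately show "\<exists>P. lax_functor (locally_discrete (cylinder C)) A P \<and> lax_cylinder C A F 0 P \<and>
      lax_cylinder C A F' 1 P"
      using P by blast
  }
  {
    assume "\<exists>P. lax_functor (locally_discrete (cylinder C)) A P \<and> lax_cylinder C A F 0 P \<and>
      lax_cylinder C A F' 1 P"
    then obtain P where P: "lax_functor (locally_discrete (cylinder C)) A P"
      and P0: "lax_cylinder C A F 0 P" and P1: "lax_cylinder C A F' 1 P" by blast
    define H where "H = (\<lambda>n. \<lambda>(\<sigma>, \<tau>)\<in>Simp (sset_prod ?X ?I) n.
      nerve_map (cylinder C) A P n (pair_simplex C n \<sigma> \<tau>))"
    have NP: "simplicial_map ?Z (Ner A) (nerve_map (cylinder C) A P)"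
      by (rule simplicial_map_nerve_map[OF Z A P])
    have "simplicial_map (sset_prod ?X ?I) (Ner A) H"
      unfolding simplicial_map_def
    proof (intro conjI allI ballI)
      fix n
      show "H n \<in> Simp (sset_prod ?X ?I) n \<rightarrow>\<^sub>E Simp (Ner A) n"
        using nerve_map(1)[OF Z A P pair_simplex(1)] by (auto simp: H_def)
    next
      fix m n \<theta> x assume \<theta>: "\<theta> \<in> simplex_maps m n" and x: "x \<in> Simp (sset_prod ?X ?I) n"
      obtain \<sigma> \<tau> where x_eq: "x = (\<sigma>, \<tau>)" by fastforce
      have \<sigma>: "lax_functor (ordinal n) (locally_discrete C) \<sigma>" and \<tau>: "\<tau> \<in> simplex_maps n 1"
        using x x_eq by simp_all
      have "pair_simplex C n \<sigma> \<tau> \<in> Simp ?Z n"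
        using pair_simplex(1)[OF \<sigma> \<tau>] by simp
      then have "nerve_map (cylinder C) A P m (act ?Z m n \<theta> (pair_simplex C n \<sigma> \<tau>)) =
          act (Ner A) m n \<theta> (nerve_map (cylinder C) A P n (pair_simplex C n \<sigma> \<tau>))"
        using NP \<theta> unfolding simplicial_map_def by blast
      moreover have "act ?X m n \<theta> \<sigma> \<in> Simp ?X m" "\<sigma> \<in> Simp ?X n"
        using act_Ner(1)[OF two_category_locally_discrete[OF C] \<theta> \<sigma>] \<sigma> by simp_all
      ultimately show "H m (act (sset_prod ?X ?I) m n \<theta> x) = act (Ner A) m n \<theta> (H n x)"
        using act_pair_simplex[OF \<theta> \<tau> \<sigma>] simplex_maps_compose[OF \<tau> \<theta>] \<tau>
        by (simp add: H_def x_eq del: Ner_simps)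
    qed
    moreover have "H n (\<sigma>, \<lambda>i\<in>{..n}. 0) = nerve_map C A F n \<sigma>"
      "H n (\<sigma>, \<lambda>i\<in>{..n}. 1) = nerve_map C A F' n \<sigma>" if "\<sigma> \<in> Simp ?X n" for n \<sigma>
      using that nerve_map_pair_simplex_const[OF A F P zero_le P0, of n \<sigma>]
        nerve_map_pair_simplex_const[OF A F' P one_le P1, of n \<sigma>]
        simplex_maps_const[OF zero_le, of n] simplex_maps_const[OF one_le, of n]
      by (simp_all add: H_def)
    ultimately show "\<exists>H. homotopy ?X (Ner A) (nerve_map C A F) (nerve_map C A F') H"
      unfolding homotopy_def by blast
  }
qed

end

section \<open>The 2-groupoid of a set of groups\<close>

lemma AUT_simps [simp]:
  "Ob (AUT S) = S"
  "(H, u, L) \<in> Ar (AUT S) \<longleftrightarrow> H \<in> S \<and> L \<in> S \<and> u \<in> iso H L \<and> u \<in> extensional (carrier H)"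
  "Dom (AUT S) (H, u, L) = H" "Cod (AUT S) (H, u, L) = L"
  "One (AUT S) H = (H, \<lambda>a\<in>carrier H. a, H)"
  "Comp (AUT S) = aut_comp"
  "((H, u, L), k, (H', v, L')) \<in> Cell (AUT S) \<longleftrightarrow> H = H' \<and> L = L' \<and> H \<in> S \<and> L \<in> S \<and>
     u \<in> iso H L \<and> u \<in> extensional (carrier H) \<and> v \<in> iso H L \<and> v \<in> extensional (carrier H) \<and>
     k \<in> carrier L \<and> (\<forall>a\<in>carrier H. v a \<otimes>\<^bsub>L\<^esub> k = k \<otimes>\<^bsub>L\<^esub> u a)"
  "Src (AUT S) (p, k, q) = p" "Trg (AUT S) (p, k, q) = q"
  "Id2 (AUT S) (H, u, L) = ((H, u, L), \<one>\<^bsub>L\<^esub>, (H, u, L))"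
  "VComp (AUT S) (p', l, q') ((H, u, L), k, q) = ((H, u, L), l \<otimes>\<^bsub>L\<^esub> k, q')"
  "HComp (AUT S) ((L', v, M), l, q') (p, k, q) =
     (aut_comp (L', v, M) p, l \<otimes>\<^bsub>M\<^esub> v k, aut_comp q' q)"
  by (auto simp: AUT_def)

lemma aut_comp_simps [simp]:
  "aut_comp (L', v, M) (H, u, L) = (H, compose (carrier H) v u, M)"
  by (simp add: aut_comp_def)

section \<open>Group isomorphisms as extensional functions\<close>

lemma iso_in: "u \<in> iso H L \<Longrightarrow> a \<in> carrier H \<Longrightarrow> u a \<in> carrier L"
  and iso_mult: "u \<in> iso H L \<Longrightarrow> a \<in> carrier H \<Longrightarrow> b \<in> carrier H \<Longrightarrow>
    u (a \<otimes>\<^bsub>H\<^esub> b) = u a \<otimes>\<^bsub>L\<^esub> u b"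
  by (auto simp: iso_def hom_def)

lemma iso_one: "group H \<Longrightarrow> group L \<Longrightarrow> u \<in> iso H L \<Longrightarrow> u \<one>\<^bsub>H\<^esub> = \<one>\<^bsub>L\<^esub>"
  by (auto simp: iso_def intro: hom_one)

lemma iso_inv: "group H \<Longrightarrow> group L \<Longrightarrow> u \<in> iso H L \<Longrightarrow> a \<in> carrier H \<Longrightarrow>
    u (inv\<^bsub>H\<^esub> a) = inv\<^bsub>L\<^esub> (u a)"
  by (metis group_hom.hom_inv group_hom.intro group_hom_axioms.intro iso_imp_homomorphism)

lemma iso_eqD: "u \<in> iso H L \<Longrightarrow> u a = u b \<Longrightarrow> a \<in> carrier H \<Longrightarrow> b \<in> carrier H \<Longrightarrow> a = b"
  by (auto simp: iso_def bij_betw_def inj_on_def)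

text \<open>1-cells of \<open>AUT\<close> are extensional, so composites and identities are cut off
  outside the carrier; this lemma absorbs such changes.\<close>

lemma iso_cong:
  assumes "group H" "u \<in> iso H L" "\<And>a. a \<in> carrier H \<Longrightarrow> v a = u a"
  shows "v \<in> iso H L"
proof -
  interpret group H by fact
  have "bij_betw v (carrier H) (carrier L)"
    using assms(2,3) bij_betw_cong[of "carrier H" v u] by (simp add: iso_def)
  then show ?thesis
    using assms(2,3) by (auto simp: iso_def hom_def)
qed

lemma iso_compose:
  assumes "group H" "u \<in> iso H L" "v \<in> iso L M"
  shows "compose (carrier H) v u \<in> iso H M"
  by (rule iso_cong[OF assms(1) iso_set_trans[OF assms(2,3)]]) (simp add: compose_eq)

lemma iso_restrict_id:
  assumes "group H"
  shows "(\<lambda>a\<in>carrier H. a) \<in> iso H H"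
  by (rule iso_cong[OF assms iso_set_refl]) simp

lemma iso_inv_into:
  assumes "group H" "u \<in> iso H L"
  shows "inv_into (carrier H) u \<in> iso L H"
    "a \<in> carrier L \<Longrightarrow> u (inv_into (carrier H) u a) = a"
  using group.iso_set_sym[OF assms] assms(2) f_inv_into_f[of a u "carrier H"]
  by (auto simp: iso_iff)

section \<open>The 2-category laws for groups, isomorphisms and conjugating elements\<close>

locale group_family =
  fixes S :: "'k monoid set"
  assumes groups: "H \<in> S \<Longrightarrow> group H"
begin

lemma category_AUT: "category (AUT S)"
proof
  fix f assume "f \<in> Ar (AUT S)"
  then obtain H u L where f: "f = (H, u, L)" "H \<in> S" "L \<in> S" "u \<in> iso H L" "u \<in> extensional (carrier H)"
    by (cases f) auto
  then have "u \<in> carrier H \<rightarrow> carrier L"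
    by (auto intro: iso_in)
  then show "Dom (AUT S) f \<in> Ob (AUT S)" "Cod (AUT S) f \<in> Ob (AUT S)"
    "Comp (AUT S) f (One (AUT S) (Dom (AUT S) f)) = f"
    "Comp (AUT S) (One (AUT S) (Cod (AUT S) f)) f = f"
    using f by (simp_all add: compose_Id Id_compose)
next
  fix H assume "H \<in> Ob (AUT S)"
  then show "One (AUT S) H \<in> Ar (AUT S) \<and> Dom (AUT S) (One (AUT S) H) = H \<and>
      Cod (AUT S) (One (AUT S) H) = H"
    using iso_restrict_id[OF groups] by simp
next
  fix f g assume "(f, g) \<in> composable (AUT S)"
  then show "Comp (AUT S) g f \<in> Ar (AUT S) \<and> Dom (AUT S) (Comp (AUT S) g f) = Dom (AUT S) f \<and>
      Cod (AUT S) (Comp (AUT S) g f) = Cod (AUT S) g"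
    using groups by (cases f; cases g) (auto simp: composable_def intro: iso_compose)
next
  fix f g k assume "(f, g) \<in> composable (AUT S)" "(g, k) \<in> composable (AUT S)"
  then obtain H u L v M w N where "f = (H, u, L)" "g = (L, v, M)" "k = (M, w, N)" "u \<in> iso H L"
    by (cases f; cases g; cases k) (auto simp: composable_def)
  moreover from this have "u \<in> carrier H \<rightarrow> carrier L"
    by (auto intro: iso_in)
  ultimately show "Comp (AUT S) k (Comp (AUT S) g f) = Comp (AUT S) (Comp (AUT S) k g) f"
    using compose_assoc[of u "carrier H" "carrier L" w v] by simp
qed

text \<open>The last four equations are the unit laws of \<open>compose\<close>, recorded because
  whiskering with an identity 1-cell leaves exactly such terms.\<close>

lemma Cell_AUT_cases:
  assumes "a \<in> Cell (AUT S)"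
  obtains H u L k v where "a = ((H, u, L), k, (H, v, L))" "H \<in> S" "L \<in> S" "group H" "group L"
    "u \<in> iso H L" "u \<in> extensional (carrier H)" "v \<in> iso H L" "v \<in> extensional (carrier H)"
    "k \<in> carrier L" "\<And>a. a \<in> carrier H \<Longrightarrow> v a \<otimes>\<^bsub>L\<^esub> k = k \<otimes>\<^bsub>L\<^esub> u a"
    "compose (carrier H) u (\<lambda>a\<in>carrier H. a) = u" "compose (carrier H) v (\<lambda>a\<in>carrier H. a) = v"
    "compose (carrier H) (\<lambda>a\<in>carrier L. a) u = u" "compose (carrier H) (\<lambda>a\<in>carrier L. a) v = v"
proof -
  obtain H u L k H' v L' where a: "a = ((H, u, L), k, (H', v, L'))"
    by (metis prod_cases3)
  have "u \<in> carrier H \<rightarrow> carrier L" "v \<in> carrier H \<rightarrow> carrier L"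
    using assms a by (auto intro: iso_in)
  then show thesis
    using that[of H u L k v] assms a groups by (auto simp: compose_Id Id_compose)
qed

lemma two_category_AUT: "two_category (AUT S)"
proof -
  interpret category "AUT S" by (rule category_AUT)
  show ?thesis
  proof
    fix a assume "a \<in> Cell (AUT S)"
    then show "Src (AUT S) a \<in> Ar (AUT S)" "Trg (AUT S) a \<in> Ar (AUT S)"
      "Dom (AUT S) (Src (AUT S) a) = Dom (AUT S) (Trg (AUT S) a) \<and>
        Cod (AUT S) (Src (AUT S) a) = Cod (AUT S) (Trg (AUT S) a)"
      "VComp (AUT S) a (Id2 (AUT S) (Src (AUT S) a)) = a"
      "VComp (AUT S) (Id2 (AUT S) (Trg (AUT S) a)) a = a"
      "whisker_right (AUT S) a (One (AUT S) (Dom (AUT S) (Src (AUT S) a))) = a"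
      "whisker_left (AUT S) (One (AUT S) (Cod (AUT S) (Src (AUT S) a))) a = a"
      by (cases rule: Cell_AUT_cases,
          simp add: group.is_monoid monoid.r_one monoid.l_one monoid.one_closed iso_one)+
  next
    fix f assume "f \<in> Ar (AUT S)"
    then show "Id2 (AUT S) f \<in> Cell (AUT S) \<and> Src (AUT S) (Id2 (AUT S) f) = f \<and>
        Trg (AUT S) (Id2 (AUT S) f) = f"
      using groups by (cases f) (auto simp: group.is_monoid iso_in)
  next
    fix a b assume ab: "(a, b) \<in> vcomposable (AUT S)"
    then have "a \<in> Cell (AUT S)" "b \<in> Cell (AUT S)" "Trg (AUT S) a = Src (AUT S) b"
      by (simp_all add: vcomposable_def)
    from this(1) show "VComp (AUT S) b a \<in> Cell (AUT S) \<and> Src (AUT S) (VComp (AUT S) b a) = Src (AUT S) a \<and>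
        Trg (AUT S) (VComp (AUT S) b a) = Trg (AUT S) b"
    proof (cases rule: Cell_AUT_cases)
      case a: (1 H u L k v)
      from \<open>b \<in> Cell (AUT S)\<close> show ?thesis
      proof (cases rule: Cell_AUT_cases)
        case b: (1 H' v' L' l w)
        then have [simp]: "H' = H" "v' = v" "L' = L"
          using a(1) \<open>Trg (AUT S) a = Src (AUT S) b\<close> by auto
        interpret L: group L by (rule a)
        \<comment> \<open>Stacking two naturality squares: \<open>w x\<close> passes
          \<open>l\<close> and becomes \<open>v x\<close>, which passes \<open>k\<close> and becomes
          \<open>u x\<close>.\<close>
        have "w x \<otimes>\<^bsub>L\<^esub> (l \<otimes>\<^bsub>L\<^esub> k) = l \<otimes>\<^bsub>L\<^esub> k \<otimes>\<^bsub>L\<^esub> u x" if x: "x \<in> carrier H" for x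
        proof -
          have c: "u x \<in> carrier L" "v x \<in> carrier L" "w x \<in> carrier L"
            using a b x by (auto intro: iso_in)
          have "w x \<otimes>\<^bsub>L\<^esub> (l \<otimes>\<^bsub>L\<^esub> k) = (l \<otimes>\<^bsub>L\<^esub> v x) \<otimes>\<^bsub>L\<^esub> k"
            using a b c x b(11)[of x] by (simp flip: L.m_assoc)
          also have "\<dots> = l \<otimes>\<^bsub>L\<^esub> (k \<otimes>\<^bsub>L\<^esub> u x)"
            using a b c x a(11)[of x] by (simp add: L.m_assoc)
          finally show ?thesis
            using a b c by (simp add: L.m_assoc)
        qed
        then show ?thesis
          using a b by simp
      qed
    qed
  next
    fix a b c assume "(a, b) \<in> vcomposable (AUT S)" "(b, c) \<in> vcomposable (AUT S)"
    then have abc: "a \<in> Cell (AUT S)" "b \<in> Cell (AUT S)" "c \<in> Cell (AUT S)"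
      and eq: "Trg (AUT S) a = Src (AUT S) b" "Trg (AUT S) b = Src (AUT S) c"
      by (simp_all add: vcomposable_def)
    have rep: "\<exists>H u L k v. p = ((H, u, L), k, (H, v, L)) \<and> k \<in> carrier L \<and> group L"
      if "p \<in> Cell (AUT S)" for p
      using that by (cases rule: Cell_AUT_cases) blast
    obtain H u L k v where a: "a = ((H, u, L), k, (H, v, L))" "k \<in> carrier L" "group L"
      using rep[OF abc(1)] by blast
    obtain H' u' L' k' v' where b: "b = ((H', u', L'), k', (H', v', L'))" "k' \<in> carrier L'"
      using rep[OF abc(2)] by blast
    obtain H'' u'' L'' k'' v'' where c: "c = ((H'', u'', L''), k'', (H'', v'', L''))" "k'' \<in> carrier L''"
      using rep[OF abc(3)] by blast
    have "L' = L" "L'' = L"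
      using eq a(1) b(1) c(1) by simp_all
    then show "VComp (AUT S) c (VComp (AUT S) b a) = VComp (AUT S) (VComp (AUT S) c b) a"
      using a b c by (simp add: group.is_monoid monoid.m_assoc)
  next
    fix a b assume "(a, b) \<in> hcomposable (AUT S)"
    then have ab: "a \<in> Cell (AUT S)" "b \<in> Cell (AUT S)"
      "Cod (AUT S) (Src (AUT S) a) = Dom (AUT S) (Src (AUT S) b)"
      by (simp_all add: hcomposable_def)
    from ab(1) show "HComp (AUT S) b a \<in> Cell (AUT S) \<and>
      Src (AUT S) (HComp (AUT S) b a) = Comp (AUT S) (Src (AUT S) b) (Src (AUT S) a) \<and>
      Trg (AUT S) (HComp (AUT S) b a) = Comp (AUT S) (Trg (AUT S) b) (Trg (AUT S) a)"
    proof (cases rule: Cell_AUT_cases)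
      case a: (1 H u L k u')
      from ab(2) show ?thesis
      proof (cases rule: Cell_AUT_cases)
        case b: (1 L' v M l v')
        then have [simp]: "L' = L"
          using a(1) ab(3) by auto
        interpret M: group M by (rule b)
        have "v' (u' x) \<otimes>\<^bsub>M\<^esub> (l \<otimes>\<^bsub>M\<^esub> v k) = l \<otimes>\<^bsub>M\<^esub> v k \<otimes>\<^bsub>M\<^esub> v (u x)"
          if x: "x \<in> carrier H" for x
        proof -
          have c: "u x \<in> carrier L" "u' x \<in> carrier L" "v k \<in> carrier M" "v (u x) \<in> carrier M"
            "v (u' x) \<in> carrier M" "v' (u' x) \<in> carrier M"
            using a(6,8,10) b(6,8) x by (simp_all add: iso_in[of _ H L] iso_in[of _ L M])
          \<comment> \<open>\<open>v\<close> applied to the naturality square of \<open>k\<close> at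
            \<open>x\<close>; the square of \<open>l\<close> at \<open>u' x\<close> then
            finishes.\<close>
          have "v (u' x) \<otimes>\<^bsub>M\<^esub> v k = v k \<otimes>\<^bsub>M\<^esub> v (u x)"
            using a(11)[OF x] iso_mult[of v L M "u' x" k] iso_mult[of v L M k "u x"] a(10) b(6) c by simp
          then have "l \<otimes>\<^bsub>M\<^esub> (v (u' x) \<otimes>\<^bsub>M\<^esub> v k) = l \<otimes>\<^bsub>M\<^esub> v k \<otimes>\<^bsub>M\<^esub> v (u x)"
            using b(10) c by (simp add: M.m_assoc)
          then show ?thesis
            using b(10) c b(11)[of "u' x"] by (simp flip: M.m_assoc)
        qed
        then show ?thesis
          using a(1-10) b(1-10) iso_compose[of H u L v M] iso_compose[of H u' L v' M] iso_in[of v L M k]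
          by (simp add: compose_eq)
      qed
    qed
  next
    fix f g assume "(f, g) \<in> composable (AUT S)"
    then obtain H u L v M where f: "f = (H, u, L)" and g: "g = (L, v, M)"
      and v: "L \<in> S" "M \<in> S" "v \<in> iso L M"
      by (cases f; cases g) (auto simp: composable_def)
    show "HComp (AUT S) (Id2 (AUT S) g) (Id2 (AUT S) f) = Id2 (AUT S) (Comp (AUT S) g f)"
      using iso_one[OF groups[OF v(1)] groups[OF v(2)] v(3)] v groups by (simp add: f g group.is_monoid)
  next
    fix a b c assume "(a, b) \<in> hcomposable (AUT S)" "(b, c) \<in> hcomposable (AUT S)"
    then have abc: "a \<in> Cell (AUT S)" "b \<in> Cell (AUT S)" "c \<in> Cell (AUT S)"
      "Cod (AUT S) (Src (AUT S) a) = Dom (AUT S) (Src (AUT S) b)"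
      "Cod (AUT S) (Src (AUT S) b) = Dom (AUT S) (Src (AUT S) c)"
      by (simp_all add: hcomposable_def)
    from abc(1) show "HComp (AUT S) c (HComp (AUT S) b a) = HComp (AUT S) (HComp (AUT S) c b) a"
    proof (cases rule: Cell_AUT_cases)
      case a: (1 H u L k u')
      from abc(2) show ?thesis
      proof (cases rule: Cell_AUT_cases)
        case b: (1 L' v M l v')
        from abc(3) show ?thesis
        proof (cases rule: Cell_AUT_cases)
          case c: (1 M' w N m w')
          have [simp]: "L' = L" "M' = M"
            using a(1) b(1) c(1) abc(4,5) by auto
          interpret N: group N by (rule c)
          have d: "v k \<in> carrier M" "w l \<in> carrier N" "w (v k) \<in> carrier N"
            using a(10) b(6,10) c(6) by (simp_all add: iso_in[of _ L M] iso_in[of _ M N])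
          have "u \<in> carrier H \<rightarrow> carrier L" "u' \<in> carrier H \<rightarrow> carrier L"
            using iso_in[OF a(6)] iso_in[OF a(8)] by simp_all
          then show ?thesis
            using a(1,10) b(1,10) c(1,10) iso_mult[of w M N l "v k"] c(6) d
            by (simp add: compose_eq N.m_assoc compose_assoc[of _ _ "carrier L"])
        qed
      qed
    qed
  next
    fix a a' b b' assume "(a, a') \<in> vcomposable (AUT S)" "(b, b') \<in> vcomposable (AUT S)"
      "(a, b) \<in> hcomposable (AUT S)"
    then have ab: "a \<in> Cell (AUT S)" "b \<in> Cell (AUT S)" "a' \<in> Cell (AUT S)" "b' \<in> Cell (AUT S)"
      "Cod (AUT S) (Src (AUT S) a) = Dom (AUT S) (Src (AUT S) b)"
      "Trg (AUT S) a = Src (AUT S) a'" "Trg (AUT S) b = Src (AUT S) b'"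
      by (simp_all add: hcomposable_def vcomposable_def)
    from ab(1) show "HComp (AUT S) (VComp (AUT S) b' b) (VComp (AUT S) a' a) =
        VComp (AUT S) (HComp (AUT S) b' a') (HComp (AUT S) b a)"
    proof (cases rule: Cell_AUT_cases)
      case a: (1 H u L k u')
      from ab(2) show ?thesis
      proof (cases rule: Cell_AUT_cases)
        case b: (1 L' v M l v')
        from ab(3) show ?thesis
        proof (cases rule: Cell_AUT_cases)
          case a': (1 H1 u1 L1 k' u'')
          from ab(4) show ?thesis
          proof (cases rule: Cell_AUT_cases)
            case b': (1 L2 v1 M1 l' v'')
            have [simp]: "L' = L" "H1 = H" "u1 = u'" "L1 = L" "L2 = L" "v1 = v'" "M1 = M"
              using a(1) b(1) a'(1) b'(1) ab(5-7) by auto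
            interpret M: group M by (rule b)
            have c: "v k \<in> carrier M" "v k' \<in> carrier M" "v' k' \<in> carrier M"
              using a(10) a'(10) b(6,8) by (simp_all add: iso_in[of _ L M])
            \<comment> \<open>The interchange law is the naturality of \<open>l\<close> at the
              element \<open>k'\<close>.\<close>
            have "l \<otimes>\<^bsub>M\<^esub> (v k' \<otimes>\<^bsub>M\<^esub> v k) = v' k' \<otimes>\<^bsub>M\<^esub> l \<otimes>\<^bsub>M\<^esub> v k"
              using b(11)[of k'] a'(10) b(10) c by (simp flip: M.m_assoc)
            then have "l' \<otimes>\<^bsub>M\<^esub> l \<otimes>\<^bsub>M\<^esub> v (k' \<otimes>\<^bsub>L\<^esub> k) = l' \<otimes>\<^bsub>M\<^esub> v' k' \<otimes>\<^bsub>M\<^esub> (l \<otimes>\<^bsub>M\<^esub> v k)"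
              using a(10) a'(10) b(6,10) b'(10) c iso_mult[of v L M k' k] by (simp add: M.m_assoc)
            then show ?thesis
              using a(1) a'(1) b(1) b'(1) by simp
          qed
        qed
      qed
    qed
  qed
qed

end

section \<open>Factor sets\<close>

text \<open>A normal lax 2-functor to \<open>AUT S\<close> in elementary terms:
  \<open>u_Comp\<close> makes \<open>c f g\<close> a 2-cell from \<open>u (Comp C g f)\<close> to
  the composite of \<open>u g\<close> and \<open>u f\<close>, and \<open>cocycle\<close> is
  \<open>str_assoc\<close>. For a one-object groupoid this is Schreier's description of a group
  extension. Values of \<open>u\<close> outside the carriers are left free, so that maps can be
  composed without restrictions.\<close>

locale factor_set = category C for C :: "('o, 'm) cat" +
  fixes S :: "'k monoid set" and b :: "'o \<Rightarrow> 'k monoid" and u :: "'m \<Rightarrow> 'k \<Rightarrow> 'k"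
    and c :: "'m \<Rightarrow> 'm \<Rightarrow> 'k"
  assumes b_in: "x \<in> Ob C \<Longrightarrow> b x \<in> S"
    and group_b: "x \<in> Ob C \<Longrightarrow> group (b x)"
    and u_iso: "f \<in> Ar C \<Longrightarrow> u f \<in> iso (b (Dom C f)) (b (Cod C f))"
    and u_One: "x \<in> Ob C \<Longrightarrow> a \<in> carrier (b x) \<Longrightarrow> u (One C x) a = a"
    and c_in: "(f, g) \<in> composable C \<Longrightarrow> c f g \<in> carrier (b (Cod C g))"
    and u_Comp: "(f, g) \<in> composable C \<Longrightarrow> a \<in> carrier (b (Dom C f)) \<Longrightarrow>
      u g (u f a) \<otimes>\<^bsub>b (Cod C g)\<^esub> c f g = c f g \<otimes>\<^bsub>b (Cod C g)\<^esub> u (Comp C g f) a"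
    and cocycle: "(f, g) \<in> composable C \<Longrightarrow> (g, k) \<in> composable C \<Longrightarrow>
      c g k \<otimes>\<^bsub>b (Cod C k)\<^esub> c f (Comp C k g) = u k (c f g) \<otimes>\<^bsub>b (Cod C k)\<^esub> c (Comp C g f) k"
    and c_One_left: "f \<in> Ar C \<Longrightarrow> c f (One C (Cod C f)) = \<one>\<^bsub>b (Cod C f)\<^esub>"
    and c_One_right: "f \<in> Ar C \<Longrightarrow> c (One C (Dom C f)) f = \<one>\<^bsub>b (Cod C f)\<^esub>"
begin

lemma group_Dom: "f \<in> Ar C \<Longrightarrow> group (b (Dom C f))"
  and group_Cod: "f \<in> Ar C \<Longrightarrow> group (b (Cod C f))"
  by (simp_all add: group_b Dom_in Cod_in)

lemma u_in: "f \<in> Ar C \<Longrightarrow> a \<in> carrier (b (Dom C f)) \<Longrightarrow> u f a \<in> carrier (b (Cod C f))"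
  using iso_in[OF u_iso] .

lemma u_mult: "f \<in> Ar C \<Longrightarrow> a \<in> carrier (b (Dom C f)) \<Longrightarrow> a' \<in> carrier (b (Dom C f)) \<Longrightarrow>
    u f (a \<otimes>\<^bsub>b (Dom C f)\<^esub> a') = u f a \<otimes>\<^bsub>b (Cod C f)\<^esub> u f a'"
  using iso_mult[OF u_iso] .

lemma u_unit: "f \<in> Ar C \<Longrightarrow> u f \<one>\<^bsub>b (Dom C f)\<^esub> = \<one>\<^bsub>b (Cod C f)\<^esub>"
  using iso_one[OF group_Dom group_Cod u_iso] .

lemma u_inv: "f \<in> Ar C \<Longrightarrow> a \<in> carrier (b (Dom C f)) \<Longrightarrow>
    u f (inv\<^bsub>b (Dom C f)\<^esub> a) = inv\<^bsub>b (Cod C f)\<^esub> (u f a)"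
  using iso_inv[OF group_Dom group_Cod u_iso] .

end

definition aut_map :: "('o, 'm, 'm, 'k monoid, 'k aut1, 'k aut2) laxfun \<Rightarrow> 'm \<Rightarrow> 'k \<Rightarrow> 'k" where
  "aut_map F f = fst (snd (far F f))"

definition factor :: "('o, 'm, 'm, 'k monoid, 'k aut1, 'k aut2) laxfun \<Rightarrow> 'm \<Rightarrow> 'm \<Rightarrow> 'k" where
  "factor F f g = fst (snd (fstr F (f, g)))"

text \<open>The restriction in \<open>r\<close> supplies the extensionality that \<open>AUT\<close>
  demands of 1-cells and \<open>factor_set\<close> does not provide.\<close>

definition factor_lax :: "('o, 'm) cat \<Rightarrow> 'k monoid set \<Rightarrow> ('o \<Rightarrow> 'k monoid) \<Rightarrow> ('m \<Rightarrow> 'k \<Rightarrow> 'k) \<Rightarrow>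
    ('m \<Rightarrow> 'm \<Rightarrow> 'k) \<Rightarrow> ('o, 'm, 'm, 'k monoid, 'k aut1, 'k aut2) laxfun" where
  "factor_lax C S b u c =
     (let r = (\<lambda>f. (b (Dom C f), restrict (u f) (carrier (b (Dom C f))), b (Cod C f)))
      in discrete_lax C (AUT S) b r (\<lambda>(f, g). (r (Comp C g f), c f g, aut_comp (r g) (r f))))"

text \<open>The elementary form of \<open>lax_transformation\<close>. Here too \<alpha> is
  constrained on carriers only, so inverses and composites can be taken as plain functions.\<close>

locale factor_transformation = F: factor_set C S b u c + F': factor_set C S b' u' c'
  for C :: "('o, 'm) cat" and S :: "'k monoid set" and b u c b' u' c' +
  fixes \<alpha> :: "'o \<Rightarrow> 'k \<Rightarrow> 'k" and s :: "'m \<Rightarrow> 'k"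
  assumes \<alpha>_iso: "x \<in> Ob C \<Longrightarrow> \<alpha> x \<in> iso (b x) (b' x)"
    and s_in: "f \<in> Ar C \<Longrightarrow> s f \<in> carrier (b' (Cod C f))"
    and s_natural: "f \<in> Ar C \<Longrightarrow> a \<in> carrier (b (Dom C f)) \<Longrightarrow>
      u' f (\<alpha> (Dom C f) a) \<otimes>\<^bsub>b' (Cod C f)\<^esub> s f = s f \<otimes>\<^bsub>b' (Cod C f)\<^esub> \<alpha> (Cod C f) (u f a)"
    and s_One: "x \<in> Ob C \<Longrightarrow> s (One C x) = \<one>\<^bsub>b' x\<^esub>"
    and s_coherence: "(f, g) \<in> composable C \<Longrightarrow>
      c' f g \<otimes>\<^bsub>b' (Cod C g)\<^esub> s (Comp C g f) =
      u' g (s f) \<otimes>\<^bsub>b' (Cod C g)\<^esub> (s g \<otimes>\<^bsub>b' (Cod C g)\<^esub> \<alpha> (Cod C g) (c f g))"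
begin

lemma \<alpha>_in: "x \<in> Ob C \<Longrightarrow> a \<in> carrier (b x) \<Longrightarrow> \<alpha> x a \<in> carrier (b' x)"
  using iso_in[OF \<alpha>_iso] .

lemma \<alpha>_mult: "x \<in> Ob C \<Longrightarrow> a \<in> carrier (b x) \<Longrightarrow> a' \<in> carrier (b x) \<Longrightarrow>
    \<alpha> x (a \<otimes>\<^bsub>b x\<^esub> a') = \<alpha> x a \<otimes>\<^bsub>b' x\<^esub> \<alpha> x a'"
  using iso_mult[OF \<alpha>_iso] .

lemma \<alpha>_unit: "x \<in> Ob C \<Longrightarrow> \<alpha> x \<one>\<^bsub>b x\<^esub> = \<one>\<^bsub>b' x\<^esub>"
  using iso_one[OF F.group_b F'.group_b \<alpha>_iso] .

end

section \<open>Lax 2-functors and factor sets\<close>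

context group_family
begin

lemma lax_functor_factor_lax:
  assumes "factor_set C S b u c"
  shows "lax_functor (locally_discrete C) (AUT S) (factor_lax C S b u c)"
proof -
  interpret factor_set C S b u c by fact
  define r where "r f = (b (Dom C f), restrict (u f) (carrier (b (Dom C f))), b (Cod C f))" for f
  have u_ext: "restrict (u f) (carrier (b (Dom C f))) \<in> iso (b (Dom C f)) (b (Cod C f))" if "f \<in> Ar C" for f
    by (rule iso_cong[OF group_Dom[OF that] u_iso[OF that]]) simp
  have rc: "aut_comp (r g) (r f) = (b (Dom C f),
      compose (carrier (b (Dom C f))) (restrict (u g) (carrier (b (Dom C g)))) (restrict (u f) (carrier (b (Dom C f)))),
      b (Cod C g))"
    if "(f, g) \<in> composable C" for f g
    using that by (simp add: r_def composable_def)
  have unit_comp: "aut_comp (One (AUT S) (b (Cod C f))) (r f) = r f"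
    "aut_comp (r f) (One (AUT S) (b (Dom C f))) = r f" if "f \<in> Ar C" for f
    using category.One_Comp[OF category_AUT, of "r f"]
      category.Comp_One[OF category_AUT, of "r f"] u_ext[OF that] b_in Dom_in[OF that] Cod_in[OF that]
    by (simp_all add: r_def)
  have r_One: "r (One C x) = One (AUT S) (b x)" if "x \<in> Ob C" for x
    using One_in[OF that] u_One[OF that] by (auto simp: r_def fun_eq_iff restrict_def)
  have "lax_functor (locally_discrete C) (AUT S)
      (discrete_lax C (AUT S) b r (\<lambda>(f, g). (r (Comp C g f), c f g, aut_comp (r g) (r f))))"
  proof (rule lax_functor_discrete_laxI[OF _ two_category_AUT])
    show "category C" by unfold_locales
    fix f assume f: "f \<in> Ar C"
    show "r f \<in> Ar (AUT S)"
      using u_ext[OF f] b_in Dom_in[OF f] Cod_in[OF f] by (simp add: r_def)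
    show "Dom (AUT S) (r f) = b (Dom C f)" "Cod (AUT S) (r f) = b (Cod C f)"
      by (simp_all add: r_def)
    show "(case (f, One C (Cod C f)) of (f, g) \<Rightarrow> (r (Comp C g f), c f g, aut_comp (r g) (r f))) = Id2 (AUT S) (r f)"
      using f unit_comp[OF f] by (simp add: One_Comp r_One Cod_in c_One_left del: AUT_simps(5)) (simp add: r_def)
    show "(case (One C (Dom C f), f) of (f, g) \<Rightarrow> (r (Comp C g f), c f g, aut_comp (r g) (r f))) = Id2 (AUT S) (r f)"
      using f unit_comp[OF f] by (simp add: Comp_One r_One Dom_in c_One_right del: AUT_simps(5)) (simp add: r_def)
  next
    fix f g assume fg: "(f, g) \<in> composable C"
    note cs = Comp_simps[OF fg]
    have "(\<lambda>a\<in>carrier (b (Dom C (Comp C g f))). u (Comp C g f) a) \<in> iso (b (Dom C f)) (b (Cod C g))"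
      using u_ext[OF cs(4)] cs by simp
    moreover have "compose (carrier (b (Dom C f))) (restrict (u g) (carrier (b (Dom C g))))
        (restrict (u f) (carrier (b (Dom C f)))) \<in> iso (b (Dom C f)) (b (Cod C g))"
      using iso_compose[OF group_Dom[OF cs(1)] u_ext[OF cs(1)]] u_ext[OF cs(2)] cs(3) by simp
    ultimately show "(case (f, g) of (f, g) \<Rightarrow> (r (Comp C g f), c f g, aut_comp (r g) (r f))) \<in> Cell (AUT S)"
      using u_Comp[OF fg] c_in[OF fg] b_in Dom_in[OF cs(1)] Cod_in[OF cs(2)] u_in[OF cs(1)] cs
      by (simp add: rc[OF fg]) (simp add: r_def compose_eq)
    show "Src (AUT S) (case (f, g) of (f, g) \<Rightarrow> (r (Comp C g f), c f g, aut_comp (r g) (r f))) = r (Comp C g f)"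
      "Trg (AUT S) (case (f, g) of (f, g) \<Rightarrow> (r (Comp C g f), c f g, aut_comp (r g) (r f))) = Comp (AUT S) (r g) (r f)"
      by simp_all
    fix k assume gk: "(g, k) \<in> composable C"
    note ds = Comp_simps[OF gk]
    interpret M: group "b (Cod C k)" by (rule group_Cod[OF ds(2)])
    have "(r f, r g) \<in> composable (AUT S)" "(r g, r k) \<in> composable (AUT S)"
      using u_ext[OF cs(1)] u_ext[OF cs(2)] u_ext[OF ds(2)] b_in Dom_in Cod_in cs ds
      by (simp_all add: composable_def r_def)
    \<comment> \<open>The two whiskered structure 2-cells end in composites that are bracketed
      differently, so their targets agree only after reassociation.\<close>
    from category.Comp_assoc[OF category_AUT this]
    have assoc: "aut_comp (r k) (aut_comp (r g) (r f)) = aut_comp (aut_comp (r k) (r g)) (r f)"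
      by simp
    have "HComp (AUT S) (r (Comp C k g), c g k, aut_comp (r k) (r g)) (Id2 (AUT S) (r f)) =
        (aut_comp (r (Comp C k g)) (r f), c g k, aut_comp (aut_comp (r k) (r g)) (r f))"
      using c_in[OF gk] u_unit[OF ds(4)] cs ds M.one_closed
        group.is_monoid[OF group_Cod[OF cs(1)]]
      by (simp add: r_def monoid.one_closed)
    moreover have "HComp (AUT S) (Id2 (AUT S) (r k)) (r (Comp C g f), c f g, aut_comp (r g) (r f)) =
        (aut_comp (r k) (r (Comp C g f)), u k (c f g), aut_comp (r k) (aut_comp (r g) (r f)))"
      using c_in[OF fg] u_in[OF ds(2)] cs ds by (simp add: r_def)
    ultimately show "VComp (AUT S)
        (whisker_right (AUT S) (case (g, k) of (f, g) \<Rightarrow> (r (Comp C g f), c f g, aut_comp (r g) (r f))) (r f))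
        (case (f, Comp C k g) of (f, g) \<Rightarrow> (r (Comp C g f), c f g, aut_comp (r g) (r f))) =
      VComp (AUT S)
        (whisker_left (AUT S) (r k) (case (f, g) of (f, g) \<Rightarrow> (r (Comp C g f), c f g, aut_comp (r g) (r f))))
        (case (Comp C g f, k) of (f, g) \<Rightarrow> (r (Comp C g f), c f g, aut_comp (r g) (r f)))"
      using cocycle[OF fg gk] Comp_assoc[OF fg gk] Comp_simps[OF composable_Comp(1)[OF fg gk]] cs ds
      by (simp add: assoc) (simp add: r_def)
  qed (simp_all add: b_in r_One del: AUT_simps(5))
  then show ?thesis
    unfolding factor_lax_def Let_def r_def[abs_def] .
qed

context
  fixes C :: "('o, 'm) cat" and F
  assumes C: "category C" and F: "lax_functor (locally_discrete C) (AUT S) F"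
begin

interpretation C: category C by (rule C)

lemma far_AUT:
  assumes "f \<in> Ar C"
  shows "far F f = (fob F (Dom C f), aut_map F f, fob F (Cod C f))"
    "aut_map F f \<in> iso (fob F (Dom C f)) (fob F (Cod C f))"
    "aut_map F f \<in> extensional (carrier (fob F (Dom C f)))"
    "fob F (Dom C f) \<in> S" "fob F (Cod C f) \<in> S"
  using lax_functor_discreteD(2,3,4)[OF C F assms]
  by (cases "far F f"; simp add: aut_map_def)+

lemma fstr_AUT:
  assumes "(f, g) \<in> composable C"
  shows "fstr F (f, g) = ((fob F (Dom C f), aut_map F (Comp C g f), fob F (Cod C g)), factor F f g,
      (fob F (Dom C f), compose (carrier (fob F (Dom C f))) (aut_map F g) (aut_map F f), fob F (Cod C g)))"
    "factor F f g \<in> carrier (fob F (Cod C g))"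
    "a \<in> carrier (fob F (Dom C f)) \<Longrightarrow> aut_map F g (aut_map F f a) \<otimes>\<^bsub>fob F (Cod C g)\<^esub> factor F f g =
      factor F f g \<otimes>\<^bsub>fob F (Cod C g)\<^esub> aut_map F (Comp C g f) a"
proof -
  note cs = C.Comp_simps[OF assms]
  obtain p k q where s: "fstr F (f, g) = (p, k, q)"
    by (metis prod_cases3)
  note d = lax_functor_discreteD(7,8,9)[OF C F assms, unfolded s, simplified]
  show e: "fstr F (f, g) = ((fob F (Dom C f), aut_map F (Comp C g f), fob F (Cod C g)), factor F f g,
      (fob F (Dom C f), compose (carrier (fob F (Dom C f))) (aut_map F g) (aut_map F f), fob F (Cod C g)))"
    using d(2,3) cs by (simp add: s factor_def far_AUT(1))
  show "factor F f g \<in> carrier (fob F (Cod C g))"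
    using lax_functor_discreteD(7)[OF C F assms, unfolded e] by simp
  show "aut_map F g (aut_map F f a) \<otimes>\<^bsub>fob F (Cod C g)\<^esub> factor F f g =
      factor F f g \<otimes>\<^bsub>fob F (Cod C g)\<^esub> aut_map F (Comp C g f) a"
    if "a \<in> carrier (fob F (Dom C f))"
    using lax_functor_discreteD(7)[OF C F assms, unfolded e] that by (auto simp: compose_eq)
qed

lemma factor_set_lax_functor: "factor_set C S (fob F) (aut_map F) (factor F)"
proof (intro factor_set.intro factor_set_axioms.intro)
  show "category C" by (rule C)
next
  fix x assume x: "x \<in> Ob C"
  show "fob F x \<in> S" "group (fob F x)"
    using lax_functor_discreteD(1)[OF C F x] groups by simp_all
  show "aut_map F (One C x) a = a" if "a \<in> carrier (fob F x)" for a
    using lax_functor_discreteD(5)[OF C F x] that by (simp add: aut_map_def)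
next
  fix f assume f: "f \<in> Ar C"
  show "aut_map F f \<in> iso (fob F (Dom C f)) (fob F (Cod C f))"
    by (rule far_AUT(2)[OF f])
  show "factor F f (One C (Cod C f)) = \<one>\<^bsub>fob F (Cod C f)\<^esub>"
    "factor F (One C (Dom C f)) f = \<one>\<^bsub>fob F (Cod C f)\<^esub>"
    using lax_functor_discreteD(11,12)[OF C F f] by (simp_all add: factor_def far_AUT(1)[OF f])
next
  fix f g assume fg: "(f, g) \<in> composable C"
  show "factor F f g \<in> carrier (fob F (Cod C g))"
    by (rule fstr_AUT(2)[OF fg])
  show "aut_map F g (aut_map F f a) \<otimes>\<^bsub>fob F (Cod C g)\<^esub> factor F f g =
      factor F f g \<otimes>\<^bsub>fob F (Cod C g)\<^esub> aut_map F (Comp C g f) a"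
    if "a \<in> carrier (fob F (Dom C f))" for a
    by (rule fstr_AUT(3)[OF fg that])
  fix k assume gk: "(g, k) \<in> composable C"
  note cs = C.Comp_simps[OF fg] and ds = C.Comp_simps[OF gk]
    and cc = C.composable_Comp[OF fg gk]
  interpret M: group "fob F (Cod C k)"
    using far_AUT(5)[OF ds(2)] groups by simp
  \<comment> \<open>\<open>HComp\<close> multiplies \<open>factor F g k\<close> by the image of the
    unit element that stands for the identity 2-cell of \<open>far F f\<close>.\<close>
  have "aut_map F (Comp C k g) \<one>\<^bsub>fob F (Cod C f)\<^esub> = \<one>\<^bsub>fob F (Cod C k)\<^esub>"
    using iso_one[OF _ _ far_AUT(2)[OF ds(4)]] far_AUT(4,5)[OF ds(4)] groups cs ds by simp
  moreover have "aut_map F k (factor F f g) \<in> carrier (fob F (Cod C k))"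
    using iso_in[OF far_AUT(2)[OF ds(2)]] fstr_AUT(2)[OF fg] ds by simp
  ultimately show "factor F g k \<otimes>\<^bsub>fob F (Cod C k)\<^esub> factor F f (Comp C k g) =
      aut_map F k (factor F f g) \<otimes>\<^bsub>fob F (Cod C k)\<^esub> factor F (Comp C g f) k"
    using lax_functor_discreteD(10)[OF C F fg gk] cs ds fstr_AUT(2)[OF gk]
    by (simp add: fstr_AUT(1)[OF fg] fstr_AUT(1)[OF gk] fstr_AUT(1)[OF cc(1)] fstr_AUT(1)[OF cc(2)]
      far_AUT(1)[OF cs(1)] far_AUT(1)[OF ds(2)])
qed

end

end

section \<open>Transformations of factor sets\<close>

lemma (in group) inv_mult_cancel:
  assumes "x \<in> carrier G" "y \<in> carrier G"
  shows "inv x \<otimes> (x \<otimes> y) = y" "x \<otimes> (inv x \<otimes> y) = y"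
  using assms by (simp_all flip: m_assoc)

text \<open>Inverts a naturality square: \<open>s\<close> conjugates \<open>w\<close> into
  \<open>x\<close>, so its inverse conjugates \<open>x\<close> back into \<open>w\<close>.\<close>

lemma (in group) conjugate_inv:
  assumes "x \<in> carrier G" "s \<in> carrier G" "w \<in> carrier G" and "x \<otimes> s = s \<otimes> w"
  shows "w \<otimes> inv s = inv s \<otimes> x"
proof -
  have "inv s \<otimes> x = inv s \<otimes> (x \<otimes> s) \<otimes> inv s"
    using assms(1-3) by (simp add: m_assoc)
  also have "\<dots> = w \<otimes> inv s"
    using assms by (simp add: inv_mult_cancel)
  finally show ?thesis by simp
qed

text \<open>\<alpha> and every \<open>s f\<close> are invertible, so the squares can be read
  backwards. Naturality and coherence are checked after applying \<alpha>, which is injective on the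
  carrier and cancels \<beta>.\<close>

lemma factor_transformation_sym:
  assumes "factor_transformation C S b u c b' u' c' \<alpha> s"
  shows "\<exists>\<alpha> s. factor_transformation C S b' u' c' b u c \<alpha> s"
proof -
  interpret factor_transformation C S b u c b' u' c' \<alpha> s by fact
  define \<beta> where "\<beta> x = inv_into (carrier (b x)) (\<alpha> x)" for x
  \<comment> \<open>The inverse of \<open>s f\<close> whiskered with \<beta> on both sides, a 2-cell
    from \<open>\<beta> u'\<close> to \<open>u \<beta>\<close>; whiskering on the right does not
    change the element.\<close>
  define r where "r f = \<beta> (Cod C f) (inv\<^bsub>b' (Cod C f)\<^esub> s f)" for f
  have \<beta>: "\<beta> x \<in> iso (b' x) (b x)" "a \<in> carrier (b' x) \<Longrightarrow> \<alpha> x (\<beta> x a) = a"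
    if "x \<in> Ob C" for x a
    using iso_inv_into[OF F.group_b[OF that] \<alpha>_iso[OF that]] by (simp_all add: \<beta>_def)
  note \<beta>_in = iso_in[OF \<beta>(1)]
  have r: "r f \<in> carrier (b (Cod C f))" "\<alpha> (Cod C f) (r f) = inv\<^bsub>b' (Cod C f)\<^esub> s f" if "f \<in> Ar C" for f
    using group.inv_closed[OF F'.group_Cod[OF that] s_in[OF that]] \<beta>_in \<beta>(2) F.Cod_in[OF that]
    by (simp_all add: r_def)
  have "factor_transformation C S b' u' c' b u c \<beta> r"
  proof (intro factor_transformation.intro factor_transformation_axioms.intro)
    show "factor_set C S b' u' c'" "factor_set C S b u c" by unfold_locales
  next
    fix x assume x: "x \<in> Ob C"
    show "\<beta> x \<in> iso (b' x) (b x)" by (rule \<beta>(1)[OF x])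
    interpret L: group "b' x" by (rule F'.group_b[OF x])
    show "r (One C x) = \<one>\<^bsub>b x\<^esub>"
      using iso_one[OF F'.group_b[OF x] F.group_b[OF x] \<beta>(1)[OF x]] F.One_in[OF x]
      by (simp add: r_def s_One[OF x])
  next
    fix f assume f: "f \<in> Ar C"
    note D = F.Dom_in[OF f] and E = F.Cod_in[OF f]
    show "r f \<in> carrier (b (Cod C f))" by (rule r(1)[OF f])
    interpret L: group "b (Cod C f)" by (rule F.group_b[OF E])
    interpret L': group "b' (Cod C f)" by (rule F'.group_b[OF E])
    fix a assume a: "a \<in> carrier (b' (Dom C f))"
    note \<beta>a = \<beta>_in[OF D a]
    note ua = F.u_in[OF f \<beta>a] and u'a = F'.u_in[OF f a]
    show "u f (\<beta> (Dom C f) a) \<otimes>\<^bsub>b (Cod C f)\<^esub> r f = r f \<otimes>\<^bsub>b (Cod C f)\<^esub> \<beta> (Cod C f) (u' f a)"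
    proof (rule iso_eqD[OF \<alpha>_iso[OF E]])
      have "\<alpha> (Cod C f) (u f (\<beta> (Dom C f) a)) \<otimes>\<^bsub>b' (Cod C f)\<^esub> inv\<^bsub>b' (Cod C f)\<^esub> s f =
          inv\<^bsub>b' (Cod C f)\<^esub> s f \<otimes>\<^bsub>b' (Cod C f)\<^esub> u' f a"
        using L'.conjugate_inv[OF u'a s_in[OF f] \<alpha>_in[OF E ua]] s_natural[OF f \<beta>a] \<beta>(2)[OF D a] by simp
      then show "\<alpha> (Cod C f) (u f (\<beta> (Dom C f) a) \<otimes>\<^bsub>b (Cod C f)\<^esub> r f) =
          \<alpha> (Cod C f) (r f \<otimes>\<^bsub>b (Cod C f)\<^esub> \<beta> (Cod C f) (u' f a))"
        using ua u'a r[OF f] \<beta>_in[OF E u'a] \<beta>(2)[OF E u'a] by (simp add: \<alpha>_mult[OF E])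
    qed (use ua r[OF f] \<beta>_in[OF E u'a] in simp_all)
  next
    fix f g assume fg: "(f, g) \<in> composable C"
    note cs = F.Comp_simps[OF fg]
    note E = F.Cod_in[OF cs(2)]
    let ?M = "b' (Cod C g)" and ?\<alpha> = "\<alpha> (Cod C g)"
    interpret L: group "b (Cod C g)" by (rule F.group_b[OF E])
    interpret M: group ?M by (rule F'.group_b[OF E])
    define X where "X = ?\<alpha> (u g (r f))"
    define t where "t = u' g (s f)"
    have rf: "r f \<in> carrier (b (Dom C g))" "s f \<in> carrier (b' (Dom C g))"
      using r[OF cs(1)] s_in[OF cs(1)] cs(3) by simp_all
    have rgf: "r (Comp C g f) \<in> carrier (b (Cod C g))" "s (Comp C g f) \<in> carrier ?M"
      "?\<alpha> (r (Comp C g f)) = inv\<^bsub>?M\<^esub> s (Comp C g f)"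
      using r[OF cs(4)] s_in[OF cs(4)] cs by simp_all
    have ur: "u g (r f) \<in> carrier (b (Cod C g))"
      using F.u_in[OF cs(2) rf(1)] .
    have mem: "X \<in> carrier ?M" "t \<in> carrier ?M" "s g \<in> carrier ?M" "?\<alpha> (c f g) \<in> carrier ?M"
      "c' f g \<in> carrier ?M" "\<beta> (Cod C g) (c' f g) \<in> carrier (b (Cod C g))"
      using \<alpha>_in[OF E ur] F'.u_in[OF cs(2) rf(2)] s_in[OF cs(2)] \<alpha>_in[OF E F.c_in[OF fg]]
        F'.c_in[OF fg] \<beta>_in[OF E F'.c_in[OF fg]] by (simp_all add: X_def t_def)
    \<comment> \<open>This is \<open>s_natural\<close> for \<open>g\<close> at the element
      \<open>r f\<close>, which \<alpha> sends to the inverse of \<open>s f\<close>. It expresses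
      \<open>X\<close> through \<open>s g\<close> and \<open>t\<close> alone.\<close>
    have "inv\<^bsub>?M\<^esub> t \<otimes>\<^bsub>?M\<^esub> s g = s g \<otimes>\<^bsub>?M\<^esub> X"
      using s_natural[OF cs(2) rf(1)] r(2)[OF cs(1)] F'.u_inv[OF cs(2) rf(2)] cs(3)
      by (simp add: X_def t_def)
    then have X: "X = inv\<^bsub>?M\<^esub> s g \<otimes>\<^bsub>?M\<^esub> (inv\<^bsub>?M\<^esub> t \<otimes>\<^bsub>?M\<^esub> s g)"
      using mem by (simp add: M.inv_mult_cancel)
    have co: "c' f g \<otimes>\<^bsub>?M\<^esub> s (Comp C g f) = t \<otimes>\<^bsub>?M\<^esub> (s g \<otimes>\<^bsub>?M\<^esub> ?\<alpha> (c f g))"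
      using s_coherence[OF fg] by (simp add: t_def)
    then have "inv\<^bsub>?M\<^esub> s g \<otimes>\<^bsub>?M\<^esub> (inv\<^bsub>?M\<^esub> t \<otimes>\<^bsub>?M\<^esub> (c' f g \<otimes>\<^bsub>?M\<^esub> s (Comp C g f))) = ?\<alpha> (c f g)"
      using mem by (simp add: M.inv_mult_cancel)
    then have "?\<alpha> (c f g) \<otimes>\<^bsub>?M\<^esub> inv\<^bsub>?M\<^esub> s (Comp C g f) =
        inv\<^bsub>?M\<^esub> s g \<otimes>\<^bsub>?M\<^esub> (inv\<^bsub>?M\<^esub> t \<otimes>\<^bsub>?M\<^esub> (c' f g \<otimes>\<^bsub>?M\<^esub> s (Comp C g f))) \<otimes>\<^bsub>?M\<^esub> inv\<^bsub>?M\<^esub> s (Comp C g f)"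
      by simp
    also have "\<dots> = X \<otimes>\<^bsub>?M\<^esub> (inv\<^bsub>?M\<^esub> s g \<otimes>\<^bsub>?M\<^esub> c' f g)"
      using mem rgf(2) by (simp add: X M.m_assoc M.inv_mult_cancel)
    finally have eq: "?\<alpha> (c f g) \<otimes>\<^bsub>?M\<^esub> inv\<^bsub>?M\<^esub> s (Comp C g f) = X \<otimes>\<^bsub>?M\<^esub> (inv\<^bsub>?M\<^esub> s g \<otimes>\<^bsub>?M\<^esub> c' f g)" .
    show "c f g \<otimes>\<^bsub>b (Cod C g)\<^esub> r (Comp C g f) =
        u g (r f) \<otimes>\<^bsub>b (Cod C g)\<^esub> (r g \<otimes>\<^bsub>b (Cod C g)\<^esub> \<beta> (Cod C g) (c' f g))"
    proof (rule iso_eqD[OF \<alpha>_iso[OF E]])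
      show "?\<alpha> (c f g \<otimes>\<^bsub>b (Cod C g)\<^esub> r (Comp C g f)) =
          ?\<alpha> (u g (r f) \<otimes>\<^bsub>b (Cod C g)\<^esub> (r g \<otimes>\<^bsub>b (Cod C g)\<^esub> \<beta> (Cod C g) (c' f g)))"
        using eq ur F.c_in[OF fg] rgf r[OF cs(2)] mem(6) \<beta>(2)[OF E F'.c_in[OF fg]]
        by (simp add: \<alpha>_mult[OF E] X_def)
    qed (use ur F.c_in[OF fg] rgf r[OF cs(2)] mem(6) in simp_all)
  qed
  then show ?thesis by blast
qed

text \<open>The squares are pasted: \<beta> applied to the square of \<open>s f\<close>, followed by
  the square of \<open>t f\<close>, has as component the product of \<open>t f\<close> with the
  image of \<open>s f\<close> under \<beta>.\<close>

lemma factor_transformation_trans: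
  assumes "factor_transformation C S b u c b' u' c' \<alpha> s"
    and "factor_transformation C S b' u' c' b'' u'' c'' \<beta> t"
  shows "\<exists>\<alpha> s. factor_transformation C S b u c b'' u'' c'' \<alpha> s"
proof -
  interpret A: factor_transformation C S b u c b' u' c' \<alpha> s by fact
  interpret B: factor_transformation C S b' u' c' b'' u'' c'' \<beta> t by fact
  define r where "r f = t f \<otimes>\<^bsub>b'' (Cod C f)\<^esub> \<beta> (Cod C f) (s f)" for f
  have "factor_transformation C S b u c b'' u'' c'' (\<lambda>x. \<beta> x \<circ> \<alpha> x) r"
  proof (intro factor_transformation.intro factor_transformation_axioms.intro)
    show "factor_set C S b u c" "factor_set C S b'' u'' c''" by unfold_locales
  next
    fix x assume x: "x \<in> Ob C"
    show "\<beta> x \<circ> \<alpha> x \<in> iso (b x) (b'' x)"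
      by (rule iso_set_trans[OF A.\<alpha>_iso[OF x] B.\<alpha>_iso[OF x]])
    interpret L: group "b'' x" by (rule B.F'.group_b[OF x])
    show "r (One C x) = \<one>\<^bsub>b'' x\<^esub>"
      using A.F.One_in[OF x] by (simp add: r_def A.s_One[OF x] B.s_One[OF x] B.\<alpha>_unit[OF x])
  next
    fix f assume f: "f \<in> Ar C"
    note D = A.F.Dom_in[OF f] and E = A.F.Cod_in[OF f]
    let ?M = "b'' (Cod C f)"
    interpret M: group ?M by (rule B.F'.group_b[OF E])
    show "r f \<in> carrier ?M"
      using B.s_in[OF f] B.\<alpha>_in[OF E A.s_in[OF f]] by (simp add: r_def)
    fix a assume a: "a \<in> carrier (b (Dom C f))"
    note \<alpha>a = A.\<alpha>_in[OF D a] and ua = A.\<alpha>_in[OF E A.F.u_in[OF f a]]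
    note mem = B.s_in[OF f] B.\<alpha>_in[OF E A.s_in[OF f]] B.\<alpha>_in[OF E ua]
      B.F'.u_in[OF f B.\<alpha>_in[OF D \<alpha>a]] B.\<alpha>_in[OF E A.F'.u_in[OF f \<alpha>a]]
    have "u'' f (\<beta> (Dom C f) (\<alpha> (Dom C f) a)) \<otimes>\<^bsub>?M\<^esub> r f =
        t f \<otimes>\<^bsub>?M\<^esub> (\<beta> (Cod C f) (u' f (\<alpha> (Dom C f) a)) \<otimes>\<^bsub>?M\<^esub> \<beta> (Cod C f) (s f))"
      using B.s_natural[OF f \<alpha>a] mem by (simp add: r_def flip: M.m_assoc)
    also have "\<beta> (Cod C f) (u' f (\<alpha> (Dom C f) a)) \<otimes>\<^bsub>?M\<^esub> \<beta> (Cod C f) (s f) =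
        \<beta> (Cod C f) (s f) \<otimes>\<^bsub>?M\<^esub> \<beta> (Cod C f) (\<alpha> (Cod C f) (u f a))"
      using A.s_natural[OF f a] B.\<alpha>_mult[OF E A.F'.u_in[OF f \<alpha>a] A.s_in[OF f]]
        B.\<alpha>_mult[OF E A.s_in[OF f] ua] by simp
    finally show "u'' f ((\<beta> (Dom C f) \<circ> \<alpha> (Dom C f)) a) \<otimes>\<^bsub>?M\<^esub> r f =
        r f \<otimes>\<^bsub>?M\<^esub> (\<beta> (Cod C f) \<circ> \<alpha> (Cod C f)) (u f a)"
      using mem by (simp add: r_def M.m_assoc)
  next
    fix f g assume fg: "(f, g) \<in> composable C"
    note cs = A.F.Comp_simps[OF fg]
    note E = A.F.Cod_in[OF cs(2)]
    let ?M = "b'' (Cod C g)" and ?\<beta> = "\<beta> (Cod C g)" and ?\<alpha> = "\<alpha> (Cod C g)"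
    interpret L: group "b' (Cod C g)" by (rule A.F'.group_b[OF E])
    interpret M: group ?M by (rule B.F'.group_b[OF E])
    have sf: "s f \<in> carrier (b' (Dom C g))" "\<beta> (Cod C f) (s f) \<in> carrier (b'' (Dom C g))"
      "t f \<in> carrier (b'' (Dom C g))"
      using A.s_in[OF cs(1)] B.\<alpha>_in[OF A.F.Cod_in[OF cs(1)] A.s_in[OF cs(1)]] B.s_in[OF cs(1)] cs(3)
      by simp_all
    have sgf: "s (Comp C g f) \<in> carrier (b' (Cod C g))" "t (Comp C g f) \<in> carrier ?M"
      using A.s_in[OF cs(4)] B.s_in[OF cs(4)] cs by simp_all
    note us = A.F'.u_in[OF cs(2) sf(1)] and sg = A.s_in[OF cs(2)] B.s_in[OF cs(2)]
    note \<alpha>c = A.\<alpha>_in[OF E A.F.c_in[OF fg]]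
    note mem = B.\<alpha>_in[OF E us] B.\<alpha>_in[OF E sg(1)] B.\<alpha>_in[OF E \<alpha>c] B.\<alpha>_in[OF E sgf(1)] sgf(2)
      sg(2) B.F'.c_in[OF fg] B.F'.u_in[OF cs(2) sf(2)] B.F'.u_in[OF cs(2) sf(3)]
      B.\<alpha>_in[OF E A.F'.c_in[OF fg]]
    have \<beta>s: "?\<beta> (c' f g) \<otimes>\<^bsub>?M\<^esub> ?\<beta> (s (Comp C g f)) =
        ?\<beta> (u' g (s f)) \<otimes>\<^bsub>?M\<^esub> (?\<beta> (s g) \<otimes>\<^bsub>?M\<^esub> ?\<beta> (?\<alpha> (c f g)))"
      using A.s_coherence[OF fg] us sg(1) \<alpha>c sgf(1) A.F'.c_in[OF fg]
      by (simp flip: B.\<alpha>_mult[OF E])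
    \<comment> \<open>Naturality of \<open>t g\<close> at \<open>s f\<close>; this exchange brings
      the two factors of \<open>u'' g (r f)\<close> next to each other.\<close>
    have nat: "t g \<otimes>\<^bsub>?M\<^esub> ?\<beta> (u' g (s f)) = u'' g (\<beta> (Cod C f) (s f)) \<otimes>\<^bsub>?M\<^esub> t g"
      using B.s_natural[OF cs(2) sf(1)] cs(3) by simp
    have "c'' f g \<otimes>\<^bsub>?M\<^esub> r (Comp C g f) =
        c'' f g \<otimes>\<^bsub>?M\<^esub> t (Comp C g f) \<otimes>\<^bsub>?M\<^esub> ?\<beta> (s (Comp C g f))"
      using mem cs by (simp add: r_def M.m_assoc)
    also have "\<dots> = u'' g (t f) \<otimes>\<^bsub>?M\<^esub> (t g \<otimes>\<^bsub>?M\<^esub> (?\<beta> (c' f g) \<otimes>\<^bsub>?M\<^esub> ?\<beta> (s (Comp C g f))))"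
      using mem by (simp add: B.s_coherence[OF fg] M.m_assoc)
    also have "\<dots> = u'' g (t f) \<otimes>\<^bsub>?M\<^esub> (t g \<otimes>\<^bsub>?M\<^esub> ?\<beta> (u' g (s f)) \<otimes>\<^bsub>?M\<^esub> (?\<beta> (s g) \<otimes>\<^bsub>?M\<^esub> ?\<beta> (?\<alpha> (c f g))))"
      using mem by (simp add: \<beta>s M.m_assoc)
    also have "\<dots> = u'' g (t f) \<otimes>\<^bsub>?M\<^esub> u'' g (\<beta> (Cod C f) (s f)) \<otimes>\<^bsub>?M\<^esub>
        (t g \<otimes>\<^bsub>?M\<^esub> ?\<beta> (s g) \<otimes>\<^bsub>?M\<^esub> ?\<beta> (?\<alpha> (c f g)))"
      using mem by (simp add: nat M.m_assoc)
    also have "u'' g (t f) \<otimes>\<^bsub>?M\<^esub> u'' g (\<beta> (Cod C f) (s f)) = u'' g (r f)"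
      using B.F'.u_mult[OF cs(2) sf(3) sf(2)] cs(3) by (simp add: r_def)
    finally show "c'' f g \<otimes>\<^bsub>?M\<^esub> r (Comp C g f) =
        u'' g (r f) \<otimes>\<^bsub>?M\<^esub> (r g \<otimes>\<^bsub>?M\<^esub> (?\<beta> \<circ> ?\<alpha>) (c f g))"
      by (simp add: r_def)
  qed
  then show ?thesis by blast
qed

section \<open>Factor sets on the cylinder\<close>

lemma cylinder_arrow_cases:
  assumes "p \<in> Ar (cylinder C)"
  obtains f i j where "p = (f, (i, j))" "f \<in> Ar C" "i \<le> j" "j \<le> 1"
  using assms by (cases p) (auto simp del: One_nat_def)

lemma cylinder_composable_cases:
  assumes "(p, q) \<in> composable (cylinder C)"
  obtains f g i j k where "p = (f, (i, j))" "q = (g, (j, k))" "(f, g) \<in> composable C"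
    "i \<le> j" "j \<le> k" "k \<le> 1"
  using assms by (cases p; cases q) (auto simp del: One_nat_def)

text \<open>The crossing arrow over \<open>f\<close> is sent to
  \<open>\<alpha> (Cod C f) \<circ> u f\<close>: first along the bottom, then up. With this choice a
  triangle of type 001 needs only the image of \<open>c f g\<close> under \<alpha>. In type 011 the
  composite is \<open>u' g \<circ> \<alpha> (Cod C f) \<circ> u f\<close>, and \<open>s g\<close> is
  what carries \<alpha> past \<open>g\<close>.\<close>

lemma (in factor_transformation) factor_set_cylinder:
  "factor_set (cylinder C) S (\<lambda>(x, i). if i = 0 then b x else b' x)
    (\<lambda>(f, (i, j)). if j = 0 then u f else if i = 0 then \<alpha> (Cod C f) \<circ> u f else u' f)
    (\<lambda>(f, (i, j)) (g, (_, k)). if k = 0 then c f g else if j = 0 then \<alpha> (Cod C g) (c f g)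
      else if i = 0 then s g \<otimes>\<^bsub>b' (Cod C g)\<^esub> \<alpha> (Cod C g) (c f g) else c' f g)"
  (is "factor_set _ _ ?B ?U ?D")
proof (intro factor_set.intro factor_set_axioms.intro)
  show "category (cylinder C)"
    by (rule category_cylinder) unfold_locales
next
  fix x assume "x \<in> Ob (cylinder C)"
  then obtain y i where x: "x = (y, i)" "y \<in> Ob C" "i \<le> 1"
    by (cases x) auto
  then show "?B x \<in> S" "group (?B x)"
    by (simp_all add: F.b_in F'.b_in F.group_b F'.group_b)
  show "?U (One (cylinder C) x) a = a" if "a \<in> carrier (?B x)" for a
    using that x by (auto simp: F.u_One F'.u_One split: if_splits)
next
  fix p assume "p \<in> Ar (cylinder C)"
  then obtain f i j where p: "p = (f, (i, j))" and f: "f \<in> Ar C" and ij: "i \<le> j" "j \<le> 1"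
    by (rule cylinder_arrow_cases)
  show "?U p \<in> iso (?B (Dom (cylinder C) p)) (?B (Cod (cylinder C) p))"
    using F.u_iso[OF f] F'.u_iso[OF f] iso_set_trans[OF F.u_iso[OF f] \<alpha>_iso[OF F.Cod_in[OF f]]] ij
    by (simp add: p)
  interpret L: group "b' (Cod C f)" by (rule F'.group_Cod[OF f])
  show "?D p (One (cylinder C) (Cod (cylinder C) p)) = \<one>\<^bsub>?B (Cod (cylinder C) p)\<^esub>"
    using ij F.Cod_in[OF f] F.One_in[OF F.Cod_in[OF f]] f
    by (simp add: p F.c_One_left F'.c_One_left \<alpha>_unit s_One)
  show "?D (One (cylinder C) (Dom (cylinder C) p)) p = \<one>\<^bsub>?B (Cod (cylinder C) p)\<^esub>"
    using ij F.Cod_in[OF f] f by (simp add: p F.c_One_right F'.c_One_right \<alpha>_unit)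
next
  fix p q assume "(p, q) \<in> composable (cylinder C)"
  then obtain f g i j k where p: "p = (f, (i, j))" and q: "q = (g, (j, k))"
    and fg: "(f, g) \<in> composable C" and ijk: "i \<le> j" "j \<le> k" "k \<le> 1"
    by (rule cylinder_composable_cases)
  note cs = F.Comp_simps[OF fg]
  note E = F.Cod_in[OF cs(2)]
  note c = F.c_in[OF fg] and c' = F'.c_in[OF fg]
  let ?M = "b' (Cod C g)" and ?\<alpha> = "\<alpha> (Cod C g)"
  interpret M: group ?M by (rule F'.group_b[OF E])
  note \<alpha>c = \<alpha>_in[OF E c] and sg = s_in[OF cs(2)]
  show "?D p q \<in> carrier (?B (Cod (cylinder C) q))"
    using c c' \<alpha>c sg ijk by (simp add: p q)
  have s_nat: "u' g (\<alpha> (Cod C f) a) \<otimes>\<^bsub>?M\<^esub> s g = s g \<otimes>\<^bsub>?M\<^esub> ?\<alpha> (u g a)"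
    if "a \<in> carrier (b (Cod C f))" for a
    using s_natural[OF cs(2), of a] cs(3) that by simp
  {
    fix a assume "a \<in> carrier (?B (Dom (cylinder C) p))"
    then have a: "i = 0 \<Longrightarrow> a \<in> carrier (b (Dom C f))" "i \<noteq> 0 \<Longrightarrow> a \<in> carrier (b' (Dom C f))"
      by (simp_all add: p)
    \<comment> \<open>The heights of the triangle are 000, 001, 011 or 111.\<close>
    consider "k = 0" | "k \<noteq> 0" "j = 0" | "j \<noteq> 0" "i = 0" | "i \<noteq> 0" by blast
    then show "?U q (?U p a) \<otimes>\<^bsub>?B (Cod (cylinder C) q)\<^esub> ?D p q =
        ?D p q \<otimes>\<^bsub>?B (Cod (cylinder C) q)\<^esub> ?U (Comp (cylinder C) q p) a"
    proof cases
      case 1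
      then show ?thesis
        using ijk a F.u_Comp[OF fg] by (simp add: p q cs)
    next
      case 2
      then have a': "a \<in> carrier (b (Dom C f))" using a ijk by simp
      have ua: "u g (u f a) \<in> carrier (b (Cod C g))" "u (Comp C g f) a \<in> carrier (b (Cod C g))"
        using F.u_in[OF cs(2), of "u f a"] F.u_in[OF cs(1) a'] F.u_in[OF cs(4), of a] a' cs by simp_all
      show ?thesis
        using 2 ijk F.u_Comp[OF fg a'] ua c
        by (simp add: p q cs flip: \<alpha>_mult[OF E])
    next
      case 3
      then have a': "a \<in> carrier (b (Dom C f))" using a by simp
      have ua: "u g (u f a) \<in> carrier (b (Cod C g))" "u (Comp C g f) a \<in> carrier (b (Cod C g))"
        "u f a \<in> carrier (b (Cod C f))"
        using F.u_in[OF cs(2), of "u f a"] F.u_in[OF cs(1) a'] F.u_in[OF cs(4), of a] a' cs by simp_all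
      have u'\<alpha>: "u' g (\<alpha> (Cod C f) (u f a)) \<in> carrier ?M"
        using F'.u_in[OF cs(2)] \<alpha>_in[OF F.Cod_in[OF cs(1)] ua(3)] cs(3) by simp
      \<comment> \<open>Type 011: naturality of \<open>s g\<close> at \<open>u f a\<close> moves the
        computation under \<alpha>, where the bottom factor set takes over.\<close>
      have "u' g (\<alpha> (Cod C f) (u f a)) \<otimes>\<^bsub>?M\<^esub> (s g \<otimes>\<^bsub>?M\<^esub> ?\<alpha> (c f g)) =
          s g \<otimes>\<^bsub>?M\<^esub> (?\<alpha> (u g (u f a)) \<otimes>\<^bsub>?M\<^esub> ?\<alpha> (c f g))"
        using s_nat[OF ua(3)] sg \<alpha>c \<alpha>_in[OF E ua(1)] u'\<alpha> by (simp flip: M.m_assoc)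
      also have "\<dots> = s g \<otimes>\<^bsub>?M\<^esub> (?\<alpha> (c f g) \<otimes>\<^bsub>?M\<^esub> ?\<alpha> (u (Comp C g f) a))"
        using F.u_Comp[OF fg a'] ua c by (simp flip: \<alpha>_mult[OF E])
      finally show ?thesis
        using 3 ijk sg \<alpha>c \<alpha>_in[OF E ua(2)] by (simp add: p q cs M.m_assoc)
    next
      case 4
      then show ?thesis
        using ijk a F'.u_Comp[OF fg] by (simp add: p q cs)
    qed
  }
  fix r assume "(q, r) \<in> composable (cylinder C)"
  then obtain h l where r: "r = (h, (k, l))" and gh: "(g, h) \<in> composable C" and kl: "k \<le> l" "l \<le> 1"
    by (auto simp: q elim: cylinder_composable_cases)
  note ds = F.Comp_simps[OF gh]
  note cc = F.composable_Comp[OF fg gh]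
  note E' = F.Cod_in[OF ds(2)]
  let ?N = "b' (Cod C h)" and ?\<beta> = "\<alpha> (Cod C h)"
  interpret L: group "b (Cod C h)" by (rule F.group_b[OF E'])
  interpret N: group ?N by (rule F'.group_b[OF E'])
  have m: "c g h \<in> carrier (b (Cod C h))" "c f (Comp C h g) \<in> carrier (b (Cod C h))"
    "u h (c f g) \<in> carrier (b (Cod C h))" "c (Comp C g f) h \<in> carrier (b (Cod C h))"
    using F.c_in[OF gh] F.c_in[OF cc(1)] F.c_in[OF cc(2)] F.u_in[OF ds(2)] c ds by simp_all
  note \<beta>m = m[THEN \<alpha>_in[OF E']]
  have \<beta>co: "?\<beta> (c g h) \<otimes>\<^bsub>?N\<^esub> ?\<beta> (c f (Comp C h g)) = ?\<beta> (u h (c f g)) \<otimes>\<^bsub>?N\<^esub> ?\<beta> (c (Comp C g f) h)"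
    using F.cocycle[OF fg gh] m by (simp flip: \<alpha>_mult[OF E'])
  have m': "s h \<in> carrier ?N" "u' h (?\<alpha> (c f g)) \<in> carrier ?N" "u' h (s g) \<in> carrier ?N"
    "s (Comp C h g) \<in> carrier ?N" "c' g h \<in> carrier ?N"
    using s_in[OF ds(2)] F'.u_in[OF ds(2)] \<alpha>c sg s_in[OF ds(4)] F'.c_in[OF gh] ds by simp_all
  have nat: "u' h (?\<alpha> (c f g)) \<otimes>\<^bsub>?N\<^esub> s h = s h \<otimes>\<^bsub>?N\<^esub> ?\<beta> (u h (c f g))"
    using s_natural[OF ds(2), of "c f g"] c ds(3) by simp
  \<comment> \<open>The cocycle condition of type 0011: the bottom cocycle under \<alpha>, combined
    with the naturality of \<open>s h\<close> at \<open>c f g\<close>.\<close>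
  have mid: "s h \<otimes>\<^bsub>?N\<^esub> ?\<beta> (c g h) \<otimes>\<^bsub>?N\<^esub> ?\<beta> (c f (Comp C h g)) =
      u' h (?\<alpha> (c f g)) \<otimes>\<^bsub>?N\<^esub> (s h \<otimes>\<^bsub>?N\<^esub> ?\<beta> (c (Comp C g f) h))"
  proof -
    have "s h \<otimes>\<^bsub>?N\<^esub> ?\<beta> (c g h) \<otimes>\<^bsub>?N\<^esub> ?\<beta> (c f (Comp C h g)) =
        s h \<otimes>\<^bsub>?N\<^esub> ?\<beta> (u h (c f g)) \<otimes>\<^bsub>?N\<^esub> ?\<beta> (c (Comp C g f) h)"
      using \<beta>m m' by (simp add: N.m_assoc \<beta>co)
    then show ?thesis
      using \<beta>m m' by (simp add: N.m_assoc flip: nat)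
  qed
  \<comment> \<open>The heights of the 3-simplex are 0000, 0001, 0011, 0111 or 1111. In type 0111
    the coherence of \<open>s\<close> for \<open>(g, h)\<close> reduces the equation to
    \<open>mid\<close>.\<close>
  consider "l = 0" | "l \<noteq> 0" "k = 0" | "k \<noteq> 0" "j = 0" | "j \<noteq> 0" "i = 0" | "i \<noteq> 0" by blast
  then show "?D q r \<otimes>\<^bsub>?B (Cod (cylinder C) r)\<^esub> ?D p (Comp (cylinder C) r q) =
      ?U r (?D p q) \<otimes>\<^bsub>?B (Cod (cylinder C) r)\<^esub> ?D (Comp (cylinder C) q p) r"
  proof cases
    case 1
    then show ?thesis
      using ijk kl F.cocycle[OF fg gh] by (simp add: p q r cs ds)
  next
    case 2
    then show ?thesis
      using ijk kl \<beta>co by (simp add: p q r cs ds)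
  next
    case 3
    then show ?thesis
      using ijk kl mid by (simp add: p q r cs ds)
  next
    case 4
    have "c' g h \<otimes>\<^bsub>?N\<^esub> (s (Comp C h g) \<otimes>\<^bsub>?N\<^esub> ?\<beta> (c f (Comp C h g))) =
        u' h (s g) \<otimes>\<^bsub>?N\<^esub> (s h \<otimes>\<^bsub>?N\<^esub> ?\<beta> (c g h) \<otimes>\<^bsub>?N\<^esub> ?\<beta> (c f (Comp C h g)))"
      using s_coherence[OF gh] \<beta>m m' by (simp add: N.m_assoc flip: N.m_assoc[of "c' g h"])
    also have "\<dots> = u' h (s g \<otimes>\<^bsub>?M\<^esub> ?\<alpha> (c f g)) \<otimes>\<^bsub>?N\<^esub> (s h \<otimes>\<^bsub>?N\<^esub> ?\<beta> (c (Comp C g f) h))"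
      using \<beta>m m' mid F'.u_mult[OF ds(2), of "s g" "?\<alpha> (c f g)"] sg \<alpha>c ds(3)
      by (simp add: N.m_assoc)
    finally show ?thesis
      using 4 ijk kl by (simp add: p q r cs ds)
  next
    case 5
    then show ?thesis
      using ijk kl F'.cocycle[OF fg gh] by (simp add: p q r cs ds)
  qed
qed

text \<open>\<alpha> comes from the crossing arrows over identities. The crossing arrow over
  \<open>f\<close> factors along either side of a square, and comparing the two factorisations
  yields \<open>s f\<close>.\<close>

lemma factor_transformation_of_cylinder:
  assumes F: "factor_set C S b u c" and F': "factor_set C S b' u' c'"
    and P: "factor_set (cylinder C) S B U D"
    and B: "\<And>x. x \<in> Ob C \<Longrightarrow> B (x, 0) = b x" "\<And>x. x \<in> Ob C \<Longrightarrow> B (x, 1) = b' x"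
    and U: "\<And>f. f \<in> Ar C \<Longrightarrow> U (f, (0, 0)) = u f" "\<And>f. f \<in> Ar C \<Longrightarrow> U (f, (1, 1)) = u' f"
    and D: "\<And>f g. (f, g) \<in> composable C \<Longrightarrow> D (f, (0, 0)) (g, (0, 0)) = c f g"
      "\<And>f g. (f, g) \<in> composable C \<Longrightarrow> D (f, (1, 1)) (g, (1, 1)) = c' f g"
  shows "\<exists>\<alpha> s. factor_transformation C S b u c b' u' c' \<alpha> s"
proof -
  interpret F: factor_set C S b u c by fact
  interpret F': factor_set C S b' u' c' by fact
  interpret P: factor_set "cylinder C" S B U D by fact
  define \<alpha> where "\<alpha> x = U (One C x, (0, 1))" for x
  \<comment> \<open>\<open>p f\<close> belongs to the factorisation that runs along the bottom and
    then up, \<open>q f\<close> to the one that goes up first. Both are 2-cells out of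
    \<open>U (f, (0, 1))\<close>, so \<open>p f\<close> enters \<open>s f\<close> inverted.\<close>
  define p q where "p f = D (f, (0, 0)) (One C (Cod C f), (0, 1))"
    and "q f = D (One C (Dom C f), (0, 1)) (f, (1, 1))" for f
  define s where "s f = q f \<otimes>\<^bsub>b' (Cod C f)\<^esub> inv\<^bsub>b' (Cod C f)\<^esub> p f" for f
  have comp: "((f, (i, j)), (g, (j, k))) \<in> composable (cylinder C)"
    if "(f, g) \<in> composable C" "i \<le> j" "j \<le> k" "k \<le> 1" for f g i j k
    using that by simp
  have D_in: "D (f, (i, j)) (g, (j, 1)) \<in> carrier (b' (Cod C g))"
    if "(f, g) \<in> composable C" "i \<le> j" "j \<le> 1" for f g i j
    using P.c_in[OF comp[OF that]] B(2)[OF F.Cod_in[OF F.Comp_simps(2)[OF that(1)]]] by simp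
  have \<alpha>_iso: "\<alpha> x \<in> iso (b x) (b' x)" if "x \<in> Ob C" for x
    using P.u_iso[of "(One C x, (0, 1))"] F.One_in[OF that] B that by (simp add: \<alpha>_def)
  have pq: "p f \<in> carrier (b' (Cod C f))" "q f \<in> carrier (b' (Cod C f))" if "f \<in> Ar C" for f
    using D_in[of f "One C (Cod C f)" 0 0] D_in[of "One C (Dom C f)" f 0 1] F.composable_One[OF that]
      F.One_in[OF F.Cod_in[OF that]] by (simp_all add: p_def q_def)
  have "factor_transformation C S b u c b' u' c' \<alpha> s"
  proof (intro factor_transformation.intro factor_transformation_axioms.intro)
    show "factor_set C S b u c" "factor_set C S b' u' c'" by fact+
  next
    fix x assume x: "x \<in> Ob C"
    show "\<alpha> x \<in> iso (b x) (b' x)" by (rule \<alpha>_iso[OF x])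
    interpret L: group "b' x" by (rule F'.group_b[OF x])
    have "p (One C x) = \<one>\<^bsub>b' x\<^esub>" "q (One C x) = \<one>\<^bsub>b' x\<^esub>"
      using P.c_One_right[of "(One C x, (0, 1))"] P.c_One_left[of "(One C x, (0, 1))"]
        F.One_in[OF x] B(2)[OF x] x by (simp_all add: p_def q_def)
    then show "s (One C x) = \<one>\<^bsub>b' x\<^esub>"
      using F.One_in[OF x] by (simp add: s_def)
  next
    fix f assume f: "f \<in> Ar C"
    note E = F.Cod_in[OF f] and E0 = F.Dom_in[OF f]
    let ?M = "b' (Cod C f)"
    interpret M: group ?M by (rule F'.group_b[OF E])
    show "s f \<in> carrier ?M"
      using pq[OF f] by (simp add: s_def)
    fix a assume a: "a \<in> carrier (b (Dom C f))"
    \<comment> \<open>The value at \<open>a\<close> of the crossing map, the common source of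
      \<open>p f\<close> and \<open>q f\<close>; it drops out once the two squares are joined along
      it.\<close>
    define w where "w = U (f, (0, 1)) a"
    have w: "w \<in> carrier ?M"
      using P.u_in[of "(f, (0, 1))" a] f a B(1)[OF E0] B(2)[OF E] by (simp add: w_def)
    have ua: "\<alpha> (Cod C f) (u f a) \<in> carrier ?M" "u' f (\<alpha> (Dom C f) a) \<in> carrier ?M"
      using iso_in[OF \<alpha>_iso[OF E] F.u_in[OF f a]] F'.u_in[OF f iso_in[OF \<alpha>_iso[OF E0] a]] by simp_all
    have "\<alpha> (Cod C f) (u f a) \<otimes>\<^bsub>?M\<^esub> p f = p f \<otimes>\<^bsub>?M\<^esub> w"
      using P.u_Comp[OF comp[OF F.composable_One(1)[OF f], of 0 0 1], of a] f a
        B(1)[OF E0] B(2)[OF E] U(1)[OF f] F.One_in[OF E] F.One_Comp[OF f]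
      by (simp add: \<alpha>_def p_def w_def)
    then have 1: "w \<otimes>\<^bsub>?M\<^esub> inv\<^bsub>?M\<^esub> p f = inv\<^bsub>?M\<^esub> p f \<otimes>\<^bsub>?M\<^esub> \<alpha> (Cod C f) (u f a)"
      using M.conjugate_inv[OF ua(1) pq(1)[OF f] w] by simp
    have 2: "u' f (\<alpha> (Dom C f) a) \<otimes>\<^bsub>?M\<^esub> q f = q f \<otimes>\<^bsub>?M\<^esub> w"
      using P.u_Comp[OF comp[OF F.composable_One(2)[OF f], of 0 1 1], of a] f a
        B(1)[OF E0] B(2)[OF E] U(2)[OF f] F.One_in[OF E0] F.Comp_One[OF f]
      by (simp add: \<alpha>_def q_def w_def)
    have "u' f (\<alpha> (Dom C f) a) \<otimes>\<^bsub>?M\<^esub> s f = u' f (\<alpha> (Dom C f) a) \<otimes>\<^bsub>?M\<^esub> q f \<otimes>\<^bsub>?M\<^esub> inv\<^bsub>?M\<^esub> p f"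
      using pq[OF f] ua by (simp add: s_def M.m_assoc)
    also have "\<dots> = q f \<otimes>\<^bsub>?M\<^esub> (w \<otimes>\<^bsub>?M\<^esub> inv\<^bsub>?M\<^esub> p f)"
      using pq[OF f] w by (simp add: 2 M.m_assoc)
    finally show "u' f (\<alpha> (Dom C f) a) \<otimes>\<^bsub>?M\<^esub> s f = s f \<otimes>\<^bsub>?M\<^esub> \<alpha> (Cod C f) (u f a)"
      using pq[OF f] ua by (simp add: 1 s_def M.m_assoc)
  next
    fix f g assume fg: "(f, g) \<in> composable C"
    note cs = F.Comp_simps[OF fg]
    note E = F.Cod_in[OF cs(2)] and Ef = F.Cod_in[OF cs(1)]
    let ?M = "b' (Cod C g)"
    interpret Mf: group "b' (Cod C f)" by (rule F'.group_b[OF Ef])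
    interpret M: group ?M by (rule F'.group_b[OF E])
    \<comment> \<open>The triangles of type 001 and 011 over the pair \<open>(f, g)\<close>. They do
      not occur in the claim and are eliminated by means of \<open>A\<close> and
      \<open>Bq\<close>.\<close>
    define x y where "x = D (f, (0, 0)) (g, (0, 1))" and "y = D (f, (0, 1)) (g, (1, 1))"
    have xy: "x \<in> carrier ?M" "y \<in> carrier ?M"
      using D_in[OF fg] by (simp_all add: x_def y_def)
    have f1: "(f, One C (Cod C f)) \<in> composable C" "(One C (Cod C f), g) \<in> composable C"
      "(g, One C (Cod C g)) \<in> composable C" "(One C (Dom C f), f) \<in> composable C"
      using F.composable_One[OF cs(1)] F.composable_One[OF cs(2)] cs(3) by simp_all
    \<comment> \<open>the cocycle conditions over \<open>0001\<close>, \<open>0011\<close> and \<open>0111\<close>\<close>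
    have A: "p g \<otimes>\<^bsub>?M\<^esub> x = \<alpha> (Cod C g) (c f g) \<otimes>\<^bsub>?M\<^esub> p (Comp C g f)"
      using P.cocycle[OF comp[OF fg, of 0 0 0] comp[OF f1(3), of 0 0 1]]
        F.One_in[OF E] F.One_Comp[OF cs(2)] B(2)[OF E] D(1)[OF fg] cs
      by (simp add: x_def p_def \<alpha>_def)
    have Bq: "q g \<otimes>\<^bsub>?M\<^esub> x = u' g (p f) \<otimes>\<^bsub>?M\<^esub> y"
      using P.cocycle[OF comp[OF f1(1), of 0 0 1] comp[OF f1(2), of 0 1 1]]
        F.One_Comp[OF cs(1)] F.Comp_One[OF cs(2)] B(2)[OF E] U(2)[OF cs(2)] cs
      by (simp add: x_def y_def p_def q_def)
    have Cq: "c' f g \<otimes>\<^bsub>?M\<^esub> q (Comp C g f) = u' g (q f) \<otimes>\<^bsub>?M\<^esub> y"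
      using P.cocycle[OF comp[OF f1(4), of 0 1 1] comp[OF fg, of 1 1 1]]
        F.Comp_One[OF cs(1)] B(2)[OF E] U(2)[OF cs(2)] D(2)[OF fg] cs
      by (simp add: y_def q_def)
    have mem: "p g \<in> carrier ?M" "q g \<in> carrier ?M" "p (Comp C g f) \<in> carrier ?M"
      "q (Comp C g f) \<in> carrier ?M" "u' g (p f) \<in> carrier ?M" "u' g (q f) \<in> carrier ?M"
      "\<alpha> (Cod C g) (c f g) \<in> carrier ?M" "c' f g \<in> carrier ?M"
      using pq[OF cs(2)] pq[OF cs(4)] F'.u_in[OF cs(2)] pq[OF cs(1)] cs
        iso_in[OF \<alpha>_iso[OF E] F.c_in[OF fg]] F'.c_in[OF fg] by simp_all
    have us: "u' g (s f) = u' g (q f) \<otimes>\<^bsub>?M\<^esub> inv\<^bsub>?M\<^esub> u' g (p f)"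
      using F'.u_mult[OF cs(2), of "q f" "inv\<^bsub>b' (Cod C f)\<^esub> p f"] F'.u_inv[OF cs(2), of "p f"]
        pq[OF cs(1)] cs(3) by (simp add: s_def)
    have y: "y = inv\<^bsub>?M\<^esub> u' g (p f) \<otimes>\<^bsub>?M\<^esub> (q g \<otimes>\<^bsub>?M\<^esub> x)"
      using mem xy by (simp add: Bq M.inv_mult_cancel)
    have x: "x = inv\<^bsub>?M\<^esub> p g \<otimes>\<^bsub>?M\<^esub> (\<alpha> (Cod C g) (c f g) \<otimes>\<^bsub>?M\<^esub> p (Comp C g f))"
      using mem xy by (simp add: A[symmetric] M.inv_mult_cancel)
    have "c' f g \<otimes>\<^bsub>?M\<^esub> s (Comp C g f) = c' f g \<otimes>\<^bsub>?M\<^esub> q (Comp C g f) \<otimes>\<^bsub>?M\<^esub> inv\<^bsub>?M\<^esub> p (Comp C g f)"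
      using mem cs by (simp add: s_def M.m_assoc)
    also have "\<dots> = u' g (q f) \<otimes>\<^bsub>?M\<^esub> y \<otimes>\<^bsub>?M\<^esub> inv\<^bsub>?M\<^esub> p (Comp C g f)"
      by (simp only: Cq)
    also have "\<dots> = u' g (s f) \<otimes>\<^bsub>?M\<^esub> (q g \<otimes>\<^bsub>?M\<^esub> (x \<otimes>\<^bsub>?M\<^esub> inv\<^bsub>?M\<^esub> p (Comp C g f)))"
      using mem xy by (simp add: us y M.m_assoc)
    also have "x \<otimes>\<^bsub>?M\<^esub> inv\<^bsub>?M\<^esub> p (Comp C g f) = inv\<^bsub>?M\<^esub> p g \<otimes>\<^bsub>?M\<^esub> \<alpha> (Cod C g) (c f g)"
      using mem by (simp add: x M.m_assoc)
    finally show "c' f g \<otimes>\<^bsub>?M\<^esub> s (Comp C g f) =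
        u' g (s f) \<otimes>\<^bsub>?M\<^esub> (s g \<otimes>\<^bsub>?M\<^esub> \<alpha> (Cod C g) (c f g))"
      using mem by (simp add: s_def M.m_assoc)
  qed
  then show ?thesis by blast
qed

section \<open>Cylinders, lax transformations and homotopies in elementary terms\<close>

context group_family
begin

context
  fixes C :: "('o, 'm) cat" and F F'
  assumes C: "category C" and F: "lax_functor (locally_discrete C) (AUT S) F"
    and F': "lax_functor (locally_discrete C) (AUT S) F'"
begin

interpretation F: factor_set C S "fob F" "aut_map F" "factor F"
  by (rule factor_set_lax_functor[OF C F])

interpretation F': factor_set C S "fob F'" "aut_map F'" "factor F'"
  by (rule factor_set_lax_functor[OF C F'])

lemma lax_cylinder_iff_factor_transformation:
  "(\<exists>P. lax_functor (locally_discrete (cylinder C)) (AUT S) P \<and> lax_cylinder C (AUT S) F 0 P \<and>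
      lax_cylinder C (AUT S) F' 1 P) \<longleftrightarrow>
    (\<exists>\<alpha> s. factor_transformation C S (fob F) (aut_map F) (factor F)
      (fob F') (aut_map F') (factor F') \<alpha> s)"
proof
  assume "\<exists>P. lax_functor (locally_discrete (cylinder C)) (AUT S) P \<and>
    lax_cylinder C (AUT S) F 0 P \<and> lax_cylinder C (AUT S) F' 1 P"
  then obtain P where P: "lax_functor (locally_discrete (cylinder C)) (AUT S) P"
    and P0: "lax_cylinder C (AUT S) F 0 P" and P1: "lax_cylinder C (AUT S) F' 1 P" by blast
  show "\<exists>\<alpha> s. factor_transformation C S (fob F) (aut_map F) (factor F)
      (fob F') (aut_map F') (factor F') \<alpha> s"
    by (rule factor_transformation_of_cylinder[OF F.factor_set_axioms F'.factor_set_axioms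
          factor_set_lax_functor[OF category_cylinder[OF C] P]])
      (use P0 P1 in \<open>auto simp: lax_cylinder_def aut_map_def factor_def\<close>)
next
  assume "\<exists>\<alpha> s. factor_transformation C S (fob F) (aut_map F) (factor F)
      (fob F') (aut_map F') (factor F') \<alpha> s"
  then obtain \<alpha> s where "factor_transformation C S (fob F) (aut_map F) (factor F)
      (fob F') (aut_map F') (factor F') \<alpha> s" by blast
  then interpret factor_transformation C S "fob F" "aut_map F" "factor F" "fob F'" "aut_map F'" "factor F'" \<alpha> s .
  define P where "P = factor_lax (cylinder C) S
    (\<lambda>(x, i). if i = 0 then fob F x else fob F' x)
    (\<lambda>(f, i, j). if j = 0 then aut_map F f else if i = 0 then \<alpha> (Cod C f) \<circ> aut_map F f else aut_map F' f)
    (\<lambda>(f, i, j) (g, _, k). if k = 0 then factor F f g else if j = 0 then \<alpha> (Cod C g) (factor F f g)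
      else if i = 0 then s g \<otimes>\<^bsub>fob F' (Cod C g)\<^esub> \<alpha> (Cod C g) (factor F f g) else factor F' f g)"
  \<comment> \<open>The 1-cells of \<open>F\<close> and \<open>F'\<close> are extensional already,
    so the restriction in \<open>factor_lax\<close> leaves both ends of the cylinder
    unchanged.\<close>
  have r: "restrict (aut_map F f) (carrier (fob F (Dom C f))) = aut_map F f"
    "restrict (aut_map F' f) (carrier (fob F' (Dom C f))) = aut_map F' f" if "f \<in> Ar C" for f
    using far_AUT(3)[OF C F that] far_AUT(3)[OF C F' that] by (simp_all add: extensional_restrict)
  have r': "restrict (aut_map F (Comp C g f)) (carrier (fob F (Dom C f))) = aut_map F (Comp C g f)"
    "restrict (aut_map F g) (carrier (fob F (Cod C f))) = aut_map F g"
    "restrict (aut_map F' (Comp C g f)) (carrier (fob F' (Dom C f))) = aut_map F' (Comp C g f)"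
    "restrict (aut_map F' g) (carrier (fob F' (Cod C f))) = aut_map F' g"
    if "(f, g) \<in> composable C" for f g
    using r[of "Comp C g f"] r[of g] F.Comp_simps[OF that] by simp_all
  have "lax_functor (locally_discrete (cylinder C)) (AUT S) P"
    unfolding P_def by (rule lax_functor_factor_lax[OF factor_set_cylinder])
  moreover have "lax_cylinder C (AUT S) F 0 P"
    unfolding lax_cylinder_def P_def factor_lax_def Let_def
    by (auto simp: r r' far_AUT(1)[OF C F] fstr_AUT(1)[OF C F] F.Comp_simps)
  moreover have "lax_cylinder C (AUT S) F' 1 P"
    unfolding lax_cylinder_def P_def factor_lax_def Let_def
    by (auto simp: r r' far_AUT(1)[OF C F'] fstr_AUT(1)[OF C F'] F.Comp_simps)
  ultimately show "\<exists>P. lax_functor (locally_discrete (cylinder C)) (AUT S) P \<and>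
    lax_cylinder C (AUT S) F 0 P \<and> lax_cylinder C (AUT S) F' 1 P"
    by blast
qed

text \<open>The source and target of \<open>s f\<close> are prescribed by \<alpha> and the two
  functors, so the only information in this 2-cell is its middle element \<open>t f\<close>.\<close>

lemma lax_transformation_iff_factor_transformation:
  "(\<exists>\<alpha> s. lax_transformation (locally_discrete C) (AUT S) F F' \<alpha> s) \<longleftrightarrow>
    (\<exists>\<alpha> s. factor_transformation C S (fob F) (aut_map F) (factor F)
      (fob F') (aut_map F') (factor F') \<alpha> s)"
proof
  assume "\<exists>\<alpha> s. lax_transformation (locally_discrete C) (AUT S) F F' \<alpha> s"
  then obtain \<alpha> s where "lax_transformation (locally_discrete C) (AUT S) F F' \<alpha> s" by blast
  then interpret T: lax_transformation "locally_discrete C" "AUT S" F F' \<alpha> s .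
  define \<beta> where "\<beta> x = fst (snd (\<alpha> x))" for x
  define t where "t f = fst (snd (s f))" for f
  have \<alpha>: "\<alpha> x = (fob F x, \<beta> x, fob F' x)" "\<beta> x \<in> iso (fob F x) (fob F' x)" if "x \<in> Ob C" for x
  proof -
    have "\<alpha> x \<in> Ar (AUT S)"
      using PiE_mem[OF T.ar_ext] that by simp
    then show "\<alpha> x = (fob F x, \<beta> x, fob F' x)" "\<beta> x \<in> iso (fob F x) (fob F' x)"
      using T.ar_Dom[of x] T.ar_Cod[of x] that by (cases "\<alpha> x"; simp add: \<beta>_def)+
  qed
  have s: "s f = ((fob F (Dom C f), compose (carrier (fob F (Dom C f))) (\<beta> (Cod C f)) (aut_map F f), fob F' (Cod C f)),
      t f, (fob F (Dom C f), compose (carrier (fob F (Dom C f))) (aut_map F' f) (\<beta> (Dom C f)), fob F' (Cod C f)))"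
    "t f \<in> carrier (fob F' (Cod C f))"
    "a \<in> carrier (fob F (Dom C f)) \<Longrightarrow> aut_map F' f (\<beta> (Dom C f) a) \<otimes>\<^bsub>fob F' (Cod C f)\<^esub> t f =
      t f \<otimes>\<^bsub>fob F' (Cod C f)\<^esub> \<beta> (Cod C f) (aut_map F f a)" if f: "f \<in> Ar C" for f a
  proof -
    note d = F.Dom_in[OF f] F.Cod_in[OF f]
    have "Src (AUT S) (s f) = (fob F (Dom C f), compose (carrier (fob F (Dom C f))) (\<beta> (Cod C f)) (aut_map F f), fob F' (Cod C f))"
      "Trg (AUT S) (s f) = (fob F (Dom C f), compose (carrier (fob F (Dom C f))) (aut_map F' f) (\<beta> (Dom C f)), fob F' (Cod C f))"
      using T.cell_Src[of f] T.cell_Trg[of f] f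
      by (simp_all add: \<alpha>(1) d far_AUT(1)[OF C F f] far_AUT(1)[OF C F' f])
    then show e: "s f = ((fob F (Dom C f), compose (carrier (fob F (Dom C f))) (\<beta> (Cod C f)) (aut_map F f), fob F' (Cod C f)),
      t f, (fob F (Dom C f), compose (carrier (fob F (Dom C f))) (aut_map F' f) (\<beta> (Dom C f)), fob F' (Cod C f)))"
      by (cases "s f") (simp add: t_def)
    have m: "s f \<in> Cell (AUT S)"
      using PiE_mem[OF T.cell_ext] f by simp
    show "t f \<in> carrier (fob F' (Cod C f))"
      using m[unfolded e] by simp
    show "aut_map F' f (\<beta> (Dom C f) a) \<otimes>\<^bsub>fob F' (Cod C f)\<^esub> t f =
        t f \<otimes>\<^bsub>fob F' (Cod C f)\<^esub> \<beta> (Cod C f) (aut_map F f a)" if "a \<in> carrier (fob F (Dom C f))"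
      using m[unfolded e] that by (auto simp: compose_eq)
  qed
  have "factor_transformation C S (fob F) (aut_map F) (factor F) (fob F') (aut_map F') (factor F') \<beta> t"
  proof (intro factor_transformation.intro factor_transformation_axioms.intro)
    show "factor_set C S (fob F) (aut_map F) (factor F)" "factor_set C S (fob F') (aut_map F') (factor F')"
      by unfold_locales
  next
    fix x assume x: "x \<in> Ob C"
    show "\<beta> x \<in> iso (fob F x) (fob F' x)" by (rule \<alpha>(2)[OF x])
    show "t (One C x) = \<one>\<^bsub>fob F' x\<^esub>"
      using T.cell_One[of x] x by (simp add: t_def \<alpha>(1))
  next
    fix f g assume fg: "(f, g) \<in> composable C"
    note cs = F.Comp_simps[OF fg]
    note d = F.Dom_in[OF cs(1)] F.Cod_in[OF cs(1)] F.Cod_in[OF cs(2)]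
    interpret M: group "fob F' (Cod C g)" by (rule F'.group_b[OF d(3)])
    interpret L: group "fob F (Cod C f)" by (rule F.group_b[OF d(2)])
    \<comment> \<open>Images of the unit elements that whiskering with identity 2-cells
      produces.\<close>
    have 1: "aut_map F' (Comp C g f) \<one>\<^bsub>fob F' (Dom C f)\<^esub> = \<one>\<^bsub>fob F' (Cod C g)\<^esub>"
      "\<beta> (Cod C g) (aut_map F g \<one>\<^bsub>fob F (Cod C f)\<^esub>) = \<one>\<^bsub>fob F' (Cod C g)\<^esub>"
      using F'.u_unit[OF cs(4)] F.u_unit[OF cs(2)] iso_one[OF F.group_b F'.group_b \<alpha>(2)[OF d(3)]] d cs
      by simp_all
    have m: "\<beta> (Cod C g) (factor F f g) \<in> carrier (fob F' (Cod C g))"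
      "aut_map F' g (t f) \<in> carrier (fob F' (Cod C g))"
      using iso_in[OF \<alpha>(2)[OF d(3)] F.c_in[OF fg]] F'.u_in[OF cs(2)] s(2)[OF cs(1)] cs(3) by simp_all
    show "factor F' f g \<otimes>\<^bsub>fob F' (Cod C g)\<^esub> t (Comp C g f) =
      aut_map F' g (t f) \<otimes>\<^bsub>fob F' (Cod C g)\<^esub> (t g \<otimes>\<^bsub>fob F' (Cod C g)\<^esub> \<beta> (Cod C g) (factor F f g))"
      using T.coherence[of f g] fg F'.c_in[OF fg] s(2)[OF cs(2)] m
      by (simp add: \<alpha>(1) d cs s(1)[OF cs(1)] s(1)[OF cs(2)] s(1)[OF cs(4)]
        far_AUT(1)[OF C F cs(1)] far_AUT(1)[OF C F' cs(2)]
        fstr_AUT(1)[OF C F fg] fstr_AUT(1)[OF C F' fg] 1 compose_eq)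
  qed (rule s(2,3); assumption)+
  then show "\<exists>\<alpha> s. factor_transformation C S (fob F) (aut_map F) (factor F)
      (fob F') (aut_map F') (factor F') \<alpha> s" by blast
next
  assume "\<exists>\<alpha> s. factor_transformation C S (fob F) (aut_map F) (factor F)
      (fob F') (aut_map F') (factor F') \<alpha> s"
  then obtain \<beta>0 t where "factor_transformation C S (fob F) (aut_map F) (factor F)
      (fob F') (aut_map F') (factor F') \<beta>0 t" by blast
  then interpret T: factor_transformation C S "fob F" "aut_map F" "factor F" "fob F'" "aut_map F'" "factor F'" \<beta>0 t .
  \<comment> \<open>\<open>\<beta>0\<close> is constrained on carriers only; cutting it off makes it
    a 1-cell of \<open>AUT\<close>.\<close>
  define \<beta> where "\<beta> x = restrict (\<beta>0 x) (carrier (fob F x))" for x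
  have \<beta>: "\<beta> x \<in> iso (fob F x) (fob F' x)" "\<beta> x \<in> extensional (carrier (fob F x))"
    "\<And>a. a \<in> carrier (fob F x) \<Longrightarrow> \<beta> x a = \<beta>0 x a" if "x \<in> Ob C" for x
    using iso_cong[OF F.group_b[OF that] T.\<alpha>_iso[OF that], of "\<beta> x"] by (simp_all add: \<beta>_def)
  define \<alpha> where "\<alpha> = (\<lambda>x\<in>Ob C. (fob F x, \<beta> x, fob F' x))"
  define s where "s = (\<lambda>f\<in>Ar C.
    ((fob F (Dom C f), compose (carrier (fob F (Dom C f))) (\<beta> (Cod C f)) (aut_map F f), fob F' (Cod C f)),
      t f, (fob F (Dom C f), compose (carrier (fob F (Dom C f))) (aut_map F' f) (\<beta> (Dom C f)), fob F' (Cod C f))))"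
  have "lax_transformation (locally_discrete C) (AUT S) F F' \<alpha> s"
  proof (rule lax_transformation.intro)
    show "\<alpha> \<in> Ob (locally_discrete C) \<rightarrow>\<^sub>E Ar (AUT S)"
      using \<beta> F.b_in F'.b_in by (auto simp: \<alpha>_def)
    have "s f \<in> Cell (AUT S)" if f: "f \<in> Ar C" for f
    proof -
      note d = F.Dom_in[OF f] F.Cod_in[OF f]
      have "aut_map F' f (\<beta> (Dom C f) a) \<otimes>\<^bsub>fob F' (Cod C f)\<^esub> t f =
          t f \<otimes>\<^bsub>fob F' (Cod C f)\<^esub> \<beta> (Cod C f) (aut_map F f a)" if "a \<in> carrier (fob F (Dom C f))" for a
        using T.s_natural[OF f that] \<beta>(3)[OF d(1) that] \<beta>(3)[OF d(2) F.u_in[OF f that]] by simp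
      then show ?thesis
        using f d F.b_in F'.b_in T.s_in[OF f]
          iso_compose[OF F.group_b[OF d(1)] F.u_iso[OF f] \<beta>(1)[OF d(2)]]
          iso_compose[OF F.group_b[OF d(1)] \<beta>(1)[OF d(1)] F'.u_iso[OF f]]
        by (simp add: s_def compose_eq)
    qed
    then show "s \<in> Ar (locally_discrete C) \<rightarrow>\<^sub>E Cell (AUT S)"
      by (auto simp: s_def)
  next
    fix x assume x: "x \<in> Ob (locally_discrete C)"
    then show "Dom (AUT S) (\<alpha> x) = fob F x" "Cod (AUT S) (\<alpha> x) = fob F' x"
      by (simp_all add: \<alpha>_def)
    have x: "x \<in> Ob C" using x by simp
    have "aut_map F (One C x) = (\<lambda>a\<in>carrier (fob F x). a)" "aut_map F' (One C x) = (\<lambda>a\<in>carrier (fob F' x). a)"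
      using lax_functor_discreteD(5)[OF C F x] lax_functor_discreteD(5)[OF C F' x] by (simp_all add: aut_map_def)
    moreover have "compose (carrier (fob F x)) (\<lambda>a\<in>carrier (fob F' x). a) (\<beta> x) = \<beta> x"
      "compose (carrier (fob F x)) (\<beta> x) (\<lambda>a\<in>carrier (fob F x). a) = \<beta> x"
      using Id_compose[OF _ \<beta>(2)[OF x]] compose_Id[OF _ \<beta>(2)[OF x]] iso_in[OF \<beta>(1)[OF x]]
      by blast+
    ultimately show "s (One (locally_discrete C) x) = Id2 (AUT S) (\<alpha> x)"
      using F.One_in[OF x] x by (simp add: s_def \<alpha>_def T.s_One)
  next
    fix f assume "f \<in> Ar (locally_discrete C)"
    then have f: "f \<in> Ar C" by simp
    note d = F.Dom_in[OF f] F.Cod_in[OF f]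
    show "Src (AUT S) (s f) = Comp (AUT S) (\<alpha> (Cod (locally_discrete C) f)) (far F f)"
      "Trg (AUT S) (s f) = Comp (AUT S) (far F' f) (\<alpha> (Dom (locally_discrete C) f))"
      using f d by (simp_all add: s_def \<alpha>_def far_AUT(1)[OF C F f] far_AUT(1)[OF C F' f])
  next
    fix f assume "f \<in> Cell (locally_discrete C)"
    then have f: "f \<in> Ar C" by simp
    note d = F.Dom_in[OF f] F.Cod_in[OF f]
    interpret M: group "fob F' (Cod C f)" by (rule F'.group_b[OF d(2)])
    have "\<beta> (Cod C f) \<one>\<^bsub>fob F (Cod C f)\<^esub> = \<one>\<^bsub>fob F' (Cod C f)\<^esub>"
      using iso_one[OF F.group_b F'.group_b \<beta>(1)[OF d(2)]] d by simp
    then show "VComp (AUT S) (s (Trg (locally_discrete C) f))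
        (whisker_left (AUT S) (\<alpha> (Cod (locally_discrete C) (Src (locally_discrete C) f))) (fcell F f)) =
      VComp (AUT S) (whisker_right (AUT S) (fcell F' f) (\<alpha> (Dom (locally_discrete C) (Src (locally_discrete C) f))))
        (s (Src (locally_discrete C) f))"
      using f d T.s_in[OF f] F'.u_unit[OF f]
      by (simp add: s_def \<alpha>_def lax_functor_discreteD(6)[OF C F f] lax_functor_discreteD(6)[OF C F' f]
        far_AUT(1)[OF C F f] far_AUT(1)[OF C F' f])
  next
    fix f g assume "(f, g) \<in> composable (locally_discrete C)"
    then have fg: "(f, g) \<in> composable C" by simp
    note cs = F.Comp_simps[OF fg]
    note d = F.Dom_in[OF cs(1)] F.Cod_in[OF cs(1)] F.Cod_in[OF cs(2)]
    interpret M: group "fob F' (Cod C g)" by (rule F'.group_b[OF d(3)])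
    interpret L: group "fob F (Cod C f)" by (rule F.group_b[OF d(2)])
    have 1: "aut_map F' (Comp C g f) \<one>\<^bsub>fob F' (Dom C f)\<^esub> = \<one>\<^bsub>fob F' (Cod C g)\<^esub>"
      "\<beta> (Cod C g) (aut_map F g \<one>\<^bsub>fob F (Cod C f)\<^esub>) = \<one>\<^bsub>fob F' (Cod C g)\<^esub>"
      using F'.u_unit[OF cs(4)] F.u_unit[OF cs(2)] iso_one[OF F.group_b F'.group_b \<beta>(1)[OF d(3)]] d cs
      by simp_all
    have m: "\<beta>0 (Cod C g) (factor F f g) \<in> carrier (fob F' (Cod C g))"
      "aut_map F' g (t f) \<in> carrier (fob F' (Cod C g))"
      "\<beta> (Cod C g) (factor F f g) = \<beta>0 (Cod C g) (factor F f g)"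
      using T.\<alpha>_in[OF d(3) F.c_in[OF fg]] F'.u_in[OF cs(2)] T.s_in[OF cs(1)] cs(3)
        \<beta>(3)[OF d(3) F.c_in[OF fg]] by simp_all
    have p: "aut_map F g \<in> carrier (fob F (Cod C f)) \<rightarrow> carrier (fob F (Cod C g))"
      "aut_map F f \<in> carrier (fob F (Dom C f)) \<rightarrow> carrier (fob F (Cod C f))"
      "\<beta> (Dom C f) \<in> carrier (fob F (Dom C f)) \<rightarrow> carrier (fob F' (Dom C f))"
      using F.u_in[OF cs(2)] F.u_in[OF cs(1)] iso_in[OF \<beta>(1)[OF d(1)]] cs(3) by simp_all
    \<comment> \<open>The two sides of the coherence equation end in composites that are bracketed
      differently.\<close>
    have q: "compose (carrier (fob F (Dom C f)))
        (compose (carrier (fob F' (Dom C f))) (aut_map F' g) (aut_map F' f)) (\<beta> (Dom C f)) =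
      compose (carrier (fob F (Dom C f))) (aut_map F' g)
        (compose (carrier (fob F (Dom C f))) (aut_map F' f) (\<beta> (Dom C f)))"
      by (rule compose_assoc[OF p(3), symmetric])
    show "VComp (AUT S) (whisker_right (AUT S) (fstr F' (f, g)) (\<alpha> (Dom (locally_discrete C) f)))
        (s (Comp (locally_discrete C) g f)) =
      VComp (AUT S) (whisker_left (AUT S) (far F' g) (s f))
        (VComp (AUT S) (whisker_right (AUT S) (s g) (far F f))
          (whisker_left (AUT S) (\<alpha> (Cod (locally_discrete C) g)) (fstr F (f, g))))"
      using T.s_coherence[OF fg] F'.c_in[OF fg] T.s_in[OF cs(2)] m
      by (simp add: \<alpha>_def d cs s_def far_AUT(1)[OF C F cs(1)] far_AUT(1)[OF C F' cs(2)]
        fstr_AUT(1)[OF C F fg] fstr_AUT(1)[OF C F' fg] 1 compose_eq q)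
  qed
  then show "\<exists>\<alpha> s. lax_transformation (locally_discrete C) (AUT S) F F' \<alpha> s" by blast
qed

lemma homotopy_iff_lax_transformation:
  "(\<exists>H. homotopy (Ner (locally_discrete C)) (Ner (AUT S)) (nerve_map C (AUT S) F)
      (nerve_map C (AUT S) F') H) \<longleftrightarrow>
    (\<exists>\<alpha> s. lax_transformation (locally_discrete C) (AUT S) F F' \<alpha> s)"
  using homotopy_nerve_map_iff[OF C two_category_AUT F F'] lax_cylinder_iff_factor_transformation
    lax_transformation_iff_factor_transformation by simp

end

end

section \<open>Connected components\<close>

text \<open>Symmetry and transitivity contract a zigzag to a single step; the disjunct
  \<open>x = y\<close> accounts for zigzags of length zero.\<close>

lemma components_eq:
  assumes sym: "\<And>x y. x \<in> S \<Longrightarrow> y \<in> S \<Longrightarrow> R x y \<Longrightarrow> R y x"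
    and trans: "\<And>x y z. x \<in> S \<Longrightarrow> y \<in> S \<Longrightarrow> z \<in> S \<Longrightarrow> R x y \<Longrightarrow> R y z \<Longrightarrow> R x z"
  shows "components S R = S // {(x, y). x \<in> S \<and> y \<in> S \<and> (x = y \<or> R x y)}"
proof -
  have "equivclp (\<lambda>a b. a \<in> S \<and> b \<in> S \<and> R a b) x y \<longleftrightarrow> x = y \<or> R x y" if "x \<in> S" "y \<in> S" for x y
  proof
    assume "equivclp (\<lambda>a b. a \<in> S \<and> b \<in> S \<and> R a b) x y"
    then have "y = x \<or> y \<in> S \<and> R x y"
    proof (induction rule: equivclp_induct)
      case (step y z)
      then show ?case
        using sym trans \<open>x \<in> S\<close> by metis
    qed simp
    then show "x = y \<or> R x y" by auto
  next
    assume "x = y \<or> R x y"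
    then show "equivclp (\<lambda>a b. a \<in> S \<and> b \<in> S \<and> R a b) x y"
      using that by (auto intro: r_into_equivclp)
  qed
  then have "{(x, y). x \<in> S \<and> y \<in> S \<and> equivclp (\<lambda>a b. a \<in> S \<and> b \<in> S \<and> R a b) x y} =
      {(x, y). x \<in> S \<and> y \<in> S \<and> (x = y \<or> R x y)}"
    by auto
  then show ?thesis
    by (simp add: components_def)
qed

text \<open>\<open>R\<close> is symmetric and transitive on all of \<open>L\<close>, so two elements
  of \<open>L'\<close> joined by a zigzag in \<open>L\<close> are equal or related in one step,
  hence joined within \<open>L'\<close>. Thus distinct components of \<open>L'\<close> do not merge
  in \<open>L\<close>, and along \<open>N\<close> they correspond to the components of
  \<open>M\<close> that meet the image of \<open>L'\<close>.\<close>

lemma bij_betw_components: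
  assumes N: "bij_betw N L M" and sub: "L' \<subseteq> L"
    and R: "\<And>x y. x \<in> L \<Longrightarrow> y \<in> L \<Longrightarrow> R' (N x) (N y) \<longleftrightarrow> R x y"
    and sym: "\<And>x y. x \<in> L \<Longrightarrow> y \<in> L \<Longrightarrow> R x y \<Longrightarrow> R y x"
    and trans: "\<And>x y z. x \<in> L \<Longrightarrow> y \<in> L \<Longrightarrow> z \<in> L \<Longrightarrow> R x y \<Longrightarrow> R y z \<Longrightarrow> R x z"
  shows "\<exists>\<Phi>. bij_betw \<Phi> (components L' R) {c \<in> components M R'. \<exists>x\<in>L'. N x \<in> c}"
proof -
  define E where "E = {(x, y). x \<in> L \<and> y \<in> L \<and> (x = y \<or> R x y)}"
  define E' where "E' = {(x, y). x \<in> L' \<and> y \<in> L' \<and> (x = y \<or> R x y)}"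
  define EM where "EM = {(x, y). x \<in> M \<and> y \<in> M \<and> (x = y \<or> R' x y)}"
  have cL': "components L' R = L' // E'"
    unfolding E'_def by (rule components_eq) (use sym trans sub in blast)+
  have surj: "\<exists>x\<in>L. m = N x" if "m \<in> M" for m
    using N that by (auto simp: bij_betw_def)
  have N_in: "N x \<in> M" if "x \<in> L" for x
    using N that by (auto simp: bij_betw_def)
  have inj: "N x = N y \<longleftrightarrow> x = y" if "x \<in> L" "y \<in> L" for x y
    using N that by (auto simp: bij_betw_def inj_on_def)
  have cM: "components M R' = M // EM"
    unfolding EM_def
  proof (rule components_eq)
    fix x y assume "x \<in> M" "y \<in> M" "R' x y"
    then show "R' y x"
      using surj[of x] surj[of y] R sym by metis
  next
    fix x y z assume "x \<in> M" "y \<in> M" "z \<in> M" "R' x y" "R' y z"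
    then show "R' x z"
      using surj[of x] surj[of y] surj[of z] R trans by metis
  qed
  have EM: "(N x, N y) \<in> EM \<longleftrightarrow> x = y \<or> R x y" if "x \<in> L" "y \<in> L" for x y
    using that by (simp add: EM_def N_in inj R)
  have eqM: "equiv M EM"
  proof (rule equivI)
    show "EM \<subseteq> M \<times> M" by (auto simp: EM_def)
    show "refl_on M EM" by (auto simp: EM_def refl_on_def)
    show "sym EM"
    proof (rule symI)
      fix x y assume xy: "(x, y) \<in> EM"
      then have "x \<in> M" "y \<in> M"
        by (simp_all add: EM_def)
      then obtain a b where ab: "a \<in> L" "b \<in> L" and "x = N a" "y = N b"
        using surj[of x] surj[of y] by blast
      then show "(y, x) \<in> EM"
        using xy EM[of a b] EM[of b a] sym[OF ab] by auto
    qed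
    show "trans EM"
    proof (rule transI)
      fix x y z assume xyz: "(x, y) \<in> EM" "(y, z) \<in> EM"
      then have "x \<in> M" "y \<in> M" "z \<in> M"
        by (simp_all add: EM_def)
      then obtain a b c where abc: "a \<in> L" "b \<in> L" "c \<in> L" and "x = N a" "y = N b" "z = N c"
        using surj[of x] surj[of y] surj[of z] by blast
      then show "(x, z) \<in> EM"
        using xyz EM[of a b] EM[of b c] EM[of a c] trans[OF abc] by auto
    qed
  qed
  have E'_iff: "(x, y) \<in> E' \<longleftrightarrow> (N x, N y) \<in> EM" if "x \<in> L'" "y \<in> L'" for x y
    using that sub EM[of x y] by (auto simp: E'_def)
  have eq': "equiv L' E'"
  proof (rule equivI)
    show "E' \<subseteq> L' \<times> L'" by (auto simp: E'_def)
    show "refl_on L' E'" by (auto simp: E'_def refl_on_def)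
    show "sym E'" using sym sub by (auto simp: sym_def E'_def)
    show "trans E'"
      unfolding E'_def using trans sub by (intro transI) blast
  qed
  \<comment> \<open>The image of a component under \<open>N\<close> may miss members of its class
    that do not come from \<open>L'\<close>, so it is saturated.\<close>
  define \<Phi> where "\<Phi> k = EM `` (N ` k)" for k
  have \<Phi>: "\<Phi> (E' `` {x}) = EM `` {N x}" if "x \<in> L'" for x
  proof -
    have "(N x, m) \<in> EM" if "y \<in> E' `` {x}" "(N y, m) \<in> EM" for y m
    proof -
      have "y \<in> L'" "(x, y) \<in> E'"
        using that(1) by (auto simp: E'_def)
      then have "(N x, N y) \<in> EM"
        using E'_iff \<open>x \<in> L'\<close> by blast
      then show ?thesis
        using that(2) eqM by (meson equiv_def transE)
    qed
    moreover have "x \<in> E' `` {x}"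
      using that by (simp add: E'_def)
    ultimately show ?thesis
      by (auto simp: \<Phi>_def)
  qed
  have "bij_betw \<Phi> (L' // E') {k \<in> M // EM. \<exists>x\<in>L'. N x \<in> k}"
    unfolding bij_betw_def
  proof (intro conjI)
    show "inj_on \<Phi> (L' // E')"
    proof (rule inj_onI)
      fix k l assume "k \<in> L' // E'" "l \<in> L' // E'" and eq: "\<Phi> k = \<Phi> l"
      then obtain x y where x: "x \<in> L'" "k = E' `` {x}" and y: "y \<in> L'" "l = E' `` {y}"
        by (auto simp: quotient_def)
      have "(N x, N y) \<in> EM"
        using eq eq_equiv_class[OF _ eqM, of "N x" "N y"] N_in sub x y by (auto simp: \<Phi>)
      then show "k = l"
        using E'_iff x y equiv_class_eq[OF eq'] by auto
    qed
    show "\<Phi> ` (L' // E') = {k \<in> M // EM. \<exists>x\<in>L'. N x \<in> k}"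
    proof (intro equalityI subsetI)
      fix k assume "k \<in> \<Phi> ` (L' // E')"
      then obtain x where x: "x \<in> L'" "k = EM `` {N x}"
        by (auto simp: quotient_def \<Phi>)
      then have "k \<in> M // EM" "N x \<in> k"
        using N_in sub equiv_class_self[OF eqM, of "N x"] by (auto intro: quotientI)
      then show "k \<in> {k \<in> M // EM. \<exists>x\<in>L'. N x \<in> k}"
        using x by blast
    next
      fix k assume "k \<in> {k \<in> M // EM. \<exists>x\<in>L'. N x \<in> k}"
      then obtain x where x: "x \<in> L'" "N x \<in> k" "k \<in> M // EM" by blast
      then have "k = EM `` {N x}"
        by (metis Image_singleton_iff eqM equiv_class_eq quotientE)
      then have "k = \<Phi> (E' `` {x})"
        using \<Phi>[OF x(1)] by simp
      then show "k \<in> \<Phi> ` (L' // E')"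
        using quotientI[OF x(1), of E'] by blast
    qed
  qed
  then show ?thesis
    unfolding cL' cM by blast
qed

theorem theorem5p1:
  fixes G :: "('o, 'm) cat" and K :: "'o \<Rightarrow> 'k monoid"
  assumes "groupoid G"
    and "\<And>x. x \<in> Ob G \<Longrightarrow> group (K x)"
  shows "\<exists>\<Phi>. bij_betw \<Phi> (H2 G K)
    {c \<in> homotopy_classes (Ner (locally_discrete G)) (Ner (AUT (K ` Ob G))).
       \<exists>\<phi>\<in>c. over_objects G K \<phi>}"
proof -
  interpret G: groupoid G by fact
  interpret group_family "K ` Ob G"
    by (rule group_family.intro) (use assms(2) in auto)
  have G: "category G" by unfold_locales
  let ?A = "AUT (K ` Ob G)" and ?X = "Ner (locally_discrete G)"
  let ?L = "{F. lax_functor (locally_discrete G) ?A F}"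
  let ?M = "{\<phi>. simplicial_map ?X (Ner ?A) \<phi>}"
  let ?R = "\<lambda>E F. \<exists>\<alpha> s. lax_transformation (locally_discrete G) ?A E F \<alpha> s"
  let ?N = "nerve_map G ?A"
  have N: "bij_betw ?N ?L ?M"
    by (rule bij_betw_nerve_map[OF G two_category_AUT])
  \<comment> \<open>Every object of \<open>G\<close> is the vertex of some \<open>point G x\<close>,
    so the condition on 0-simplices is the condition on objects.\<close>
  have over: "over_objects G K (?N F) \<longleftrightarrow> F \<in> LaxFun_over G K" if F: "F \<in> ?L" for F
  proof -
    have F: "lax_functor (locally_discrete G) ?A F" using F by simp
    have *: "fob (?N F 0 \<sigma>) 0 = fob F (fob \<sigma> 0)" if "\<sigma> \<in> Simp ?X 0" for \<sigma>
      using nerve_map(2)[OF G two_category_AUT F, of 0 \<sigma> 0] that by simp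
    have "(\<forall>\<sigma>\<in>Simp ?X 0. fob F (fob \<sigma> 0) = K (fob \<sigma> 0)) \<longleftrightarrow> (\<forall>x\<in>Ob G. fob F x = K x)"
    proof (intro iffI ballI)
      fix x assume a: "\<forall>\<sigma>\<in>Simp ?X 0. fob F (fob \<sigma> 0) = K (fob \<sigma> 0)" and x: "x \<in> Ob G"
      show "fob F x = K x"
        using bspec[OF a, of "point G x"] lax_functor_point[OF G x] by simp
    next
      fix \<sigma> assume a: "\<forall>x\<in>Ob G. fob F x = K x" and "\<sigma> \<in> Simp ?X 0"
      then show "fob F (fob \<sigma> 0) = K (fob \<sigma> 0)"
        using lax_functor_discreteD(1)[OF category_ordinal_cat, of 0 "locally_discrete G" \<sigma> 0] by simp
    qed
    then show ?thesis
      using F * by (simp add: over_objects_def LaxFun_over_def del: Ner_simps)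
  qed
  \<comment> \<open>Through this translation lax transformations inherit symmetry and transitivity
    from factor transformations.\<close>
  have iff: "?R E F \<longleftrightarrow> (\<exists>\<alpha> s. factor_transformation G (K ` Ob G) (fob E) (aut_map E) (factor E)
      (fob F) (aut_map F) (factor F) \<alpha> s)" if "E \<in> ?L" "F \<in> ?L" for E F
    using lax_transformation_iff_factor_transformation[OF G] that by blast
  have "\<exists>\<Phi>. bij_betw \<Phi> (components (LaxFun_over G K) ?R)
    {c \<in> components ?M (\<lambda>\<phi> \<psi>. \<exists>H. homotopy ?X (Ner ?A) \<phi> \<psi> H). \<exists>F\<in>LaxFun_over G K. ?N F \<in> c}"
  proof (rule bij_betw_components[OF N])
    show "LaxFun_over G K \<subseteq> ?L"
      by (auto simp: LaxFun_over_def)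
  next
    fix E F assume "E \<in> ?L" "F \<in> ?L"
    then show "(\<exists>H. homotopy ?X (Ner ?A) (?N E) (?N F) H) \<longleftrightarrow> ?R E F"
      using homotopy_iff_lax_transformation[OF G] by blast
  next
    fix E F assume "E \<in> ?L" "F \<in> ?L" "?R E F"
    then show "?R F E"
      using iff[of E F] iff[of F E] factor_transformation_sym[of G "K ` Ob G"] by metis
  next
    fix D E F assume "D \<in> ?L" "E \<in> ?L" "F \<in> ?L" "?R D E" "?R E F"
    then show "?R D F"
      using iff[of D E] iff[of E F] iff[of D F] factor_transformation_trans[of G "K ` Ob G"] by metis
  qed
  \<comment> \<open>All members of a class are nerve maps of lax 2-functors, so \<open>over\<close>
    identifies the two ways of selecting classes.\<close>
  moreover have "(\<exists>F\<in>LaxFun_over G K. ?N F \<in> c) \<longleftrightarrow> (\<exists>\<phi>\<in>c. over_objects G K \<phi>)"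
    if c: "c \<in> components ?M (\<lambda>\<phi> \<psi>. \<exists>H. homotopy ?X (Ner ?A) \<phi> \<psi> H)" for c
  proof
    assume "\<exists>F\<in>LaxFun_over G K. ?N F \<in> c"
    then show "\<exists>\<phi>\<in>c. over_objects G K \<phi>"
      using over by (auto simp: LaxFun_over_def)
  next
    assume "\<exists>\<phi>\<in>c. over_objects G K \<phi>"
    then obtain \<phi> where \<phi>: "\<phi> \<in> c" "over_objects G K \<phi>" by blast
    have "c \<subseteq> ?M"
      using c by (auto simp: components_def quotient_def)
    then obtain F where "F \<in> ?L" "\<phi> = ?N F"
      using \<phi>(1) N by (auto simp: bij_betw_def)
    then show "\<exists>F\<in>LaxFun_over G K. ?N F \<in> c"
      using \<phi> over by blast
  qed
  ultimately show ?thesis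
    unfolding H2_def homotopy_classes_def by (simp cong: conj_cong)
qed

end
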